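(* Let $d=2$, write $x,y$ for the two variables, and let $\varphi=M_\Xi$ be the bivariate $C^2$ piecewise quartic box spline with $\Xi=\begin{bmatrix}1&1&0&0&1&1\\0&0&1&1&1&1\end{bmatrix}$, so that $H=2^{-6}(1+x)^2(1+y)^2(1+xy)^2$. Let $c=2^6\cdot362880$ and write $\overline{cH}\,\Phi=w_{0,0}+w_{1,0}x^{-1}+w_{0,1}y^{-1}+w_{1,1}x^{-1}y^{-1}$ with $w_{s,t}\in\mathcal{L}_\downarrow$. Explicitly, $$w_{0,0}=1884x^2y^2+14088x^2+14088y^2+1884x^2y^{-2}+555000+1884x^{-2}y^2+555000y^{-2}+555000x^{-2}+14088y^{-4}+2380248x^{-2}y^{-2}+14088x^{-4}+555000x^{-2}y^{-4}+555000x^{-4}y^{-2}+1884x^{-2}y^{-6}+555000x^{-4}y^{-4}+1884x^{-6}y^{-2}+14088x^{-4}y^{-6}+14088x^{-6}y^{-4}+1884x^{-6}y^{-6},$$ $$w_{1,0}=38x^4y^2+104x^4+8890x^2y^2+2x^4y^{-2}+163440x^2+8890y^2+69054x^2y^{-2}+811088+38x^{-2}y^2+104x^2y^{-4}+1677952y^{-2}+163440x^{-2}+163440y^{-4}+1677952x^{-2}y^{-2}+104x^{-4}+38y^{-6}+811088x^{-2}y^{-4}+69054x^{-4}y^{-2}+8890x^{-2}y^{-6}+163440x^{-4}y^{-4}+2x^{-6}y^{-2}+8890x^{-4}y^{-6}+104x^{-6}y^{-4}+38x^{-6}y^{-6},$$ $$w_{1,1}=2x^4y^4+104x^4y^2+104x^2y^4+38x^4+69054x^2y^2+38y^4+163440x^2+163440y^2+8890x^2y^{-2}+1677952+8890x^{-2}y^2+811088y^{-2}+811088x^{-2}+8890y^{-4}+1677952x^{-2}y^{-2}+8890x^{-4}+163440x^{-2}y^{-4}+163440x^{-4}y^{-2}+38x^{-2}y^{-6}+69054x^{-4}y^{-4}+38x^{-6}y^{-2}+104x^{-4}y^{-6}+104x^{-6}y^{-4}+2x^{-6}y^{-6},$$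 and $w_{0,1}(x,y)=w_{1,0}(y,x)$. Put $H_{1,0}=w_{1,0}-w_{0,0}x$, $H_{0,1}=w_{0,1}-w_{0,0}y$, $H_{1,1}=w_{1,1}-w_{0,0}xy$. Then $\{H,H_{1,0},H_{0,1},H_{1,1}\}$ is a basis of $\mathcal{L}(\ell_1)$ over $\mathcal{L}_\downarrow(\ell_1)$ and $\langle H,H_s\rangle_\Phi=0$ for all $s\in E\setminus\{0\}$; consequently the compactly supported functions $\psi_s$ with masks $H_s$, $s\in E\setminus\{0\}$, are prewavelets for the multiresolution analysis generated by $\varphi$. Moreover $H_{0,1}(x,y)=H_{1,0}(y,x)$, and each of $H_{1,0},H_{0,1},H_{1,1}$ has exactly $43$ nonzero coefficients, in total $129$.
   Context: $E=\{0,1\}^d$; $\mathbb{T}^d=\{\zeta\in\mathbb{C}^d:|\zeta_j|=1\}$. $\mathcal{L}$ is the ring of Laurent polynomials over $\mathbb{C}$; $\mathcal{L}(\ell_1)$ (resp. $\mathcal{L}(\ell_2)$) is the set of Laurent series $\sum_{k\in\mathbb{Z}^d}a_k\zeta^k$ with $a\in\ell_1(\mathbb{Z}^d)$ (resp. $\ell_2$), as functions on $\mathbb{T}^d$; $\mathcal{L}_\downarrow=\{P(\zeta^2):P\in\mathcal{L}\}$ and $\mathcal{L}_\downarrow(\ell_1)=\{F(\zeta^2):F\in\mathcal{L}(\ell_1)\}$, $\zeta^2=(\zeta_1^2,\dots,\zeta_d^2)$. Conjugation: $\overline{\sum a_k\zeta^k}=\sum\overline{a_k}\zeta^{-k}$.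 Fourier transform: $\hat f(u)=\int f(x)e^{-iu^Tx}dx$. The box spline $M_\Xi$ of a full-rank integer matrix $\Xi=[\xi_1,\dots,\xi_\ell]\in\mathbb{Z}^{d\times\ell}$ is given by $\widehat{M}_\Xi(u)=\prod_{j=1}^\ell\frac{1-e^{-i\xi_j^Tu}}{i\xi_j^Tu}$, and $\hat\varphi(2u)=H(e^{-iu})\hat\varphi(u)$ for $\varphi=M_\Xi$ with $H(\zeta)=2^{-\ell}\prod_j(1+\zeta^{\xi_j})$. $\Phi(\zeta)=\sum_{k\in\mathbb{Z}^d}\tilde\varphi(k)\zeta^k$, where $\tilde\varphi(u)=\int\varphi(t)\overline{\varphi(t-u)}dt$; here $\Phi=\frac1{362880}\big(94992+37742(x+x^{-1}+y+y^{-1}+xy+x^{-1}y^{-1})+5100(x^{-1}y+xy^{-1}+x^2y+x^{-2}y^{-1}+xy^2+x^{-1}y^{-2})+1736(x^2+x^{-2}+y^2+y^{-2}+x^2y^2+x^{-2}y^{-2})+34(x^{-2}y+x^2y^{-1}+x^3y+x^{-3}y^{-1}+x^{-1}y^2+xy^{-2}+x^3y^2+x^{-3}y^{-2}+xy^3+x^{-1}y^{-3}+x^2y^3+x^{-2}y^{-3})+2(x^3+x^{-3}+y^3+y^{-3}+x^3y^3+x^{-3}y^{-3})\big)$. $\langle F,G\rangle_\Phi(\zeta)=\sum_{s\in E}\Phi((-1)^s\zeta)F((-1)^s\zeta)\overline{G((-1)^s\zeta)}$ with $(-1)^s\zeta=((-1)^{s_1}\zeta_1,\dots,(-1)^{s_d}\zeta_d)$.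 $V_0=\{f\in L_2(\mathbb{R}^d):\hat f(u)=F(e^{-iu})\hat\varphi(u),\ F\in\mathcal{L}(\ell_2)\}$; $F$ is called the mask of $f$. $V_{-1}=\{f\in L_2(\mathbb{R}^d):\hat f(u)=\hat g(2u),\ g\in V_0\}\subset V_0$, and $W_0$ is the orthogonal complement of $V_{-1}$ in $V_0$. Functions $\psi_s\in W_0$, $s\in S$ ($S$ finite), are prewavelets if $\{\psi_s(\cdot-2k):s\in S,k\in\mathbb{Z}^d\}$ is a Riesz basis of $W_0$. *)

theory Defs
  imports "HOL-Analysis.Analysis" "HOL-Library.Poly_Mapping"
begin

text \<open>The ring of Laurent polynomials is the group algebra of \<open>int \<times> int\<close>: multiplication in
  \<open>poly_mapping\<close> is convolution, so \<open>mon i j\<close> is \<open>x\<^sup>i y\<^sup>j\<close>.\<close>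

type_synonym lpoly = "(int \<times> int) \<Rightarrow>\<^sub>0 complex"

definition C :: "complex \<Rightarrow> lpoly" where
  "C c = Poly_Mapping.single 0 c"

definition mon :: "int \<Rightarrow> int \<Rightarrow> lpoly" where
  "mon i j = Poly_Mapping.single (i, j) 1"

definition zpow :: "complex \<times> complex \<Rightarrow> int \<times> int \<Rightarrow> complex" where
  "zpow \<zeta> k = fst \<zeta> powi fst k * snd \<zeta> powi snd k"

definition leval :: "lpoly \<Rightarrow> complex \<times> complex \<Rightarrow> complex" where
  "leval P \<zeta> = (\<Sum>k\<in>Poly_Mapping.keys P. Poly_Mapping.lookup P k * zpow \<zeta> k)"

text \<open>Since \<open>lookup (map_key f P) = lookup P \<circ> f\<close> for injective \<open>f\<close>, the next two operations are
  \<open>\<Sum> a\<^sub>k \<zeta>\<^sup>k \<mapsto> \<Sum> cnj a\<^sub>k \<zeta>^(-k)\<close> and \<open>P(x, y) \<mapsto> P(y, x)\<close>.\<close>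

definition lconj :: "lpoly \<Rightarrow> lpoly" where
  "lconj P = Poly_Mapping.map_key uminus (Poly_Mapping.map cnj P)"

definition lswap :: "lpoly \<Rightarrow> lpoly" where
  "lswap P = Poly_Mapping.map_key prod.swap P"

definition ldilate :: "lpoly \<Rightarrow> lpoly" where
  "ldilate P = (\<Sum>k\<in>Poly_Mapping.keys P. Poly_Mapping.single (k + k) (Poly_Mapping.lookup P k))"

definition Ldown :: "lpoly set" where
  "Ldown = range ldilate"

definition E :: "(nat \<times> nat) set" where
  "E = {0, 1} \<times> {0, 1}"

text \<open>A function on the torus is represented by a function on the whole of \<open>complex \<times> complex\<close>
  whose values off the torus are irrelevant (and, for the \<open>\<ell>\<^sub>2\<close> case, is only determined almost
  everywhere).\<close>

definition torus :: "(complex \<times> complex) set" where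
  "torus = {\<zeta>. cmod (fst \<zeta>) = 1 \<and> cmod (snd \<zeta>) = 1}"

definition zsq :: "complex \<times> complex \<Rightarrow> complex \<times> complex" where
  "zsq \<zeta> = ((fst \<zeta>)\<^sup>2, (snd \<zeta>)\<^sup>2)"

definition zflip :: "nat \<times> nat \<Rightarrow> complex \<times> complex \<Rightarrow> complex \<times> complex" where
  "zflip s \<zeta> = ((-1) ^ fst s * fst \<zeta>, (-1) ^ snd s * snd \<zeta>)"

definition expm :: "real \<times> real \<Rightarrow> complex \<times> complex" where
  "expm u = (cis (- fst u), cis (- snd u))"

definition L_l1 :: "(complex \<times> complex \<Rightarrow> complex) set" where
  "L_l1 = {F. \<exists>a :: int \<times> int \<Rightarrow> complex. (\<lambda>k. cmod (a k)) summable_on UNIV \<and>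
                (\<forall>\<zeta>\<in>torus. F \<zeta> = (\<Sum>\<^sub>\<infinity>k. a k * zpow \<zeta> k))}"

definition Ldown_l1 :: "(complex \<times> complex \<Rightarrow> complex) set" where
  "Ldown_l1 = {G. \<exists>F\<in>L_l1. \<forall>\<zeta>\<in>torus. G \<zeta> = F (zsq \<zeta>)}"

text \<open>For \<open>a \<in> \<ell>\<^sub>2\<close> the series converges in \<open>L\<^sub>2\<close> of the torus.\<close>

definition L_l2 :: "(complex \<times> complex \<Rightarrow> complex) set" where
  "L_l2 = {F. (\<lambda>u. F (expm u)) \<in> borel_measurable borel \<and>
     (\<exists>a :: int \<times> int \<Rightarrow> complex. (\<lambda>k. (cmod (a k))\<^sup>2) summable_on UNIV \<and>
        (\<lambda>n::nat. \<integral>\<^sup>+u\<in>{-pi..pi} \<times> {-pi..pi}.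
            ennreal ((cmod (F (expm u) -
              (\<Sum>k\<in>{-int n..int n} \<times> {-int n..int n}. a k * zpow (expm u) k)))\<^sup>2) \<partial>lborel)
          \<longlonglongrightarrow> 0)}"

definition torus_basis ::
  "(complex \<times> complex \<Rightarrow> complex) set \<Rightarrow> (complex \<times> complex \<Rightarrow> complex) set \<Rightarrow> 's set \<Rightarrow>
   ('s \<Rightarrow> complex \<times> complex \<Rightarrow> complex) \<Rightarrow> bool" where
  "torus_basis R M I B \<longleftrightarrow> finite I \<and> (\<forall>i\<in>I. B i \<in> M) \<and>
     (\<forall>F\<in>M. \<exists>c. (\<forall>i\<in>I. c i \<in> R) \<and> (\<forall>\<zeta>\<in>torus. F \<zeta> = (\<Sum>i\<in>I. c i \<zeta> * B i \<zeta>))) \<and>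
     (\<forall>c. (\<forall>i\<in>I. c i \<in> R) \<and> (\<forall>\<zeta>\<in>torus. (\<Sum>i\<in>I. c i \<zeta> * B i \<zeta>) = 0) \<longrightarrow>
        (\<forall>i\<in>I. \<forall>\<zeta>\<in>torus. c i \<zeta> = 0))"

definition bracket ::
  "(complex \<times> complex \<Rightarrow> complex) \<Rightarrow> (complex \<times> complex \<Rightarrow> complex) \<Rightarrow>
   (complex \<times> complex \<Rightarrow> complex) \<Rightarrow> complex \<times> complex \<Rightarrow> complex" where
  "bracket P F G \<zeta> = (\<Sum>s\<in>E. P (zflip s \<zeta>) * F (zflip s \<zeta>) * cnj (G (zflip s \<zeta>)))"

definition L2sq :: "('a::euclidean_space \<Rightarrow> complex) \<Rightarrow> ennreal" where
  "L2sq f = (\<integral>\<^sup>+x. ennreal ((cmod (f x))\<^sup>2) \<partial>lborel)"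

definition L2 :: "('a::euclidean_space \<Rightarrow> complex) set" where
  "L2 = {f. f \<in> borel_measurable borel \<and> L2sq f < \<infinity>}"

definition L2inner :: "('a::euclidean_space \<Rightarrow> complex) \<Rightarrow> ('a \<Rightarrow> complex) \<Rightarrow> complex" where
  "L2inner f g = (\<integral>x. f x * cnj (g x) \<partial>lborel)"

definition fourier :: "('a::euclidean_space \<Rightarrow> complex) \<Rightarrow> 'a \<Rightarrow> complex" where
  "fourier f u = (\<integral>x. f x * cis (- (u \<bullet> x)) \<partial>lborel)"

text \<open>\<open>g\<close> is (a representative of) the Fourier--Plancherel transform of \<open>f \<in> L\<^sub>2\<close>, that is, the
  \<open>L\<^sub>2\<close>-limit of the transforms of the truncations of \<open>f\<close> to balls.\<close>

definition has_fourier :: "('a::euclidean_space \<Rightarrow> complex) \<Rightarrow> ('a \<Rightarrow> complex) \<Rightarrow> bool" where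
  "has_fourier f g \<longleftrightarrow> f \<in> L2 \<and> g \<in> L2 \<and>
     (\<lambda>n::nat. L2sq (\<lambda>u. fourier (\<lambda>x. indicator (cball 0 (real n)) x * f x) u - g u))
       \<longlonglongrightarrow> 0"

definition compactly_supported :: "('a::euclidean_space \<Rightarrow> complex) \<Rightarrow> bool" where
  "compactly_supported f \<longleftrightarrow> (\<exists>K. compact K \<and> (AE x in lborel. x \<notin> K \<longrightarrow> f x = 0))"

text \<open>Riesz basis of the closed subspace \<open>V\<close> of \<open>L\<^sub>2\<close>: a family in \<open>V\<close> with lower and upper
  Riesz bounds whose finite linear combinations are dense in \<open>V\<close>.\<close>

definition riesz_basis ::
  "('a::euclidean_space \<Rightarrow> complex) set \<Rightarrow> 'i set \<Rightarrow> ('i \<Rightarrow> 'a \<Rightarrow> complex) \<Rightarrow> bool" where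
  "riesz_basis V I f \<longleftrightarrow> (\<forall>i\<in>I. f i \<in> V) \<and>
     (\<exists>A B :: real. 0 < A \<and> 0 < B \<and>
        (\<forall>J c. finite J \<and> J \<subseteq> I \<longrightarrow>
           ennreal (A * (\<Sum>i\<in>J. (cmod (c i))\<^sup>2)) \<le> L2sq (\<lambda>x. \<Sum>i\<in>J. c i * f i x) \<and>
           L2sq (\<lambda>x. \<Sum>i\<in>J. c i * f i x) \<le> ennreal (B * (\<Sum>i\<in>J. (cmod (c i))\<^sup>2)))) \<and>
     (\<forall>g\<in>V. \<forall>\<epsilon>>0. \<exists>J c. finite J \<and> J \<subseteq> I \<and>
        L2sq (\<lambda>x. g x - (\<Sum>i\<in>J. c i * f i x)) < ennreal \<epsilon>)"

definition lat :: "int \<times> int \<Rightarrow> real \<times> real" where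
  "lat k = (of_int (fst k), of_int (snd k))"

definition box_factor :: "real \<Rightarrow> complex" where
  "box_factor t = (if t = 0 then 1 else (1 - cis (- t)) / (\<i> * of_real t))"

text \<open>An integer matrix with two rows is given as the list of its columns.  The box spline is
  determined by its Fourier transform up to a null set; every integrable representative is
  admitted.\<close>

definition is_box_spline :: "(int \<times> int) list \<Rightarrow> (real \<times> real \<Rightarrow> complex) \<Rightarrow> bool" where
  "is_box_spline \<Xi> \<phi> \<longleftrightarrow> \<phi> \<in> borel_measurable borel \<and> integrable lborel \<phi> \<and>
     (\<forall>u. fourier \<phi> u = (\<Prod>\<xi>\<leftarrow>\<Xi>. box_factor (lat \<xi> \<bullet> u)))"

definition box_mask :: "(int \<times> int) list \<Rightarrow> lpoly" where
  "box_mask \<Xi> = C (1 / 2 ^ length \<Xi>) * (\<Prod>\<xi>\<leftarrow>\<Xi>. 1 + Poly_Mapping.single \<xi> 1)"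

definition autocorr :: "(real \<times> real \<Rightarrow> complex) \<Rightarrow> real \<times> real \<Rightarrow> complex" where
  "autocorr \<phi> u = (\<integral>t. \<phi> t * cnj (\<phi> (t - u)) \<partial>lborel)"

definition has_mask ::
  "(real \<times> real \<Rightarrow> complex) \<Rightarrow> (real \<times> real \<Rightarrow> complex) \<Rightarrow> (complex \<times> complex \<Rightarrow> complex) \<Rightarrow> bool"
  where
  "has_mask \<phi> f F \<longleftrightarrow> F \<in> L_l2 \<and> has_fourier f (\<lambda>u. F (expm u) * fourier \<phi> u)"

definition V0 :: "(real \<times> real \<Rightarrow> complex) \<Rightarrow> (real \<times> real \<Rightarrow> complex) set" where
  "V0 \<phi> = {f. \<exists>F. has_mask \<phi> f F}"

definition Vm1 :: "(real \<times> real \<Rightarrow> complex) \<Rightarrow> (real \<times> real \<Rightarrow> complex) set" where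
  "Vm1 \<phi> = {f. \<exists>g\<in>V0 \<phi>. \<exists>G. has_fourier g G \<and> has_fourier f (\<lambda>u. G (2 *\<^sub>R u))}"

definition W0 :: "(real \<times> real \<Rightarrow> complex) \<Rightarrow> (real \<times> real \<Rightarrow> complex) set" where
  "W0 \<phi> = {f \<in> V0 \<phi>. \<forall>g\<in>Vm1 \<phi>. L2inner f g = 0}"

definition prewavelets ::
  "(real \<times> real \<Rightarrow> complex) \<Rightarrow> 's set \<Rightarrow> ('s \<Rightarrow> real \<times> real \<Rightarrow> complex) \<Rightarrow> bool" where
  "prewavelets \<phi> S \<psi> \<longleftrightarrow> finite S \<and> (\<forall>s\<in>S. \<psi> s \<in> W0 \<phi>) \<and>
     riesz_basis (W0 \<phi>) (S \<times> (UNIV :: (int \<times> int) set)) (\<lambda>(s, k) x. \<psi> s (x - 2 *\<^sub>R lat k))"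

definition Xi :: "(int \<times> int) list" where
  "Xi = [(1, 0), (1, 0), (0, 1), (0, 1), (1, 1), (1, 1)]"

definition H :: lpoly where
  "H = box_mask Xi"

definition Phi :: lpoly where
  "Phi = C (1 / 362880) *
    (94992
     + 37742 * (mon 1 0 + mon (-1) 0 + mon 0 1 + mon 0 (-1) + mon 1 1 + mon (-1) (-1))
     + 5100 * (mon (-1) 1 + mon 1 (-1) + mon 2 1 + mon (-2) (-1) + mon 1 2 + mon (-1) (-2))
     + 1736 * (mon 2 0 + mon (-2) 0 + mon 0 2 + mon 0 (-2) + mon 2 2 + mon (-2) (-2))
     + 34 * (mon (-2) 1 + mon 2 (-1) + mon 3 1 + mon (-3) (-1) + mon (-1) 2 + mon 1 (-2)
         + mon 3 2 + mon (-3) (-2) + mon 1 3 + mon (-1) (-3) + mon 2 3 + mon (-2) (-3))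
     + 2 * (mon 3 0 + mon (-3) 0 + mon 0 3 + mon 0 (-3) + mon 3 3 + mon (-3) (-3)))"

definition w00 :: lpoly where
  "w00 = 1884 * mon 2 2 + 14088 * mon 2 0 + 14088 * mon 0 2 + 1884 * mon 2 (-2)
     + 555000 + 1884 * mon (-2) 2 + 555000 * mon 0 (-2) + 555000 * mon (-2) 0
     + 14088 * mon 0 (-4) + 2380248 * mon (-2) (-2) + 14088 * mon (-4) 0 + 555000 * mon (-2) (-4)
     + 555000 * mon (-4) (-2) + 1884 * mon (-2) (-6) + 555000 * mon (-4) (-4) + 1884 * mon (-6) (-2)
     + 14088 * mon (-4) (-6) + 14088 * mon (-6) (-4) + 1884 * mon (-6) (-6)"

definition w10 :: lpoly where
  "w10 = 38 * mon 4 2 + 104 * mon 4 0 + 8890 * mon 2 2 + 2 * mon 4 (-2)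
     + 163440 * mon 2 0 + 8890 * mon 0 2 + 69054 * mon 2 (-2) + 811088
     + 38 * mon (-2) 2 + 104 * mon 2 (-4) + 1677952 * mon 0 (-2) + 163440 * mon (-2) 0
     + 163440 * mon 0 (-4) + 1677952 * mon (-2) (-2) + 104 * mon (-4) 0 + 38 * mon 0 (-6)
     + 811088 * mon (-2) (-4) + 69054 * mon (-4) (-2) + 8890 * mon (-2) (-6) + 163440 * mon (-4) (-4)
     + 2 * mon (-6) (-2) + 8890 * mon (-4) (-6) + 104 * mon (-6) (-4) + 38 * mon (-6) (-6)"

definition w01 :: lpoly where
  "w01 = lswap w10"

definition w11 :: lpoly where
  "w11 = 2 * mon 4 4 + 104 * mon 4 2 + 104 * mon 2 4 + 38 * mon 4 0
     + 69054 * mon 2 2 + 38 * mon 0 4 + 163440 * mon 2 0 + 163440 * mon 0 2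
     + 8890 * mon 2 (-2) + 1677952 + 8890 * mon (-2) 2 + 811088 * mon 0 (-2)
     + 811088 * mon (-2) 0 + 8890 * mon 0 (-4) + 1677952 * mon (-2) (-2) + 8890 * mon (-4) 0
     + 163440 * mon (-2) (-4) + 163440 * mon (-4) (-2) + 38 * mon (-2) (-6) + 69054 * mon (-4) (-4)
     + 38 * mon (-6) (-2) + 104 * mon (-4) (-6) + 104 * mon (-6) (-4) + 2 * mon (-6) (-6)"

definition w :: "nat \<times> nat \<Rightarrow> lpoly" where
  "w s = (if s = (0, 0) then w00 else if s = (1, 0) then w10
          else if s = (0, 1) then w01 else w11)"

definition H10 :: lpoly where "H10 = w10 - w00 * mon 1 0"
definition H01 :: lpoly where "H01 = w01 - w00 * mon 0 1"
definition H11 :: lpoly where "H11 = w11 - w00 * mon 1 1"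

definition Hs :: "nat \<times> nat \<Rightarrow> lpoly" where
  "Hs s = (if s = (0, 0) then H else if s = (1, 0) then H10
           else if s = (0, 1) then H01 else H11)"

end

(*
Everything is reduced to the Fourier transform of the box spline.  An L^1 function is determined by
its transform, so phi agrees almost everywhere with an explicit iterated average of the indicator of
the unit square; hence phi is bounded, supported in a hexagon, and its translates sum to 1.

The refinement equation makes the autocorrelation sequence a stationary vector of a column-stochastic
matrix which has a positive row; the stationary vector of sum 1 is unique, and the coefficients of Phi
are one.

Write W = conj(c H) Phi, so that W = sum_s w_s zeta^(-s).  Pairing with W (multiplying and taking the
part with even exponents) kills H_s = w_s - w_(0,0) zeta^s for s <> 0 and maps H to a multiple of
Phi(zeta^2).  Solving the resulting triangular system needs only 1/w_(0,0) and 1/Phi, and both lie in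
the Wiener algebra because explicit Laurent polynomials P satisfy P w_(0,0) = 1 - q, P Phi = 1 - q
with an l_1-norm of q below 1.  The same two inverses, truncated, give the Riesz bounds and the
density of the translates of the psi_s in W_0; the passage between functions and masks uses a
Plancherel inequality obtained by Gaussian summation.
*)

theory Submission
  imports Defs "HOL-Probability.Probability"
begin

subsection \<open>Laurent polynomials\<close>

text \<open>\<open>has_mask\<close> and \<open>has_fourier\<close> fix functions only almost
  everywhere and through L2 limits. Exact computations are therefore made on finite sums
  \<open>syn p\<close>, p a Laurent polynomial, where the inner product of \<open>syn p\<close> and
  \<open>syn q\<close> is the constant coefficient of p conj(q) Phi. Two estimates carry limits
  over: decay of the transform of phi bounds transforms by their masks (\<open>cell_bound\<close>),
  and \<open>has_fourier_L2sq_le\<close> bounds functions by their transforms.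

  Stability, too, is proved on coefficients. If P f = 1 - q with |q|_1 < 1, Young's inequality |p
  x|_2 <= |p|_1 |x|_2 yields |x|_2 <= const |f x|_2, without any study of the values of Phi or
  w_(0,0) on the torus.

  For density, g in W_0 is the limit of \<open>syn p_n\<close> with square partial sums p_n of its
  mask. As g is orthogonal to V_(-1), the pairing of p_n with W tends to 0, and what remains of p_n
  is nearly a combination of the H_s whose coefficients come from one truncated inverse v of
  w_(0,0). The truncation is fixed before n, because the l_1-norm of v multiplies the
  pairing.\<close>

abbreviation lk :: "lpoly \<Rightarrow> int \<times> int \<Rightarrow> complex" where
  "lk \<equiv> Poly_Mapping.lookup"

abbreviation sg :: "int \<times> int \<Rightarrow> complex \<Rightarrow> lpoly" where
  "sg \<equiv> Poly_Mapping.single"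

lemma lpoly_sum_single:
  fixes p :: lpoly
  assumes "finite S" "Poly_Mapping.keys p \<subseteq> S"
  shows "p = (\<Sum>k\<in>S. sg k (lk p k))"
proof (rule poly_mapping_eqI)
  fix k
  have "lk (\<Sum>k\<in>S. sg k (lk p k)) k = (\<Sum>l\<in>S. lk p l when l = k)"
    by (simp add: lookup_sum lookup_single)
  also have "\<dots> = lk p k"
    using assms by (auto simp: when_def sum.delta in_keys_iff)
  finally show "lk p k = lk (\<Sum>k\<in>S. sg k (lk p k)) k" ..
qed

lemma lpoly_induct [case_names zero single add]:
  fixes p :: lpoly
  assumes "P 0" "\<And>k c. P (sg k c)" "\<And>p q. P p \<Longrightarrow> P q \<Longrightarrow> P (p + q)"
  shows "P p"
proof -
  have "P (\<Sum>k\<in>S. sg k (lk p k))" if "finite S" for S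
    using that by induction (auto intro: assms)
  then show ?thesis
    using lpoly_sum_single[of "Poly_Mapping.keys p" p] by (metis finite_keys order_refl)
qed

lemma lookup_single_times: "lk (sg k c * p) m = c * lk p (m - k)"
proof (induction p rule: lpoly_induct)
  case (single l d)
  have "k + l = m \<longleftrightarrow> l = m - k" by (auto simp: algebra_simps)
  then show ?case by (simp add: mult_single lookup_single when_def)
qed (simp_all add: distrib_left lookup_add)

lemma lookup_times:
  assumes "finite S" "Poly_Mapping.keys p \<subseteq> S"
  shows "lk (p * q) m = (\<Sum>k\<in>S. lk p k * lk q (m - k))"
proof -
  have "p * q = (\<Sum>k\<in>S. sg k (lk p k) * q)"
    using lpoly_sum_single[OF assms] by (simp flip: sum_distrib_right)
  then show ?thesis by (simp add: lookup_sum lookup_single_times)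
qed


lemma lookup_map_key: "inj f \<Longrightarrow> Poly_Mapping.lookup (Poly_Mapping.map_key f p) k = Poly_Mapping.lookup p (f k)"
  by (simp add: map_key.rep_eq)

lemma inj_uminus_pair: "inj (uminus :: int \<times> int \<Rightarrow> _)"
  by (auto intro: injI)

lemma lookup_lconj [simp]: "lk (lconj p) k = cnj (lk p (- k))"
  by (simp add: lconj_def lookup_map_key[OF inj_uminus_pair] Poly_Mapping.map.rep_eq when_def)

lemma lookup_lswap [simp]: "lk (lswap p) k = lk p (prod.swap k)"
  by (simp add: lswap_def lookup_map_key)

lemma lconj_add: "lconj (p + q) = lconj p + lconj q"
  by (rule poly_mapping_eqI) (simp add: lookup_add)

lemma lconj_single: "lconj (sg k c) = sg (- k) (cnj c)"
proof (rule poly_mapping_eqI)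
  fix m show "lk (lconj (sg k c)) m = lk (sg (- k) (cnj c)) m"
    by (cases "k = - m") (auto simp: lookup_single when_def)
qed

lemma lconj_0 [simp]: "lconj 0 = 0"
  by (rule poly_mapping_eqI) simp

lemma lconj_mult: "lconj (p * q) = lconj p * lconj q"
proof (induction p rule: lpoly_induct)
  case (single k c)
  show ?case
  proof (rule poly_mapping_eqI)
    fix m
    show "lk (lconj (sg k c * q)) m = lk (lconj (sg k c) * lconj q) m"
      by (simp add: lconj_single lookup_single_times)
  qed
qed (simp_all add: lconj_add distrib_right)

lemma lconj_lconj [simp]: "lconj (lconj p) = p"
  by (rule poly_mapping_eqI) simp

lemma lswap_add: "lswap (p + q) = lswap p + lswap q"
  by (rule poly_mapping_eqI) (simp add: lookup_add)

lemma lswap_single: "lswap (sg k c) = sg (prod.swap k) c"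
  by (rule poly_mapping_eqI) (auto simp: lookup_single when_def prod.swap_def)

section \<open>Even exponents and the substitution of squares\<close>

definition even_pt :: "int \<times> int \<Rightarrow> bool" where
  "even_pt k \<longleftrightarrow> even (fst k) \<and> even (snd k)"

definition half_pt :: "int \<times> int \<Rightarrow> int \<times> int" where
  "half_pt k = (fst k div 2, snd k div 2)"

lemma even_pt_double [simp]: "even_pt (k + k)" "half_pt (k + k) = k"
  by (auto simp: even_pt_def half_pt_def prod_eq_iff)

lemma half_pt_double: "even_pt k \<Longrightarrow> half_pt k + half_pt k = k"
  by (auto simp: even_pt_def half_pt_def prod_eq_iff)

lemma double_pt_inj: "k + k = l + l \<longleftrightarrow> k = (l :: int \<times> int)"
  by (auto simp: prod_eq_iff)

lemma even_pt_diff: "even_pt l \<Longrightarrow> even_pt (k - l) \<longleftrightarrow> even_pt k"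
  by (auto simp: even_pt_def)

lemma lookup_ldilate: "lk (ldilate p) m = (if even_pt m then lk p (half_pt m) else 0)"
proof -
  have eq: "l + l = m \<longleftrightarrow> even_pt m \<and> l = half_pt m" for l
    by (metis even_pt_double half_pt_double)
  have "lk (ldilate p) m = (\<Sum>k\<in>Poly_Mapping.keys p. lk p k when k + k = m)"
    by (simp add: ldilate_def lookup_sum lookup_single)
  also have "\<dots> = (if even_pt m then lk p (half_pt m) else 0)"
    by (auto simp: eq when_def sum.delta' in_keys_iff)
  finally show ?thesis .
qed

lemma lookup_ldilate_double [simp]: "lk (ldilate p) (k + k) = lk p k"
  by (simp add: lookup_ldilate)

lemma ldilate_add: "ldilate (p + q) = ldilate p + ldilate q"
  by (rule poly_mapping_eqI) (simp add: lookup_add lookup_ldilate)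

lemma ldilate_single: "ldilate (sg k c) = sg (k + k) c"
  by (simp add: ldilate_def)

lemma ldilate_0 [simp]: "ldilate 0 = 0"
  by (simp add: ldilate_def)

lemma ldilate_mult: "ldilate (p * q) = ldilate p * ldilate q"
proof (induction p rule: lpoly_induct)
  case (single k c)
  show ?case
    by (rule poly_mapping_eqI)
       (simp add: ldilate_single lookup_single_times lookup_ldilate even_pt_diff,
        auto simp: half_pt_def even_pt_def prod_eq_iff fst_diff snd_diff elim!: evenE
          intro!: arg_cong2[where f="(*)"] arg_cong[where f="lk q"])
qed (simp_all add: ldilate_add distrib_right)

lemma Ldown_iff: "p \<in> Ldown \<longleftrightarrow> (\<forall>m. \<not> even_pt m \<longrightarrow> lk p m = 0)"
proof
  assume *: "\<forall>m. \<not> even_pt m \<longrightarrow> lk p m = 0"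
  have inj: "inj (\<lambda>k :: int \<times> int. k + k)"
    by (auto intro!: injI simp: double_pt_inj)
  have "p = ldilate (Poly_Mapping.map_key (\<lambda>k. k + k) p)"
    by (rule poly_mapping_eqI) (use * in \<open>auto simp: lookup_ldilate lookup_map_key[OF inj] half_pt_double\<close>)
  then show "p \<in> Ldown" by (auto simp: Ldown_def)
qed (auto simp: Ldown_def lookup_ldilate)

lemma Ldown_add: "p \<in> Ldown \<Longrightarrow> q \<in> Ldown \<Longrightarrow> p + q \<in> Ldown"
  by (auto simp: Ldown_iff lookup_add)

lemma Ldown_diff: "p \<in> Ldown \<Longrightarrow> q \<in> Ldown \<Longrightarrow> p - q \<in> Ldown"
  by (auto simp: Ldown_iff lookup_minus)

section \<open>Evaluation of Laurent polynomials\<close>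

lemma zpow_add: "fst \<zeta> \<noteq> 0 \<Longrightarrow> snd \<zeta> \<noteq> 0 \<Longrightarrow> zpow \<zeta> (k + l) = zpow \<zeta> k * zpow \<zeta> l"
  by (simp add: zpow_def power_int_add mult_ac)

lemma zpow_0 [simp]: "zpow \<zeta> 0 = 1"
  by (simp add: zpow_def)

lemma leval_superset:
  assumes "finite S" "Poly_Mapping.keys p \<subseteq> S"
  shows "leval p \<zeta> = (\<Sum>k\<in>S. lk p k * zpow \<zeta> k)"
  unfolding leval_def by (rule sum.mono_neutral_left) (use assms in \<open>auto simp: in_keys_iff\<close>)

lemma leval_add: "leval (p + q) \<zeta> = leval p \<zeta> + leval q \<zeta>"
proof -
  let ?S = "Poly_Mapping.keys p \<union> Poly_Mapping.keys q"
  have "leval (p + q) \<zeta> = (\<Sum>k\<in>?S. lk (p + q) k * zpow \<zeta> k)"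
    using Poly_Mapping.keys_add[of p q] by (intro leval_superset) auto
  then show ?thesis
    by (simp add: leval_superset[of ?S p] leval_superset[of ?S q] lookup_add sum.distrib distrib_right)
qed

lemma leval_single: "leval (sg k c) \<zeta> = c * zpow \<zeta> k"
  by (simp add: leval_def)

lemma leval_0 [simp]: "leval 0 \<zeta> = 0"
  by (simp add: leval_def)

lemma leval_C [simp]: "leval (C c) \<zeta> = c"
  by (simp add: C_def leval_single)

lemma leval_mon: "leval (mon i j) \<zeta> = fst \<zeta> powi i * snd \<zeta> powi j"
  by (simp add: mon_def leval_single zpow_def)

lemma leval_mult:
  assumes "fst \<zeta> \<noteq> 0" "snd \<zeta> \<noteq> 0"
  shows "leval (p * q) \<zeta> = leval p \<zeta> * leval q \<zeta>"
proof (induction p rule: lpoly_induct)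
  case (single k c)
  show ?case
    by (induction q rule: lpoly_induct)
       (simp_all add: mult_single leval_single zpow_add[OF assms] distrib_left leval_add)
qed (simp_all add: distrib_right leval_add)

lemma leval_diff: "leval (p - q) \<zeta> = leval p \<zeta> - leval q \<zeta>"
  using leval_add[of "p - q" q \<zeta>] by simp

lemma leval_1 [simp]: "leval 1 \<zeta> = 1"
  using leval_single[of 0 1] by simp

lemma leval_sum: "leval (sum f S) \<zeta> = (\<Sum>k\<in>S. leval (f k) \<zeta>)"
  by (induction S rule: infinite_finite_induct) (auto simp: leval_add)

lemma torus_nonzero: "\<zeta> \<in> torus \<Longrightarrow> fst \<zeta> \<noteq> 0 \<and> snd \<zeta> \<noteq> 0"
  by (auto simp: torus_def)

lemma cnj_powi_unit:
  assumes "cmod z = 1" shows "cnj (z powi n) = z powi (- n)"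
proof -
  have "z * cnj z = 1"
    using complex_norm_square[of z] assms by simp
  then have "cnj z = inverse z"
    by (simp add: inverse_unique)
  then show ?thesis
    by (simp only: complex_cnj_power_int power_int_inverse power_int_minus)
qed

lemma zpow_cnj: "\<zeta> \<in> torus \<Longrightarrow> cnj (zpow \<zeta> k) = zpow \<zeta> (- k)"
  by (simp add: zpow_def torus_def cnj_powi_unit del: complex_cnj_power_int)

lemma leval_lconj: "\<zeta> \<in> torus \<Longrightarrow> leval (lconj p) \<zeta> = cnj (leval p \<zeta>)"
  by (induction p rule: lpoly_induct) (simp_all add: lconj_add leval_add lconj_single leval_single zpow_cnj)

lemma zpow_double: "zpow \<zeta> (k + k) = zpow (zsq \<zeta>) k"
proof -
  have "z powi (n + n) = (z\<^sup>2) powi n" for z :: complex and n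
    by (metis power_int_mult power_int_numeral mult_2)
  then show ?thesis by (simp add: zpow_def zsq_def)
qed

lemma leval_ldilate: "leval (ldilate p) \<zeta> = leval p (zsq \<zeta>)"
  by (induction p rule: lpoly_induct) (simp_all add: ldilate_add leval_add ldilate_single leval_single zpow_double)

lemma cmod_zpow: "\<zeta> \<in> torus \<Longrightarrow> cmod (zpow \<zeta> k) = 1"
  by (simp add: zpow_def torus_def norm_mult norm_power_int)

subsection \<open>Explicit coefficients\<close>

text \<open>Integer tables: entry \<open>j\<close> of row \<open>i\<close> is the coefficient of \<open>x\<^sup>i y\<^sup>j\<close>.\<close>

fun row_add :: "int list \<Rightarrow> int list \<Rightarrow> int list" where
  "row_add [] q = q"
| "row_add p [] = p"
| "row_add (a # p) (b # q) = (a + b) # row_add p q"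

fun row_mul :: "int list \<Rightarrow> int list \<Rightarrow> int list" where
  "row_mul [] q = []"
| "row_mul (a # p) q = row_add (map ((*) a) q) (0 # row_mul p q)"

fun rows_add :: "int list list \<Rightarrow> int list list \<Rightarrow> int list list" where
  "rows_add [] q = q"
| "rows_add p [] = p"
| "rows_add (a # p) (b # q) = row_add a b # rows_add p q"

fun rows_mul :: "int list list \<Rightarrow> int list list \<Rightarrow> int list list" where
  "rows_mul [] q = []"
| "rows_mul (a # p) q = rows_add (map (row_mul a) q) ([] # rows_mul p q)"

fun row_poly :: "int list \<Rightarrow> lpoly" where
  "row_poly [] = 0"
| "row_poly (a # p) = of_int a + mon 0 1 * row_poly p"

fun rows_poly :: "int list list \<Rightarrow> lpoly" where
  "rows_poly [] = 0"
| "rows_poly (a # p) = row_poly a + mon 1 0 * rows_poly p"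

lemma row_poly_add: "row_poly (row_add p q) = row_poly p + row_poly q"
  by (induction p q rule: row_add.induct) (simp_all add: algebra_simps)

lemma row_poly_scale: "row_poly (map ((*) a) q) = of_int a * row_poly q"
  by (induction q) (simp_all add: algebra_simps)

lemma row_poly_mul: "row_poly (row_mul p q) = row_poly p * row_poly q"
  by (induction p q rule: row_mul.induct) (simp_all add: algebra_simps row_poly_add row_poly_scale)

lemma rows_poly_add: "rows_poly (rows_add p q) = rows_poly p + rows_poly q"
  by (induction p q rule: rows_add.induct) (simp_all add: algebra_simps row_poly_add)

lemma rows_poly_row_mul: "rows_poly (map (row_mul a) q) = row_poly a * rows_poly q"
  by (induction q) (simp_all add: algebra_simps row_poly_mul)

lemma rows_poly_mul: "rows_poly (rows_mul p q) = rows_poly p * rows_poly q"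
  by (induction p q rule: rows_mul.induct) (simp_all add: algebra_simps rows_poly_add rows_poly_row_mul)

text \<open>Zero outside the table, so the lookup rules hold for all integer indices and
  \<open>nat\<close> is never applied to a negative one.\<close>

definition row_entry :: "int list \<Rightarrow> int \<Rightarrow> int" where
  "row_entry p j = (if 0 \<le> j \<and> j < int (length p) then p ! nat j else 0)"

definition rows_entry :: "int list list \<Rightarrow> int \<Rightarrow> int \<Rightarrow> int" where
  "rows_entry p i j = (if 0 \<le> i \<and> i < int (length p) then row_entry (p ! nat i) j else 0)"

lemma mon_mult: "mon i j * mon k l = mon (i + k) (j + l)"
  by (simp add: mon_def mult_single)

lemma lookup_mon_times: "lk (mon i j * p) (k, l) = lk p (k - i, l - j)"
  by (simp add: mon_def lookup_single_times)

lemma lookup_of_int_lpoly: "lk (of_int a) (i, j) = (if i = 0 \<and> j = 0 then of_int a else 0)"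
  by (auto simp: lookup_of_int when_def zero_prod_def)

lemma lookup_row_poly: "lk (row_poly p) (i, j) = (if i = 0 then of_int (row_entry p j) else 0)"
proof (induction p arbitrary: j)
  case (Cons a p)
  have "(a # p) ! nat j = (if j = 0 then a else p ! nat (j - 1))" if "0 \<le> j"
    using that by (auto simp: nth_Cons' nat_diff_distrib)
  then show ?case
    by (auto simp: lookup_add lookup_of_int_lpoly lookup_mon_times Cons.IH row_entry_def)
qed (simp add: row_entry_def)

lemma lookup_rows_poly: "lk (rows_poly p) (i, j) = of_int (rows_entry p i j)"
proof (induction p arbitrary: i)
  case (Cons a p)
  have "(a # p) ! nat i = (if i = 0 then a else p ! nat (i - 1))" if "0 \<le> i"
    using that by (auto simp: nth_Cons' nat_diff_distrib)
  then show ?case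
    by (auto simp: lookup_add lookup_row_poly lookup_mon_times Cons.IH rows_entry_def row_entry_def)
qed (simp add: rows_entry_def)

section \<open>Sparse lists of terms and their conversion to tables\<close>

definition sp_poly :: "((int \<times> int) \<times> int) list \<Rightarrow> lpoly" where
  "sp_poly l = (\<Sum>(k, c)\<leftarrow>l. sg k (of_int c))"

lemma sp_poly_simps [simp]:
  "sp_poly [] = 0" "sp_poly ((k, c) # l) = sg k (of_int c) + sp_poly l"
  by (simp_all add: sp_poly_def)

lemma sp_poly_append: "sp_poly (l @ l') = sp_poly l + sp_poly l'"
  by (simp add: sp_poly_def)

definition sp_shift :: "int \<Rightarrow> int \<Rightarrow> ((int \<times> int) \<times> int) list \<Rightarrow> ((int \<times> int) \<times> int) list" where
  "sp_shift i j = map (\<lambda>((k, l), c). ((i + k, j + l), c))"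

definition sp_neg :: "((int \<times> int) \<times> int) list \<Rightarrow> ((int \<times> int) \<times> int) list" where
  "sp_neg = map (\<lambda>(k, c). (k, - c))"

definition sp_swap :: "((int \<times> int) \<times> int) list \<Rightarrow> ((int \<times> int) \<times> int) list" where
  "sp_swap = map (\<lambda>((k, l), c). ((l, k), c))"

lemma sp_poly_shift: "sp_poly (sp_shift i j l) = mon i j * sp_poly l"
  unfolding sp_shift_def by (induction l) (auto simp: distrib_left mon_def mult_single)

lemma sp_poly_neg: "sp_poly (sp_neg l) = - sp_poly l"
  unfolding sp_neg_def by (induction l) (auto simp: single_uminus)

lemma lswap_0 [simp]: "lswap 0 = 0"
  by (rule poly_mapping_eqI) simp

lemma sp_poly_swap: "sp_poly (sp_swap l) = lswap (sp_poly l)"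
  unfolding sp_swap_def by (induction l) (auto simp: lswap_add lswap_single)

lemma lookup_sp_poly: "k \<notin> fst ` set l \<Longrightarrow> lk (sp_poly l) k = 0"
  by (induction l) (auto simp: lookup_add lookup_single)

lemma keys_sp_poly:
  "distinct (map fst l) \<Longrightarrow> list_all (\<lambda>(k, c). c \<noteq> 0) l \<Longrightarrow> Poly_Mapping.keys (sp_poly l) = fst ` set l"
proof (induction l)
  case (Cons x l)
  obtain k c where x: "x = (k, c)" by (cases x)
  have "Poly_Mapping.keys (sg k (of_int c) + sp_poly l) = insert k (Poly_Mapping.keys (sp_poly l))"
    using Cons.prems lookup_sp_poly[of k l]
    by (auto simp: x in_keys_iff lookup_add lookup_single when_def split: if_splits)
  then show ?case using Cons by (simp add: x)
qed simp

lemma card_keys_sp_poly: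
  assumes "distinct (map fst l)" "list_all (\<lambda>(k, c). c \<noteq> 0) l"
  shows "card (Poly_Mapping.keys (sp_poly l)) = length l"
  using keys_sp_poly[OF assms] distinct_card[OF assms(1)] by simp

text \<open>\<open>row_add\<close> treats \<open>[]\<close> as zero, so a single term is written
  with empty rows above it and no padding to the right or below.\<close>

definition term_rows :: "nat \<Rightarrow> nat \<Rightarrow> int \<Rightarrow> int list list" where
  "term_rows i j c = replicate i [] @ [replicate j 0 @ [c]]"

lemma rows_poly_term: "rows_poly (term_rows i j c) = of_int c * mon (int i) (int j)"
proof -
  have *: "row_poly (replicate j 0 @ [c]) = of_int c * mon 0 (int j)" for j
  proof (induction j)
    case 0 show ?case by (simp add: mon_def flip: zero_prod_def)
  next
    case (Suc j) then show ?case by (simp add: mult.left_commute mon_mult)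
  qed
  show ?thesis unfolding term_rows_def
  proof (induction i)
    case (Suc i) then show ?case by (simp add: mult.left_commute mon_mult)
  qed (simp add: *)
qed

definition zero_rows :: "nat \<Rightarrow> nat \<Rightarrow> int list list" where
  "zero_rows m n = replicate m (replicate n 0)"

text \<open>The summation starts from an all-zero table of the final size. The result thus has a
  fixed shape and can be compared literally with a table computed by \<open>rows_mul\<close>. The
  shift by (a, b) makes the exponents nonnegative; repeated exponents are added up.\<close>

definition sp_rows :: "int \<Rightarrow> int \<Rightarrow> nat \<Rightarrow> nat \<Rightarrow> ((int \<times> int) \<times> int) list \<Rightarrow> int list list" where
  "sp_rows a b m n l =
     foldr (\<lambda>((i, j), c) r. rows_add (term_rows (nat (i - a)) (nat (j - b)) c) r) l (zero_rows m n)"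

lemma rows_poly_zero_rows: "rows_poly (zero_rows m n) = 0"
proof -
  have "row_poly (replicate n 0) = 0" for n
    by (induction n) auto
  then show ?thesis unfolding zero_rows_def by (induction m) auto
qed

lemma mon_times_single: "mon a b * sg (i, j) c = sg (a + i, b + j) c"
  by (simp add: mon_def mult_single)

lemma of_int_times_mon: "of_int c * mon i j = sg (i, j) (of_int c)"
  by (metis single_of_int mon_def mult_single add_0 mult_1_right)

lemma sp_poly_rows:
  assumes "list_all (\<lambda>((i, j), c). a \<le> i \<and> b \<le> j) l"
  shows "sp_poly l = mon a b * rows_poly (sp_rows a b m n l)"
  using assms
proof (induction l)
  case (Cons x l)
  obtain i j c where x: "x = ((i, j), c)" by (metis surj_pair)
  from Cons.prems have "a \<le> i" "b \<le> j" by (auto simp: x)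
  then have "sg (i, j) (of_int c) = mon a b * rows_poly (term_rows (nat (i - a)) (nat (j - b)) c)"
    by (simp add: rows_poly_term mult.left_commute mon_mult of_int_times_mon mon_times_single)
  with Cons show ?case
    by (simp add: x sp_rows_def rows_poly_add distrib_left)
qed (simp add: sp_rows_def rows_poly_zero_rows)

section \<open>The given polynomials as lists and tables\<close>

definition Phi_list :: "((int \<times> int) \<times> int) list" where
  "Phi_list =
    [((0,0),94992), ((1,0),37742), ((-1,0),37742), ((0,1),37742), ((0,-1),37742), ((1,1),37742),
    ((-1,-1),37742), ((-1,1),5100), ((1,-1),5100), ((2,1),5100), ((-2,-1),5100), ((1,2),5100),
    ((-1,-2),5100), ((2,0),1736), ((-2,0),1736), ((0,2),1736), ((0,-2),1736), ((2,2),1736),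
    ((-2,-2),1736), ((-2,1),34), ((2,-1),34), ((3,1),34), ((-3,-1),34), ((-1,2),34), ((1,-2),34),
    ((3,2),34), ((-3,-2),34), ((1,3),34), ((-1,-3),34), ((2,3),34), ((-2,-3),34), ((3,0),2),
    ((-3,0),2), ((0,3),2), ((0,-3),2), ((3,3),2), ((-3,-3),2)]"


definition w00_list :: "((int \<times> int) \<times> int) list" where
  "w00_list =
    [((2,2),1884), ((2,0),14088), ((0,2),14088), ((2,-2),1884), ((0,0),555000), ((-2,2),1884),
    ((0,-2),555000), ((-2,0),555000), ((0,-4),14088), ((-2,-2),2380248), ((-4,0),14088),
    ((-2,-4),555000), ((-4,-2),555000), ((-2,-6),1884), ((-4,-4),555000), ((-6,-2),1884),
    ((-4,-6),14088), ((-6,-4),14088), ((-6,-6),1884)]"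


definition w10_list :: "((int \<times> int) \<times> int) list" where
  "w10_list =
    [((4,2),38), ((4,0),104), ((2,2),8890), ((4,-2),2), ((2,0),163440), ((0,2),8890),
    ((2,-2),69054), ((0,0),811088), ((-2,2),38), ((2,-4),104), ((0,-2),1677952), ((-2,0),163440),
    ((0,-4),163440), ((-2,-2),1677952), ((-4,0),104), ((0,-6),38), ((-2,-4),811088),
    ((-4,-2),69054), ((-2,-6),8890), ((-4,-4),163440), ((-6,-2),2), ((-4,-6),8890), ((-6,-4),104),
    ((-6,-6),38)]"


definition w11_list :: "((int \<times> int) \<times> int) list" where
  "w11_list =
    [((4,4),2), ((4,2),104), ((2,4),104), ((4,0),38), ((2,2),69054), ((0,4),38), ((2,0),163440),
    ((0,2),163440), ((2,-2),8890), ((0,0),1677952), ((-2,2),8890), ((0,-2),811088),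
    ((-2,0),811088), ((0,-4),8890), ((-2,-2),1677952), ((-4,0),8890), ((-2,-4),163440),
    ((-4,-2),163440), ((-2,-6),38), ((-4,-4),69054), ((-6,-2),38), ((-4,-6),104), ((-6,-4),104),
    ((-6,-6),2)]"


lemma single_0_mon: "sg (0, 0) c * mon i j = sg (i, j) c"
  by (simp add: mon_def mult_single)

text \<open>Bare numerals in the definitions are constant terms. Written as single terms they merge
  with monomials, so \<open>555000\<close> and \<open>1884 * mon 2 2\<close> are handled by the same
  rules.\<close>

lemma numeral_single: "(numeral n :: lpoly) = sg (0, 0) (numeral n)"
  by (metis single_numeral zero_prod_def)

lemma w00_sp: "w00 = sp_poly w00_list"
  unfolding w00_def w00_list_def
  by (simp only: sp_poly_simps single_0_mon of_int_numeral add.assoc add_0_right numeral_single)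

lemma w10_sp: "w10 = sp_poly w10_list"
  unfolding w10_def w10_list_def
  by (simp only: sp_poly_simps single_0_mon of_int_numeral add.assoc add_0_right numeral_single)

lemma w11_sp: "w11 = sp_poly w11_list"
  unfolding w11_def w11_list_def
  by (simp only: sp_poly_simps single_0_mon of_int_numeral add.assoc add_0_right numeral_single)

lemma w01_sp: "w01 = sp_poly (sp_swap w10_list)"
  by (simp add: w01_def w10_sp sp_poly_swap)

lemma Phi_sp: "Phi = C (1 / 362880) * sp_poly Phi_list"
  unfolding Phi_def Phi_list_def
  by (simp only: sp_poly_simps single_0_mon of_int_numeral add.assoc add_0_right numeral_single distrib_left)

text \<open>This and the next four tables hold 64 H, 362880 Phi, c conj(H) Phi, 4096 |H|^2 and
  \<open>w00\<close>; the last four are shifted by (3, 3), (7, 7), (4, 4) and (6, 6) to make all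
  exponents nonnegative.\<close>

definition H_rows :: "int list list" where
  "H_rows =
    [[1, 2, 1, 0, 0], [2, 6, 6, 2, 0], [1, 6, 10, 6, 1], [0, 2, 6, 6, 2], [0, 0, 1, 2, 1]]"

definition Phi_rows :: "int list list" where
  "Phi_rows =
    [[2, 34, 34, 2, 0, 0, 0], [34, 1736, 5100, 1736, 34, 0, 0], [34, 5100, 37742, 37742, 5100, 34,
    0], [2, 1736, 37742, 94992, 37742, 1736, 2], [0, 34, 5100, 37742, 37742, 5100, 34], [0, 0, 34,
    1736, 5100, 1736, 34], [0, 0, 0, 2, 34, 34, 2]]"

definition HPhi_rows :: "int list list" where
  "HPhi_rows =
    [[2, 38, 104, 104, 38, 2, 0, 0, 0, 0, 0], [38, 1884, 8890, 14088, 8890, 1884, 38, 0, 0, 0, 0],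
    [104, 8890, 69054, 163440, 163440, 69054, 8890, 104, 0, 0, 0], [104, 14088, 163440, 555000,
    811088, 555000, 163440, 14088, 104, 0, 0], [38, 8890, 163440, 811088, 1677952, 1677952,
    811088, 163440, 8890, 38, 0], [2, 1884, 69054, 555000, 1677952, 2380248, 1677952, 555000,
    69054, 1884, 2], [0, 38, 8890, 163440, 811088, 1677952, 1677952, 811088, 163440, 8890, 38],
    [0, 0, 104, 14088, 163440, 555000, 811088, 555000, 163440, 14088, 104], [0, 0, 0, 104, 8890,
    69054, 163440, 163440, 69054, 8890, 104], [0, 0, 0, 0, 38, 1884, 8890, 14088, 8890, 1884, 38],
    [0, 0, 0, 0, 0, 2, 38, 104, 104, 38, 2]]"

definition HH_rows :: "int list list" where
  "HH_rows =
    [[1, 4, 6, 4, 1, 0, 0, 0, 0], [4, 20, 40, 40, 20, 4, 0, 0, 0], [6, 40, 106, 144, 106, 40, 6,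
    0, 0], [4, 40, 144, 260, 260, 144, 40, 4, 0], [1, 20, 106, 260, 346, 260, 106, 20, 1], [0, 4,
    40, 144, 260, 260, 144, 40, 4], [0, 0, 6, 40, 106, 144, 106, 40, 6], [0, 0, 0, 4, 20, 40, 40,
    20, 4], [0, 0, 0, 0, 1, 4, 6, 4, 1]]"

definition w00_rows :: "int list list" where
  "w00_rows =
    [[1884, 0, 14088, 0, 1884, 0, 0, 0, 0], [0, 0, 0, 0, 0, 0, 0, 0, 0], [14088, 0, 555000, 0,
    555000, 0, 14088, 0, 0], [0, 0, 0, 0, 0, 0, 0, 0, 0], [1884, 0, 555000, 0, 2380248, 0, 555000,
    0, 1884], [0, 0, 0, 0, 0, 0, 0, 0, 0], [0, 0, 14088, 0, 555000, 0, 555000, 0, 14088], [0, 0,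
    0, 0, 0, 0, 0, 0, 0], [0, 0, 0, 0, 1884, 0, 14088, 0, 1884]]"

section \<open>Products of the tables\<close>

lemma one_lpoly: "1 = mon 0 0"
  by (simp add: mon_def flip: zero_prod_def)

lemma C_mult: "C a * C b = C (a * b)" and C_1 [simp]: "C 1 = 1" and C_0 [simp]: "C 0 = 0"
  by (simp_all add: C_def mult_single)

lemma H_factors: "H = C (1 / 2 ^ 6) * (1 + mon 1 0) ^ 2 * (1 + mon 0 1) ^ 2 * (1 + mon 1 0 * mon 0 1) ^ 2"
  by (simp add: H_def box_mask_def Xi_def power2_eq_square mult_ac mon_mult flip: mon_def)

lemma H_factor_rows:
  "(1 + mon 1 0) ^ 2 * (1 + mon 0 1) ^ 2 * (1 + mon 1 0 * mon 0 1) ^ 2 = rows_poly H_rows"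
proof -
  have 1: "1 + mon 1 0 = rows_poly [[1], [1]]" "1 + mon 0 1 = rows_poly [[1, 1]]"
    "1 + mon 1 0 * mon 0 1 = rows_poly [[1, 0], [0, 1]]"
    by simp_all
  have "rows_mul (rows_mul (rows_mul [[1], [1]] [[1], [1]]) (rows_mul [[1, 1]] [[1, 1]]))
          (rows_mul [[1, 0], [0, 1]] [[1, 0], [0, 1]]) = H_rows"
    by code_simp
  then show ?thesis
    by (simp only: 1 power2_eq_square flip: rows_poly_mul)
qed

lemma H_rows: "H = C (1 / 64) * rows_poly H_rows"
  by (simp add: H_factors mult.assoc flip: H_factor_rows)

lemma lconj_mon: "lconj (mon i j) = mon (- i) (- j)"
  by (simp add: mon_def lconj_single)

lemma lconj_C: "lconj (C a) = C (cnj a)"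
  by (simp add: C_def lconj_single)

lemma lconj_1 [simp]: "lconj 1 = 1"
  using lconj_mon[of 0 0] by (simp flip: one_lpoly)

text \<open>Each factor satisfies 1 + z^(-1) = z^(-1) (1 + z), so conjugation merely shifts H. Hence
  conj(H) Phi and |H|^2 are obtained from plain products of the tables.\<close>

lemma lconj_H: "lconj H = mon (-4) (-4) * H"
proof -
  have *: "1 + mon (- i) (- j) = mon (- i) (- j) * (1 + mon i j)" for i j
    by (simp add: distrib_left mon_mult flip: one_lpoly)
  have "lconj H = C (1 / 2 ^ 6) * (1 + mon (-1) 0) ^ 2 * (1 + mon 0 (-1)) ^ 2 * (1 + mon (-1) (-1)) ^ 2"
    by (simp add: H_factors lconj_mult lconj_add lconj_mon lconj_C power2_eq_square mon_mult)
  also have "\<dots> = (mon (-1) 0 ^ 2 * mon 0 (-1) ^ 2 * mon (-1) (-1) ^ 2) * H"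
    using *[of 1 0] *[of 0 1] *[of 1 1]
    by (simp add: H_factors power_mult_distrib mult_ac mon_mult)
  also have "mon (-1) 0 ^ 2 * mon 0 (-1) ^ 2 * mon (-1) (-1) ^ 2 = mon (-4) (-4)"
    by (simp add: power2_eq_square mon_mult)
  finally show ?thesis .
qed

lemma Phi_rows: "Phi = C (1 / 362880) * (mon (-3) (-3) * rows_poly Phi_rows)"
proof -
  have "sp_rows (-3) (-3) 7 7 Phi_list = Phi_rows" by code_simp
  moreover have "list_all (\<lambda>((i, j), c). -3 \<le> i \<and> -3 \<le> j) Phi_list" by code_simp
  ultimately show ?thesis using sp_poly_rows[of "-3" "-3" Phi_list 7 7] by (simp add: Phi_sp)
qed

lemma HPhi_rows: "lconj (C (2 ^ 6 * 362880) * H) * Phi = mon (-7) (-7) * rows_poly HPhi_rows"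
proof -
  have "rows_mul H_rows Phi_rows = HPhi_rows" by code_simp
  then have "rows_poly HPhi_rows = rows_poly H_rows * rows_poly Phi_rows"
    by (simp flip: rows_poly_mul)
  moreover have "C (2 ^ 6 * 362880) * (C (1 / 64) * C (1 / 362880)) = 1"
    unfolding C_mult by simp
  moreover have "lconj (C (2 ^ 6 * 362880) * H) = C (2 ^ 6 * 362880) * (mon (-4) (-4) * H)"
    by (simp add: lconj_mult lconj_H lconj_C)
  moreover have "C (2 ^ 6 * 362880) * (mon (-4) (-4) * (C (1 / 64) * h)) * (C (1 / 362880) * (mon (-3) (-3) * f))
      = C (2 ^ 6 * 362880) * (C (1 / 64) * C (1 / 362880)) * (mon (-4) (-4) * mon (-3) (-3)) * (h * f)" for h f
    by (simp only: mult_ac)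
  ultimately show ?thesis by (simp add: Phi_rows H_rows mon_mult)
qed

text \<open>Both sides are brought to the same 11 x 11 table: the left as a product of tables, the
  right by collecting the terms of four shifted lists.\<close>

lemma HPhi_split:
  "lconj (C (2 ^ 6 * 362880) * H) * Phi
     = w (0, 0) + w (1, 0) * mon (-1) 0 + w (0, 1) * mon 0 (-1) + w (1, 1) * mon (-1) (-1)"
proof -
  define l where "l = w00_list @ sp_shift (-1) 0 w10_list @ sp_shift 0 (-1) (sp_swap w10_list)
    @ sp_shift (-1) (-1) w11_list"
  have "sp_rows (-7) (-7) 11 11 l = HPhi_rows" unfolding l_def by code_simp
  moreover have "list_all (\<lambda>((i, j), c). -7 \<le> i \<and> -7 \<le> j) l" unfolding l_def by code_simp
  ultimately have "sp_poly l = lconj (C (2 ^ 6 * 362880) * H) * Phi"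
    using sp_poly_rows[of "-7" "-7" l 11 11] by (simp only: HPhi_rows)
  moreover have "sp_poly l = w (0, 0) + w (1, 0) * mon (-1) 0 + w (0, 1) * mon 0 (-1) + w (1, 1) * mon (-1) (-1)"
    by (simp add: l_def sp_poly_append sp_poly_shift w_def w01_sp w11_sp w10_sp w00_sp mult.commute add.assoc)
  ultimately show ?thesis by simp
qed

lemma Ldown_sp: "list_all (\<lambda>((i, j), c). even i \<and> even j) l \<Longrightarrow> sp_poly l \<in> Ldown"
  by (induction l) (auto simp: Ldown_iff lookup_add lookup_single when_def even_pt_def)

lemma w_Ldown: "w s \<in> Ldown"
proof -
  have "list_all (\<lambda>((i, j), c). even i \<and> even j) w00_list" by code_simp
  moreover have "list_all (\<lambda>((i, j), c). even i \<and> even j) w10_list" by code_simp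
  moreover have "list_all (\<lambda>((i, j), c). even i \<and> even j) w11_list" by code_simp
  moreover have "list_all (\<lambda>((i, j), c). even i \<and> even j) (sp_swap w10_list)" by code_simp
  ultimately show ?thesis by (simp add: w_def w00_sp w10_sp w01_sp w11_sp Ldown_sp)
qed

lemma lswap_mult: "lswap (p * q) = lswap p * lswap q"
proof (induction p rule: lpoly_induct)
  case (single k c)
  show ?case
  proof (rule poly_mapping_eqI)
    fix m
    show "lk (lswap (sg k c * q)) m = lk (lswap (sg k c) * lswap q) m"
      by (cases k; cases m) (simp add: lswap_single lookup_single_times)
  qed
qed (simp_all add: lswap_add distrib_right)

lemma lswap_diff: "lswap (p - q) = lswap p - lswap q"
  by (rule poly_mapping_eqI) (simp add: lookup_minus)

lemma w00_rows: "w00 = mon (-6) (-6) * rows_poly w00_rows"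
proof -
  have "sp_rows (-6) (-6) 9 9 w00_list = w00_rows" by code_simp
  moreover have "list_all (\<lambda>((i, j), c). -6 \<le> i \<and> -6 \<le> j) w00_list" by code_simp
  ultimately show ?thesis using sp_poly_rows[of "-6" "-6" w00_list 9 9] by (simp add: w00_sp)
qed

lemma lswap_w00: "lswap w00 = w00"
proof -
  have "sp_rows (-6) (-6) 9 9 (sp_swap w00_list) = w00_rows" by code_simp
  moreover have "list_all (\<lambda>((i, j), c). -6 \<le> i \<and> -6 \<le> j) (sp_swap w00_list)" by code_simp
  ultimately show ?thesis
    using sp_poly_rows[of "-6" "-6" "sp_swap w00_list" 9 9] w00_rows by (simp add: w00_sp sp_poly_swap)
qed

lemma H01_eq: "H01 = lswap H10"
  by (simp add: H01_def H10_def lswap_diff lswap_mult w01_def lswap_w00 mon_def lswap_single)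

lemma card_keys_lswap: "card (Poly_Mapping.keys (lswap p)) = card (Poly_Mapping.keys p)"
proof -
  have "Poly_Mapping.keys (lswap p) = prod.swap ` Poly_Mapping.keys p"
    by (force simp: in_keys_iff image_iff)
  then show ?thesis by (simp add: card_image)
qed

text \<open>The exponents of \<open>w10\<close> are even and those of \<open>w00 * mon 1 0\<close>
  are odd in x, so nothing cancels and the count is 24 + 19.\<close>

lemma card_keys_H10: "card (Poly_Mapping.keys H10) = 43"
proof -
  define l where "l = w10_list @ sp_neg (sp_shift 1 0 w00_list)"
  have "distinct (map fst l) \<and> list_all (\<lambda>(k, c). c \<noteq> 0) l \<and> length l = 43"
    unfolding l_def by code_simp
  then have "card (Poly_Mapping.keys (sp_poly l)) = 43"
    using card_keys_sp_poly by metis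
  moreover have "sp_poly l = H10"
    by (simp add: l_def sp_poly_append sp_poly_neg sp_poly_shift H10_def w10_sp w00_sp mult.commute)
  ultimately show ?thesis by simp
qed

lemma card_keys_H11: "card (Poly_Mapping.keys H11) = 43"
proof -
  define l where "l = w11_list @ sp_neg (sp_shift 1 1 w00_list)"
  have "distinct (map fst l) \<and> list_all (\<lambda>(k, c). c \<noteq> 0) l \<and> length l = 43"
    unfolding l_def by code_simp
  then have "card (Poly_Mapping.keys (sp_poly l)) = 43"
    using card_keys_sp_poly by metis
  moreover have "sp_poly l = H11"
    by (simp add: l_def sp_poly_append sp_poly_neg sp_poly_shift H11_def w11_sp w00_sp mult.commute)
  ultimately show ?thesis by simp
qed

lemma card_keys_H01: "card (Poly_Mapping.keys H01) = 43"
  by (simp add: H01_eq card_keys_lswap card_keys_H10)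

definition dims :: "nat \<Rightarrow> nat \<Rightarrow> int list list \<Rightarrow> bool" where
  "dims m n p \<longleftrightarrow> length p = m \<and> list_all (\<lambda>r. length r = n) p"

lemma rows_entry_outside:
  assumes "dims m n p" "\<not> (0 \<le> i \<and> i < int m \<and> 0 \<le> j \<and> j < int n)"
  shows "rows_entry p i j = 0"
  using assms by (auto simp: rows_entry_def row_entry_def dims_def list_all_length)

text \<open>Phi is a fixed point of the transition operator f -> 4 (even part of |H|^2 f), the
  equation which refinability imposes on autocorrelations.\<close>

lemma even_lookup_HHPhi: "lk (H * lconj H * Phi) (k + k) = lk Phi k / 4"
proof -
  define r where "r = rows_mul H_rows HPhi_rows"
  have d: "dims 15 15 r" "dims 7 7 Phi_rows" unfolding r_def by code_simp+
  \<comment> \<open>1024 = 64^2 / 4: the two tables of H carry 64 each, and 1/4 is the factor in the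
    claim.\<close>
  have e: "list_all (\<lambda>i. list_all (\<lambda>j. rows_entry r (2 * i + 7) (2 * j + 7)
      = 1024 * rows_entry Phi_rows (i + 3) (j + 3)) [-3..3]) [-3..3]"
    unfolding r_def by code_simp
  have e': "rows_entry r (2 * i + 7) (2 * j + 7) = 1024 * rows_entry Phi_rows (i + 3) (j + 3)" for i j
  proof (cases "i \<in> {-3..3} \<and> j \<in> {-3..3}")
    case True then show ?thesis using e unfolding list_all_iff set_upto by blast
  next
    case False
    \<comment> \<open>An index outside -3..3 is sent by 2 i + 7 outside 0..14, so both entries
      vanish.\<close>
    then have "\<not> (0 \<le> 2 * i + 7 \<and> 2 * i + 7 < int 15 \<and> 0 \<le> 2 * j + 7 \<and> 2 * j + 7 < int 15)"
      "\<not> (0 \<le> i + 3 \<and> i + 3 < int 7 \<and> 0 \<le> j + 3 \<and> j + 3 < int 7)"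
      by auto
    then show ?thesis using d by (simp add: rows_entry_outside)
  qed
  have c: "C (1 / (2 ^ 6 * 362880)) * C (2 ^ 6 * 362880) = 1" by (simp add: C_mult)
  have "H * lconj H * Phi = C (1 / (2 ^ 6 * 362880)) * C (2 ^ 6 * 362880) * H * lconj H * Phi"
    by (simp only: c mult_1_left)
  also have "\<dots> = C (1 / (2 ^ 6 * 362880)) * H * (lconj (C (2 ^ 6 * 362880) * H) * Phi)"
    by (simp add: lconj_mult lconj_C mult_ac)
  also have "\<dots> = C (1 / (2 ^ 6 * 362880)) * (C (1 / 64) * (mon (-7) (-7) * rows_poly r))"
    unfolding HPhi_rows unfolding H_rows r_def rows_poly_mul by (simp only: mult_ac)
  finally have "lk (H * lconj H * Phi) (k + k) = 1 / (2 ^ 6 * 362880) * (1 / 64 * lk (mon (-7) (-7) * rows_poly r) (k + k))"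
    by (simp add: C_def lookup_single_times)
  also have "\<dots> = lk Phi k / 4"
    by (cases k) (simp add: lookup_mon_times lookup_rows_poly e' Phi_rows C_def lookup_single_times flip: mult_2)
  finally show ?thesis .
qed

section \<open>Coefficients of |H|^2 and Phi on the hexagon\<close>

lemma HH_rows: "H * lconj H = C (1 / 4096) * (mon (-4) (-4) * rows_poly HH_rows)"
proof -
  have "rows_mul H_rows H_rows = HH_rows" by code_simp
  then have "rows_poly HH_rows = rows_poly H_rows * rows_poly H_rows"
    by (simp flip: rows_poly_mul)
  moreover have "C (1 / 64) * h * (mon (-4) (-4) * (C (1 / 64) * h)) = (C (1 / 64) * C (1 / 64)) * (mon (-4) (-4) * (h * h))" for h
    by (simp only: mult_ac)
  moreover have "H * lconj H = C (1 / 64) * rows_poly H_rows * (mon (-4) (-4) * (C (1 / 64) * rows_poly H_rows))"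
    by (simp only: lconj_H) (simp only: H_rows)
  ultimately show ?thesis by (simp add: C_mult)
qed

text \<open>The lattice shifts for which the open support hexagon of phi meets its
  translate.\<close>

definition hex3 :: "(int \<times> int) set" where
  "hex3 = {k. \<bar>fst k\<bar> \<le> 3 \<and> \<bar>snd k\<bar> \<le> 3 \<and> \<bar>fst k - snd k\<bar> \<le> 3}"

definition hex3_list :: "(int \<times> int) list" where
  "hex3_list = filter (\<lambda>(i, j). \<bar>i - j\<bar> \<le> 3) (List.product [-3..3] [-3..3])"

lemma set_hex3_list: "set hex3_list = hex3"
  unfolding hex3_list_def hex3_def set_filter set_product set_upto by auto

lemma distinct_hex3_list: "distinct hex3_list"
  by code_simp

lemma finite_hex3 [simp]: "finite hex3"
  by (metis set_hex3_list finite_set)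

lemma HH_lookup: "lk (H * lconj H) (i, j) = of_int (rows_entry HH_rows (i + 4) (j + 4)) / 4096"
  by (simp add: HH_rows C_def lookup_single_times lookup_mon_times lookup_rows_poly)

lemma HH_entry_nonneg: "0 \<le> rows_entry HH_rows i j"
proof -
  have "list_all (list_all (\<lambda>c. 0 \<le> c)) HH_rows" by code_simp
  then show ?thesis by (auto simp: rows_entry_def row_entry_def list_all_length)
qed

text \<open>The coefficients of |H|^2 are positive on the whole hexagon of radius 4, which contains
  the one of radius 3. This is the positive row of the transition matrix.\<close>

lemma HH_entry_pos: "(i, j) \<in> hex3 \<Longrightarrow> 1 \<le> rows_entry HH_rows (4 - i) (4 - j)"
proof -
  have "list_all (\<lambda>(i, j). 1 \<le> rows_entry HH_rows (4 - i) (4 - j)) hex3_list" by code_simp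
  then show "(i, j) \<in> hex3 \<Longrightarrow> ?thesis" by (auto simp: list_all_iff set_hex3_list)
qed

text \<open>H is 1 at (1, 1) and 0 at the other three sign points, so the four parity classes of
  4096 |H|^2 share the total 4096 equally; a column runs through one class.\<close>

lemma HH_entry_sum:
  assumes "(i, j) \<in> hex3"
  shows "(\<Sum>(k, l)\<in>hex3. rows_entry HH_rows (2 * k - i + 4) (2 * l - j + 4)) \<le> 1024"
proof -
  have "list_all (\<lambda>(i, j). sum_list (map (\<lambda>(k, l). rows_entry HH_rows (2 * k - i + 4) (2 * l - j + 4)) hex3_list)
    \<le> 1024) hex3_list"
    by code_simp
  then show ?thesis using assms
    by (auto simp: list_all_iff set_hex3_list sum_list_distinct_conv_sum_set[OF distinct_hex3_list])
qed

lemma lookup_Phi_outside: "k \<notin> hex3 \<Longrightarrow> lk Phi k = 0"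
proof -
  have "list_all (\<lambda>(k, c). \<bar>fst k\<bar> \<le> 3 \<and> \<bar>snd k\<bar> \<le> 3 \<and> \<bar>fst k - snd k\<bar> \<le> 3) Phi_list" by code_simp
  then have "fst ` set Phi_list \<subseteq> hex3" by (auto simp: list_all_iff hex3_def)
  then show "k \<notin> hex3 \<Longrightarrow> ?thesis"
    using lookup_sp_poly[of k Phi_list] by (auto simp: Phi_sp C_def lookup_single_times)
qed

lemma lookup_Phi: "lk Phi (i, j) = of_int (rows_entry Phi_rows (i + 3) (j + 3)) / 362880"
  by (simp add: Phi_rows C_def lookup_single_times lookup_mon_times lookup_rows_poly)

lemma sum_lookup_Phi: "(\<Sum>k\<in>hex3. lk Phi k) = 1"
proof -
  have "sum_list (map (\<lambda>(i, j). rows_entry Phi_rows (i + 3) (j + 3)) hex3_list) = 362880" by code_simp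
  then have "(\<Sum>(i, j)\<in>hex3. rows_entry Phi_rows (i + 3) (j + 3)) = 362880"
    by (simp add: sum_list_distinct_conv_sum_set[OF distinct_hex3_list] set_hex3_list)
  moreover have "(\<Sum>k\<in>hex3. lk Phi k) = of_int (\<Sum>(i, j)\<in>hex3. rows_entry Phi_rows (i + 3) (j + 3)) / 362880"
    by (auto simp: sum_divide_distrib lookup_Phi case_prod_unfold intro!: sum.cong)
  ultimately show ?thesis by simp
qed

lemma lookup_Phi_uminus: "lk Phi (- k) = lk Phi k"
proof -
  have "list_all (\<lambda>(i, j). rows_entry Phi_rows (- i + 3) (- j + 3) = rows_entry Phi_rows (i + 3) (j + 3)) hex3_list"
    by code_simp
  then have "rows_entry Phi_rows (- i + 3) (- j + 3) = rows_entry Phi_rows (i + 3) (j + 3)" if "(i, j) \<in> hex3" for i j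
    using that by (auto simp: list_all_iff set_hex3_list)
  then have "lk Phi (- k) = lk Phi k" if "k \<in> hex3"
    using that by (cases k) (simp add: lookup_Phi)
  moreover have "- k \<in> hex3 \<longleftrightarrow> k \<in> hex3" by (auto simp: hex3_def)
  ultimately show ?thesis using lookup_Phi_outside by metis
qed

lemma lconj_Phi [simp]: "lconj Phi = Phi"
proof (rule poly_mapping_eqI)
  fix k
  have "cnj (lk Phi k) = lk Phi k"
    by (cases k) (simp add: lookup_Phi)
  then show "lk (lconj Phi) k = lk Phi k" by (simp add: lookup_Phi_uminus)
qed

subsection \<open>Norms on Laurent polynomials\<close>

definition norm1 :: "lpoly \<Rightarrow> real" where
  "norm1 p = (\<Sum>k\<in>Poly_Mapping.keys p. cmod (lk p k))"

definition norm2 :: "lpoly \<Rightarrow> real" where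
  "norm2 p = L2_set (\<lambda>k. cmod (lk p k)) (Poly_Mapping.keys p)"

lemma norm1_superset:
  "finite S \<Longrightarrow> Poly_Mapping.keys p \<subseteq> S \<Longrightarrow> norm1 p = (\<Sum>k\<in>S. cmod (lk p k))"
  unfolding norm1_def by (rule sum.mono_neutral_left) (auto simp: in_keys_iff)

lemma norm2_superset:
  "finite S \<Longrightarrow> Poly_Mapping.keys p \<subseteq> S \<Longrightarrow> norm2 p = L2_set (\<lambda>k. cmod (lk p k)) S"
  unfolding norm2_def L2_set_def by (intro arg_cong[where f = sqrt] sum.mono_neutral_left) (auto simp: in_keys_iff)

lemma norm1_nonneg [simp]: "0 \<le> norm1 p" and norm2_nonneg [simp]: "0 \<le> norm2 p"
  by (simp_all add: norm1_def norm2_def sum_nonneg)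

lemma norm1_0 [simp]: "norm1 0 = 0" and norm2_0 [simp]: "norm2 0 = 0"
  by (simp_all add: norm1_def norm2_def)

lemma norm1_single [simp]: "norm1 (sg k c) = cmod c" and norm2_single: "norm2 (sg k c) = cmod c"
  by (auto simp: norm1_def norm2_def L2_set_def)

lemma norm1_add: "norm1 (p + q) \<le> norm1 p + norm1 q"
proof -
  let ?S = "Poly_Mapping.keys p \<union> Poly_Mapping.keys q"
  have "norm1 (p + q) = (\<Sum>k\<in>?S. cmod (lk (p + q) k))"
    using Poly_Mapping.keys_add[of p q] by (intro norm1_superset) auto
  also have "\<dots> \<le> (\<Sum>k\<in>?S. cmod (lk p k) + cmod (lk q k))"
    by (intro sum_mono) (simp add: lookup_add norm_triangle_ineq)
  also have "\<dots> = norm1 p + norm1 q"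
    by (simp add: sum.distrib norm1_superset[of ?S p] norm1_superset[of ?S q])
  finally show ?thesis .
qed

lemma norm2_add: "norm2 (p + q) \<le> norm2 p + norm2 q"
proof -
  let ?S = "Poly_Mapping.keys p \<union> Poly_Mapping.keys q"
  have "norm2 (p + q) = L2_set (\<lambda>k. cmod (lk (p + q) k)) ?S"
    using Poly_Mapping.keys_add[of p q] by (intro norm2_superset) auto
  also have "\<dots> \<le> L2_set (\<lambda>k. cmod (lk p k) + cmod (lk q k)) ?S"
    by (intro L2_set_mono) (simp_all add: lookup_add norm_triangle_ineq)
  also have "\<dots> \<le> L2_set (\<lambda>k. cmod (lk p k)) ?S + L2_set (\<lambda>k. cmod (lk q k)) ?S"
    by (rule L2_set_triangle_ineq)
  also have "\<dots> = norm2 p + norm2 q"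
    by (simp add: norm2_superset[of ?S p] norm2_superset[of ?S q])
  finally show ?thesis .
qed

lemma norm2_uminus [simp]: "norm2 (- p) = norm2 p"
  by (simp add: norm2_superset[of "Poly_Mapping.keys p" "- p"] norm2_superset[of "Poly_Mapping.keys p" p] in_keys_iff subset_iff)

lemma norm2_sum: "norm2 (sum f S) \<le> (\<Sum>k\<in>S. norm2 (f k))"
  by (induction S rule: infinite_finite_induct) (auto intro: order_trans[OF norm2_add])

lemma norm1_sum: "norm1 (sum f S) \<le> (\<Sum>k\<in>S. norm1 (f k))"
  by (induction S rule: infinite_finite_induct) (auto intro: order_trans[OF norm1_add])

lemma keys_single_times: "Poly_Mapping.keys (sg k c * p) \<subseteq> (+) k ` Poly_Mapping.keys p"
proof
  fix m assume "m \<in> Poly_Mapping.keys (sg k c * p)"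
  then have "m - k \<in> Poly_Mapping.keys p" by (auto simp: in_keys_iff lookup_single_times)
  then show "m \<in> (+) k ` Poly_Mapping.keys p" by (rule rev_image_eqI) simp
qed

lemma norm1_single_times: "norm1 (sg k c * p) = cmod c * norm1 p"
proof -
  have "norm1 (sg k c * p) = (\<Sum>m\<in>(+) k ` Poly_Mapping.keys p. cmod (lk (sg k c * p) m))"
    by (intro norm1_superset keys_single_times) simp
  also have "\<dots> = (\<Sum>l\<in>Poly_Mapping.keys p. cmod c * cmod (lk p l))"
    by (subst sum.reindex) (auto simp: lookup_single_times norm_mult)
  finally show ?thesis by (simp add: norm1_def sum_distrib_left)
qed

lemma norm2_single_times: "norm2 (sg k c * p) = cmod c * norm2 p"
proof -
  have "norm2 (sg k c * p) = L2_set (\<lambda>m. cmod (lk (sg k c * p) m)) ((+) k ` Poly_Mapping.keys p)"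
    by (intro norm2_superset keys_single_times) simp
  also have "\<dots> = L2_set (\<lambda>l. cmod c * cmod (lk p l)) (Poly_Mapping.keys p)"
    unfolding L2_set_def by (subst sum.reindex) (auto simp: lookup_single_times norm_mult)
  finally show ?thesis by (simp add: norm2_def L2_set_right_distrib)
qed

lemma lpoly_times_sum: "p * q = (\<Sum>k\<in>Poly_Mapping.keys p. sg k (lk p k) * q)"
  unfolding sum_distrib_right[symmetric] using lpoly_sum_single[of "Poly_Mapping.keys p" p] by simp

lemma norm1_mult: "norm1 (p * q) \<le> norm1 p * norm1 q"
proof -
  have "norm1 (p * q) \<le> (\<Sum>k\<in>Poly_Mapping.keys p. norm1 (sg k (lk p k) * q))"
    unfolding lpoly_times_sum[of p q] by (rule norm1_sum)
  then show ?thesis by (simp add: norm1_single_times norm1_def[of p] sum_distrib_right)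
qed

text \<open>Young's inequality: a monomial acts as an isometry of l_2, and p is a sum of multiples
  of monomials.\<close>

lemma norm2_mult: "norm2 (p * q) \<le> norm1 p * norm2 q"
proof -
  have "norm2 (p * q) \<le> (\<Sum>k\<in>Poly_Mapping.keys p. norm2 (sg k (lk p k) * q))"
    unfolding lpoly_times_sum[of p q] by (rule norm2_sum)
  then show ?thesis by (simp add: norm2_single_times norm1_def sum_distrib_right)
qed

lemma norm1_1 [simp]: "norm1 1 = 1"
  using norm1_single[of 0 1] by (simp del: norm1_single)

lemma norm1_power: "norm1 (p ^ n) \<le> norm1 p ^ n"
proof (induction n)
  case (Suc n)
  have "norm1 (p ^ Suc n) \<le> norm1 p * norm1 (p ^ n)" by (simp add: norm1_mult)
  also have "\<dots> \<le> norm1 p * norm1 p ^ n" by (intro mult_left_mono Suc) simp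
  finally show ?case by simp
qed simp

lemma norm1_mon_times [simp]: "norm1 (mon i j * p) = norm1 p"
  by (simp add: mon_def norm1_single_times)

lemma norm2_mon_times [simp]: "norm2 (mon i j * p) = norm2 p"
  by (simp add: mon_def norm2_single_times)

lemma norm1_C_times [simp]: "norm1 (C c * p) = cmod c * norm1 p"
  by (simp add: C_def norm1_single_times)

lemma norm2_C_times [simp]: "norm2 (C c * p) = cmod c * norm2 p"
  by (simp add: C_def norm2_single_times)

lemma lookup_mult_lconj_0:
  assumes "finite S" "Poly_Mapping.keys p \<subseteq> S"
  shows "lk (p * lconj q) 0 = (\<Sum>k\<in>S. lk p k * cnj (lk q k))"
  using lookup_times[OF assms, of "lconj q" 0] by simp

lemma norm2_power2: "of_real ((norm2 p)\<^sup>2) = lk (p * lconj p) 0"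
proof -
  have "lk (p * lconj p) 0 = (\<Sum>k\<in>Poly_Mapping.keys p. of_real ((cmod (lk p k))\<^sup>2))"
    by (subst lookup_mult_lconj_0[of "Poly_Mapping.keys p"]) (simp_all only: finite_keys order_refl flip: complex_norm_square)
  then show ?thesis by (simp add: norm2_def L2_set_def sum_nonneg)
qed

lemma norm2_ldilate [simp]: "norm2 (ldilate p) = norm2 p"
proof -
  have inj: "inj_on (\<lambda>k :: int \<times> int. k + k) A" for A
    by (auto intro!: inj_onI simp: double_pt_inj)
  have "Poly_Mapping.keys (ldilate p) \<subseteq> (\<lambda>k. k + k) ` Poly_Mapping.keys p"
  proof
    fix m assume "m \<in> Poly_Mapping.keys (ldilate p)"
    then have "even_pt m" "half_pt m \<in> Poly_Mapping.keys p"
      by (auto simp: in_keys_iff lookup_ldilate split: if_splits)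
    then show "m \<in> (\<lambda>k. k + k) ` Poly_Mapping.keys p"
      by (intro image_eqI[of _ _ "half_pt m"]) (simp_all only: half_pt_double)
  qed
  then have "norm2 (ldilate p) = L2_set (\<lambda>k. cmod (lk (ldilate p) k)) ((\<lambda>k. k + k) ` Poly_Mapping.keys p)"
    by (intro norm2_superset) simp
  also have "\<dots> = norm2 p"
    unfolding norm2_def L2_set_def by (subst sum.reindex[OF inj]) simp
  finally show ?thesis .
qed

subsection \<open>Inverses modulo small errors\<close>

text \<open>In x = P (f x) + q x the last term is absorbed on the left.\<close>

lemma norm2_le_of_inverse:
  assumes "P * f = 1 - q" "norm1 q < 1"
  shows "norm2 x \<le> norm1 P / (1 - norm1 q) * norm2 (f * x)"
proof -
  have "x = P * (f * x) + q * x"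
    using assms(1) by (metis add.commute add_diff_cancel_left' diff_add_cancel distrib_right mult.assoc mult_1_left)
  then have "norm2 x \<le> norm2 (P * (f * x)) + norm2 (q * x)"
    by (metis norm2_add)
  also have "\<dots> \<le> norm1 P * norm2 (f * x) + norm1 q * norm2 x"
    by (intro add_mono norm2_mult)
  finally have "(1 - norm1 q) * norm2 x \<le> norm1 P * norm2 (f * x)" by (simp add: left_diff_distrib)
  then show ?thesis using assms(2) by (simp add: field_simps)
qed

text \<open>Partial sums of the Neumann series leave the error q^N and, in contrast to the full
  inverse, remain Laurent polynomials.\<close>

lemma approx_inverse:
  assumes "P * f = 1 - q" "norm1 q < 1" "0 < \<eta>"
  obtains N where "norm1 (1 - (P * (\<Sum>n<N. q ^ n)) * f) < \<eta>"
proof -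
  have "(\<lambda>n. norm1 q ^ n) \<longlonglongrightarrow> 0"
    using assms(2) by (intro LIMSEQ_realpow_zero) auto
  then have "\<forall>\<^sub>F n in sequentially. norm1 q ^ n < \<eta>" using assms(3) by (rule order_tendstoD)
  then obtain N where N: "norm1 q ^ N < \<eta>" by (auto simp: eventually_sequentially)
  have "(P * (\<Sum>n<N. q ^ n)) * f = (1 - q) * (\<Sum>n<N. q ^ n)"
    by (simp add: mult_ac flip: assms(1))
  also have "\<dots> = 1 - q ^ N" by (rule one_diff_power_eq[symmetric])
  finally have "1 - (P * (\<Sum>n<N. q ^ n)) * f = q ^ N" by simp
  then show ?thesis using that[of N] norm1_power[of q N] N by simp
qed

definition rows_sum :: "int list list \<Rightarrow> int" where
  "rows_sum p = sum_list (map (\<lambda>r. sum_list (map abs r)) p)"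

lemma norm1_of_int: "norm1 (of_int a) = \<bar>of_int a\<bar>"
  by (metis norm1_single norm_of_int single_of_int)

lemma norm1_rows_poly: "norm1 (rows_poly p) \<le> of_int (rows_sum p)"
proof -
  have row: "norm1 (row_poly r) \<le> of_int (sum_list (map abs r))" for r
  proof (induction r)
    case (Cons a r)
    have "norm1 (row_poly (a # r)) \<le> norm1 (of_int a) + norm1 (mon 0 1 * row_poly r)"
      unfolding row_poly.simps by (rule norm1_add)
    then show ?case using Cons by (simp add: norm1_of_int)
  qed simp
  show ?thesis
  proof (induction p)
    case (Cons r p)
    have "norm1 (rows_poly (r # p)) \<le> norm1 (row_poly r) + norm1 (mon 1 0 * rows_poly p)"
      unfolding rows_poly.simps by (rule norm1_add)
    then show ?case using Cons row[of r] by (simp add: rows_sum_def)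
  qed (simp add: rows_sum_def)
qed

text \<open>An integer certificate: in the product of the two tables, the absolute values left after
  removing c at position (m, n) sum to less than c. Division by a c and a shift of (m, n) to the
  origin turn this into P f = 1 - q.\<close>

lemma inverse_of_rows:
  assumes f: "f = C a * (mon i j * rows_poly fr)" and a: "a \<noteq> 0" and c: "0 < c"
    and small: "rows_sum (rows_add (rows_mul pr fr) (term_rows m n (- c))) < c"
  shows "\<exists>q. C (1 / (a * of_int c)) * (mon (- i - int m) (- j - int n) * rows_poly pr) * f = 1 - q \<and> norm1 q < 1"
proof (intro exI conjI)
  define qr where "qr = rows_add (rows_mul pr fr) (term_rows m n (- c))"
  let ?q = "- (C (1 / of_int c) * (mon (- int m) (- int n) * rows_poly qr))"
  have "rows_poly pr * rows_poly fr = of_int c * mon (int m) (int n) + rows_poly qr"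
    by (simp add: qr_def rows_poly_add rows_poly_term rows_poly_mul)
  moreover have "C (1 / (a * of_int c)) * (mon (- i - int m) (- j - int n) * rows_poly pr) * f
      = (C (1 / (a * of_int c)) * C a) * (mon (- i - int m) (- j - int n) * mon i j) * (rows_poly pr * rows_poly fr)"
    unfolding f by (simp only: mult_ac)
  ultimately have "C (1 / (a * of_int c)) * (mon (- i - int m) (- j - int n) * rows_poly pr) * f
      = C (1 / of_int c) * (mon (- int m) (- int n) * (of_int c * mon (int m) (int n) + rows_poly qr))"
    using a by (simp add: C_mult mon_mult mult_ac)
  also have "\<dots> = (C (1 / of_int c) * of_int c) * (mon (- int m) (- int n) * mon (int m) (int n)) - ?q"
    by (simp add: algebra_simps)
  also have "C (1 / of_int c) * of_int c = 1"
    using c by (simp add: C_def mult_single flip: single_of_int)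
  finally show "C (1 / (a * of_int c)) * (mon (- i - int m) (- j - int n) * rows_poly pr) * f = 1 - ?q"
    by (simp add: mon_mult flip: one_lpoly)
  have "norm1 (- p) = norm1 p" for p by (simp add: norm1_def in_keys_iff keys_def)
  then have "norm1 ?q = norm1 (rows_poly qr) / of_int c"
    using c by (simp add: norm_divide)
  also have "\<dots> < 1" using norm1_rows_poly[of qr] small c by (simp add: qr_def)
  finally show "norm1 ?q < 1" .
qed

text \<open>The Fourier coefficients of \<open>1 / \<Phi>\<close> on the hexagon of radius 6, scaled to make the central one 400
  and rounded.\<close>

definition Phi_inv_rows :: "int list list" where
  "Phi_inv_rows =
    [[1, -3, 1, 6, 1, -3, 1, 0, 0, 0, 0, 0, 0], [-3, 2, 4, -9, -9, 4, 2, -3, 0, 0, 0, 0, 0], [1,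
    4, -9, 3, 23, 3, -9, 4, 1, 0, 0, 0, 0], [6, -9, 3, 17, -32, -32, 17, 3, -9, 6, 0, 0, 0], [1,
    -9, 23, -32, 3, 90, 3, -32, 23, -9, 1, 0, 0], [-3, 4, 3, -32, 90, -120, -120, 90, -32, 3, 4,
    -3, 0], [1, 2, -9, 17, 3, -120, 400, -120, 3, 17, -9, 2, 1], [0, -3, 4, 3, -32, 90, -120,
    -120, 90, -32, 3, 4, -3], [0, 0, 1, -9, 23, -32, 3, 90, 3, -32, 23, -9, 1], [0, 0, 0, 6, -9,
    3, 17, -32, -32, 17, 3, -9, 6], [0, 0, 0, 0, 1, 4, -9, 3, 23, 3, -9, 4, 1], [0, 0, 0, 0, 0,
    -3, 2, 4, -9, -9, 4, 2, -3], [0, 0, 0, 0, 0, 0, 1, -3, 1, 6, 1, -3, 1]]"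

text \<open>Seven terms at even positions: weight 25 in the centre and -4 at the six neighbours
  where \<open>w00\<close> has 555000. The zeros at odd positions keep the approximate inverse in
  \<open>Ldown\<close>.\<close>

definition w00_inv_rows :: "int list list" where
  "w00_inv_rows =
    [[-4, 0, -4, 0, 0], [0, 0, 0, 0, 0], [-4, 0, 25, 0, -4], [0, 0, 0, 0, 0], [0, 0, -4, 0, -4]]"

lemma Phi_inverse: "\<exists>P q. P * Phi = 1 - q \<and> norm1 q < 1"
proof -
  \<comment> \<open>13594956 is the central coefficient of the product, at (9, 9) = (6, 6) + (3,
    3).\<close>
  have 1: "rows_sum (rows_add (rows_mul Phi_inv_rows Phi_rows) (term_rows 9 9 (- 13594956))) < 13594956"
    by code_simp
  show ?thesis
    using inverse_of_rows[OF Phi_rows _ _ 1] by auto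
qed

lemma w00_inverse: "\<exists>P q. P \<in> Ldown \<and> P * w00 = 1 - q \<and> norm1 q < 1"
proof -
  \<comment> \<open>46186200 = 25 * 2380248 - 6 * 4 * 555000 is the central coefficient of the
    product, at (6, 6) = (2, 2) + (4, 4).\<close>
  have 1: "rows_sum (rows_add (rows_mul w00_inv_rows w00_rows) (term_rows 6 6 (- 46186200))) < 46186200"
    by code_simp
  have 3: "dims 5 5 w00_inv_rows" by code_simp
  have 4: "list_all (\<lambda>i. list_all (\<lambda>j. even i \<and> even j \<or> rows_entry w00_inv_rows i j = 0) [0..4]) [0..4]"
    by code_simp
  have 5: "rows_entry w00_inv_rows i j = 0" if "\<not> (even i \<and> even j)" for i j
  proof (cases "i \<in> {0..4} \<and> j \<in> {0..4}")
    case True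
    then show ?thesis using 4 that unfolding list_all_iff set_upto by blast
  next
    case False
    then show ?thesis by (intro rows_entry_outside[OF 3]) auto
  qed
  have "w00 = C 1 * (mon (-6) (-6) * rows_poly w00_rows)" by (simp add: w00_rows)
  from inverse_of_rows[OF this _ _ 1]
  obtain q where q: "C (1 / 46186200) * (mon 0 0 * rows_poly w00_inv_rows) * w00 = 1 - q" "norm1 q < 1"
    by auto
  have "C (1 / 46186200) * (mon 0 0 * rows_poly w00_inv_rows) \<in> Ldown"
    unfolding Ldown_iff
  proof (intro allI impI)
    fix m assume "\<not> even_pt m"
    then show "lk (C (1 / 46186200) * (mon 0 0 * rows_poly w00_inv_rows)) m = 0"
      using 5 by (cases m) (simp add: C_def lookup_single_times lookup_mon_times lookup_rows_poly even_pt_def)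
  qed
  with q show ?thesis by blast
qed

subsection \<open>Parity components\<close>

definition even_part :: "lpoly \<Rightarrow> lpoly" where
  "even_part p = Poly_Mapping.map_key (\<lambda>k. k + k) p"

lemma lookup_even_part [simp]: "lk (even_part p) k = lk p (k + k)"
proof -
  have "inj (\<lambda>k :: int \<times> int. k + k)" by (auto intro!: injI simp: double_pt_inj)
  then show ?thesis by (simp add: even_part_def lookup_map_key)
qed

lemma even_part_add: "even_part (p + q) = even_part p + even_part q"
  by (rule poly_mapping_eqI) (simp add: lookup_add)

lemma even_part_diff: "even_part (p - q) = even_part p - even_part q"
  by (rule poly_mapping_eqI) (simp add: lookup_minus)

lemma even_part_0 [simp]: "even_part 0 = 0"
  by (rule poly_mapping_eqI) simp

lemma even_part_ldilate [simp]: "even_part (ldilate p) = p"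
  by (rule poly_mapping_eqI) simp

text \<open>Linearity over the dilated ring: a factor with even exponents does not change parities.
  All pairings are computed with this rule.\<close>

lemma even_part_ldilate_mult: "even_part (ldilate p * q) = p * even_part q"
proof (induction p rule: lpoly_induct)
  case (single k c)
  show ?case
  proof (rule poly_mapping_eqI)
    fix m
    have "m + m - (k + k) = (m - k) + (m - k)" by simp
    then show "lk (even_part (ldilate (sg k c) * q)) m = lk (sg k c * even_part q) m"
      by (simp only: ldilate_single lookup_single_times lookup_even_part)
  qed
qed (simp_all add: ldilate_add distrib_right even_part_add)

lemma even_part_mon: "\<not> (even i \<and> even j) \<Longrightarrow> even_part (mon i j) = 0"
proof (rule poly_mapping_eqI)
  fix k assume "\<not> (even i \<and> even j)"
  then have "(i, j) \<noteq> k + k" by (cases k) (auto simp flip: mult_2)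
  then show "lk (even_part (mon i j)) k = lk 0 k"
    by (simp add: mon_def lookup_single when_def)
qed

lemma even_part_C_times: "even_part (C c * p) = C c * even_part p"
  by (rule poly_mapping_eqI) (simp add: C_def lookup_single_times)

lemma Ldown_ldilate: "p \<in> Ldown \<Longrightarrow> ldilate (even_part p) = p"
  by (auto simp: Ldown_def)

lemma Ldown_mult: "p \<in> Ldown \<Longrightarrow> q \<in> Ldown \<Longrightarrow> p * q \<in> Ldown"
  by (metis Ldown_ldilate Ldown_def ldilate_mult rangeI)

lemma norm2_even_part: "norm2 (even_part p) \<le> norm2 p"
proof -
  have inj: "inj_on (\<lambda>k :: int \<times> int. k + k) A" for A
    by (auto intro!: inj_onI simp: double_pt_inj)
  have "L2_set (\<lambda>k. cmod (lk (even_part p) k)) (Poly_Mapping.keys (even_part p))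
      = L2_set (\<lambda>k. cmod (lk p k)) ((\<lambda>k. k + k) ` Poly_Mapping.keys (even_part p))"
    unfolding L2_set_def by (subst sum.reindex[OF inj]) simp
  also have "\<dots> \<le> norm2 p"
    unfolding norm2_def L2_set_def
    by (intro real_sqrt_le_mono sum_mono2) (auto simp: in_keys_iff)
  finally show ?thesis by (simp add: norm2_def)
qed

lemma E_eq: "E = {(0, 0), (1, 0), (0, 1), (1, 1)}"
  by (auto simp: E_def)

lemma sum_E: "(\<Sum>s\<in>E. f s) = f (0, 0) + f (1, 0) + f (0, 1) + f (1, 1)" for f :: "nat \<times> nat \<Rightarrow> 'a :: comm_monoid_add"
  by (simp add: E_eq add.assoc)

lemma ball_E: "(\<forall>s\<in>E. P s) \<longleftrightarrow> P (0, 0) \<and> P (1, 0) \<and> P (0, 1) \<and> P (1, 1)"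
  by (simp add: E_eq)

lemma Hs_eq: "s \<in> E - {(0, 0)} \<Longrightarrow> Hs s = w s - w (0, 0) * mon (int (fst s)) (int (snd s))"
  by (auto simp: E_eq Hs_def w_def H10_def H01_def H11_def)

text \<open>In (sum_r w_r zeta^(-r)) (w_s - w_(0,0) zeta^s) even exponents occur only for w_(0,0)
  w_s, from r = 0, and for - w_s w_(0,0), from r = s. These two cancel.\<close>

lemma even_part_HPhi_Hs:
  assumes "s \<in> E - {(0, 0)}"
  shows "even_part (lconj (C (2 ^ 6 * 362880) * H) * Phi * Hs s) = 0"
proof -
  define p where "p t = even_part (w t)" for t
  have w: "w t = ldilate (p t)" for t
    by (simp add: p_def Ldown_ldilate w_Ldown)
  \<comment> \<open>Dilated factors are pulled out, so that only parities of bare monomials remain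
    to be decided.\<close>
  have e: "even_part (ldilate a * b * (ldilate c - ldilate d * e))
      = a * (c * even_part b) - a * (d * even_part (b * e))" for a b c d e
  proof -
    have "ldilate a * b * (ldilate c - ldilate d * e)
       = ldilate a * (ldilate c * b) - ldilate a * (ldilate d * (b * e))" by (simp add: algebra_simps)
    then show ?thesis by (simp only: even_part_diff even_part_ldilate_mult)
  qed
  have e1: "even_part (ldilate a * (ldilate c - ldilate d * e)) = a * (c * even_part 1) - a * (d * even_part e)" for a c d e
    using e[of a 1 c d e] by simp
  have "even_part 1 = 1" using even_part_ldilate[of 1] by (simp add: ldilate_def)
  with assms show ?thesis
    unfolding Hs_eq[OF assms] HPhi_split w distrib_right even_part_add e e1
    by (auto simp: E_eq even_part_mon mon_mult mult_ac simp flip: one_lpoly)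
qed

subsection \<open>The basis over the dilated ring\<close>

text \<open>Terms of equal exponent in an absolutely summable family are collected. Sums, products,
  parity averages and Neumann series all enter the Wiener algebra this way, each with its own index
  set.\<close>

lemma L_l1_regroup:
  fixes e :: "'i \<Rightarrow> int \<times> int"
  assumes c: "(\<lambda>i. cmod (c i)) summable_on A"
    and F: "\<And>\<zeta>. \<zeta> \<in> torus \<Longrightarrow> F \<zeta> = (\<Sum>\<^sub>\<infinity>i\<in>A. c i * zpow \<zeta> (e i))"
  shows "F \<in> L_l1"
proof -
  \<comment> \<open>The indices are listed fibre by fibre over their exponents, ready for summation
    in two stages.\<close>
  let ?S = "Sigma UNIV (\<lambda>k. {i \<in> A. e i = k})"
  have bij: "bij_betw snd ?S A"
    by (rule bij_betwI[where g = "\<lambda>i. (e i, i)"]) auto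
  have abs: "(\<lambda>x. norm (c (snd x))) summable_on ?S"
    using c summable_on_reindex_bij_betw[OF bij, of "\<lambda>i. cmod (c i)"] by simp
  then have fib: "(\<lambda>i. norm (c i)) summable_on {i \<in> A. e i = k}" for k
    unfolding Infinite_Sum.abs_summable_on_Sigma_iff by (cases k) simp
  from abs have tot: "(\<lambda>k. \<Sum>\<^sub>\<infinity>i\<in>{i \<in> A. e i = k}. cmod (c i)) summable_on UNIV"
    unfolding Infinite_Sum.abs_summable_on_Sigma_iff by (simp add: infsum_nonneg)
  define a where "a k = (\<Sum>\<^sub>\<infinity>i\<in>{i \<in> A. e i = k}. c i)" for k
  have "(\<lambda>k. cmod (a k)) summable_on UNIV"
    by (rule summable_on_comparison_test[OF tot]) (use fib in \<open>auto simp: a_def intro!: norm_infsum_bound\<close>)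
  moreover have "F \<zeta> = (\<Sum>\<^sub>\<infinity>k. a k * zpow \<zeta> k)" if z: "\<zeta> \<in> torus" for \<zeta>
  proof -
    let ?f = "\<lambda>x. c (snd x) * zpow \<zeta> (fst x)"
    have "(\<lambda>x. norm (?f x)) summable_on ?S"
      using abs by (rule Infinite_Sum.abs_summable_on_comparison_test) (simp add: norm_mult cmod_zpow[OF z])
    then have s: "?f summable_on ?S" by (rule Infinite_Sum.abs_summable_summable)
    have "F \<zeta> = (\<Sum>\<^sub>\<infinity>x\<in>?S. c (snd x) * zpow \<zeta> (e (snd x)))"
      unfolding F[OF z] by (rule infsum_reindex_bij_betw[OF bij, symmetric])
    also have "\<dots> = infsum ?f ?S" by (rule infsum_cong) auto
    also have "\<dots> = (\<Sum>\<^sub>\<infinity>k. \<Sum>\<^sub>\<infinity>i\<in>{i \<in> A. e i = k}. c i * zpow \<zeta> k)"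
      using infsum_Sigma_banach[OF s] by simp
    also have "\<dots> = (\<Sum>\<^sub>\<infinity>k. a k * zpow \<zeta> k)"
      by (simp add: a_def infsum_cmult_left')
    finally show ?thesis .
  qed
  ultimately show ?thesis unfolding L_l1_def by blast
qed

lemma Ldown_l1_cong: "F \<in> Ldown_l1 \<Longrightarrow> (\<And>\<zeta>. \<zeta> \<in> torus \<Longrightarrow> G \<zeta> = F \<zeta>) \<Longrightarrow> G \<in> Ldown_l1"
  unfolding Ldown_l1_def by auto

lemma abs_summable_zpow:
  assumes "(\<lambda>k. cmod (a k)) summable_on A" "\<zeta> \<in> torus"
  shows "(\<lambda>k. a k * zpow \<zeta> (e k)) summable_on A"
proof (rule Infinite_Sum.abs_summable_summable)
  show "(\<lambda>k. norm (a k * zpow \<zeta> (e k))) summable_on A"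
    using assms by (simp add: norm_mult cmod_zpow)
qed

lemma L_l1_add:
  assumes "F \<in> L_l1" "G \<in> L_l1" shows "(\<lambda>\<zeta>. F \<zeta> + G \<zeta>) \<in> L_l1"
proof -
  from assms obtain a b where a: "(\<lambda>k. cmod (a k)) summable_on UNIV" "\<forall>\<zeta>\<in>torus. F \<zeta> = (\<Sum>\<^sub>\<infinity>k. a k * zpow \<zeta> k)"
    and b: "(\<lambda>k. cmod (b k)) summable_on UNIV" "\<forall>\<zeta>\<in>torus. G \<zeta> = (\<Sum>\<^sub>\<infinity>k. b k * zpow \<zeta> k)"
    unfolding L_l1_def by blast
  show ?thesis
  proof (rule L_l1_regroup[where c = "\<lambda>k. a k + b k" and e = "\<lambda>k. k" and A = UNIV])
    show "(\<lambda>k. cmod (a k + b k)) summable_on UNIV"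
      by (rule summable_on_comparison_test[OF summable_on_add[OF a(1) b(1)]]) (simp_all add: norm_triangle_ineq)
    fix \<zeta> :: "complex \<times> complex" assume z: "\<zeta> \<in> torus"
    have "(\<Sum>\<^sub>\<infinity>k. (a k + b k) * zpow \<zeta> k) = (\<Sum>\<^sub>\<infinity>k. a k * zpow \<zeta> k) + (\<Sum>\<^sub>\<infinity>k. b k * zpow \<zeta> k)"
      using infsum_add[OF abs_summable_zpow[OF a(1) z, of "\<lambda>k. k"] abs_summable_zpow[OF b(1) z, of "\<lambda>k. k"]]
      by (simp add: distrib_right)
    then show "F \<zeta> + G \<zeta> = (\<Sum>\<^sub>\<infinity>k. (a k + b k) * zpow \<zeta> k)" using a(2) b(2) z by simp
  qed
qed

lemma abs_summable_on_times:
  fixes a :: "'a \<Rightarrow> complex" and b :: "'b \<Rightarrow> complex"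
  assumes "(\<lambda>k. cmod (a k)) summable_on A" "(\<lambda>k. cmod (b k)) summable_on B"
  shows "(\<lambda>i. cmod (case i of (k, l) \<Rightarrow> a k * b l)) summable_on A \<times> B"
  unfolding Infinite_Sum.abs_summable_on_Sigma_iff
  using assms
  by (auto simp: norm_mult infsum_cmult_right' infsum_nonneg
      intro!: summable_on_cmult_left summable_on_cmult_right)

lemma L_l1_mult:
  assumes "F \<in> L_l1" "G \<in> L_l1" shows "(\<lambda>\<zeta>. F \<zeta> * G \<zeta>) \<in> L_l1"
proof -
  from assms obtain a b where a: "(\<lambda>k. cmod (a k)) summable_on UNIV" "\<forall>\<zeta>\<in>torus. F \<zeta> = (\<Sum>\<^sub>\<infinity>k. a k * zpow \<zeta> k)"
    and b: "(\<lambda>k. cmod (b k)) summable_on UNIV" "\<forall>\<zeta>\<in>torus. G \<zeta> = (\<Sum>\<^sub>\<infinity>k. b k * zpow \<zeta> k)"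
    unfolding L_l1_def by blast
  have ab: "(\<lambda>i. cmod (case i of (k, l) \<Rightarrow> a k * b l)) summable_on UNIV \<times> UNIV"
    using abs_summable_on_times[OF a(1) b(1)] .
  show ?thesis
  proof (rule L_l1_regroup[where c = "\<lambda>(k, l). a k * b l" and e = "\<lambda>(k, l). k + l" and A = "UNIV \<times> UNIV", OF ab])
    fix \<zeta> :: "complex \<times> complex" assume z: "\<zeta> \<in> torus"
    let ?f = "\<lambda>i. (case i of (k, l) \<Rightarrow> a k * b l) * zpow \<zeta> (case i of (k, l) \<Rightarrow> k + l)"
    have "infsum ?f (UNIV \<times> UNIV) = (\<Sum>\<^sub>\<infinity>k. \<Sum>\<^sub>\<infinity>l. ?f (k, l))"
      using infsum_Sigma_banach[OF abs_summable_zpow[OF ab z, of "\<lambda>(k, l). k + l"]] by simp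
    also have "\<dots> = (\<Sum>\<^sub>\<infinity>k. \<Sum>\<^sub>\<infinity>l. (a k * zpow \<zeta> k) * (b l * zpow \<zeta> l))"
      using torus_nonzero[OF z] by (intro infsum_cong) (simp add: zpow_add mult_ac)
    also have "\<dots> = F \<zeta> * G \<zeta>"
      using a(2) b(2) z by (simp add: infsum_cmult_right' infsum_cmult_left')
    finally show "F \<zeta> * G \<zeta> = infsum ?f (UNIV \<times> UNIV)" ..
  qed
qed

lemma leval_L_l1 [simp]: "leval p \<in> L_l1"
  by (rule L_l1_regroup[where c = "lk p" and e = "\<lambda>k. k" and A = "Poly_Mapping.keys p"])
     (simp_all add: leval_def)

text \<open>1 / f is the sum of the P q^n. Indexed by n and exponent, the family is absolutely
  summable because |P q^n|_1 <= |P|_1 |q|_1^n; the closed form \<open>G\<close> is its sum at each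
  point of the torus.\<close>

lemma L_l1_inverse:
  assumes "P * f = 1 - q" "norm1 q < 1"
  shows "\<exists>G\<in>L_l1. \<forall>\<zeta>\<in>torus. G \<zeta> * leval f \<zeta> = 1"
proof
  define K where "K n = Poly_Mapping.keys (P * q ^ n)" for n
  define G where "G \<zeta> = leval P \<zeta> / (1 - leval q \<zeta>)" for \<zeta>
  have leval_pow: "leval (P * q ^ n) \<zeta> = leval P \<zeta> * leval q \<zeta> ^ n" if "\<zeta> \<in> torus" for n \<zeta>
  proof -
    have "leval (q ^ n) \<zeta> = leval q \<zeta> ^ n"
      using torus_nonzero[OF that] by (induction n) (simp_all add: leval_mult)
    then show ?thesis using torus_nonzero[OF that] by (simp add: leval_mult)
  qed
  have lt1: "cmod (leval q \<zeta>) < 1" if "\<zeta> \<in> torus" for \<zeta>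
  proof -
    have "cmod (leval q \<zeta>) \<le> norm1 q"
      unfolding leval_def norm1_def by (rule order_trans[OF norm_sum]) (simp add: norm_mult cmod_zpow[OF that])
    then show ?thesis using assms(2) by simp
  qed
  have summ: "summable (\<lambda>n. norm1 P * norm1 q ^ n)"
    using assms(2) by (intro summable_mult summable_geometric) simp
  have abs: "(\<lambda>i. cmod (case i of (n, k) \<Rightarrow> lk (P * q ^ n) k)) summable_on Sigma UNIV K"
    unfolding Infinite_Sum.abs_summable_on_Sigma_iff
  proof (intro conjI ballI)
    have "summable (\<lambda>n. norm1 (P * q ^ n))"
      by (rule summable_comparison_test'[OF summ])
         (simp, meson norm1_mult norm1_power norm1_nonneg mult_left_mono order_trans)
    then have "(\<lambda>n. norm1 (P * q ^ n)) summable_on UNIV"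
      by (intro norm_summable_imp_summable_on) simp
    then show "(\<lambda>n. norm (\<Sum>\<^sub>\<infinity>k\<in>K n. cmod (case (n, k) of (n, k) \<Rightarrow> lk (P * q ^ n) k))) summable_on UNIV"
      by (simp add: K_def norm1_def sum_nonneg)
  qed (simp add: K_def)
  show "G \<in> L_l1"
  proof (rule L_l1_regroup[where c = "\<lambda>(n, k). lk (P * q ^ n) k" and e = snd, OF abs])
    fix \<zeta> :: "complex \<times> complex" assume z: "\<zeta> \<in> torus"
    have "(\<Sum>\<^sub>\<infinity>i\<in>Sigma UNIV K. (case i of (n, k) \<Rightarrow> lk (P * q ^ n) k) * zpow \<zeta> (snd i))
        = (\<Sum>\<^sub>\<infinity>n. leval (P * q ^ n) \<zeta>)"
      using infsum_Sigma_banach[OF abs_summable_zpow[OF abs z, of snd]]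
      by (simp add: leval_def K_def)
    also have "((\<lambda>n. leval P \<zeta> * leval q \<zeta> ^ n) has_sum G \<zeta>) UNIV"
    proof (rule norm_summable_imp_has_sum)
      show "(\<lambda>n. leval P \<zeta> * leval q \<zeta> ^ n) sums G \<zeta>"
        using sums_mult[OF geometric_sums[OF lt1[OF z]], of "leval P \<zeta>"] by (simp add: G_def)
      show "summable (\<lambda>n. cmod (leval P \<zeta> * leval q \<zeta> ^ n))"
        using lt1[OF z] by (auto simp: norm_mult norm_power intro!: summable_mult summable_geometric)
    qed
    then have "(\<Sum>\<^sub>\<infinity>n. leval (P * q ^ n) \<zeta>) = G \<zeta>"
      by (simp add: leval_pow[OF z] infsumI)
    finally show "G \<zeta> = (\<Sum>\<^sub>\<infinity>i\<in>Sigma UNIV K. (case i of (n, k) \<Rightarrow> lk (P * q ^ n) k) * zpow \<zeta> (snd i))" ..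
  qed
  show "\<forall>\<zeta>\<in>torus. G \<zeta> * leval f \<zeta> = 1"
  proof
    fix \<zeta> :: "complex \<times> complex" assume z: "\<zeta> \<in> torus"
    have "leval P \<zeta> * leval f \<zeta> = 1 - leval q \<zeta>"
      using arg_cong[OF assms(1), of "\<lambda>p. leval p \<zeta>"] torus_nonzero[OF z] by (simp add: leval_mult leval_diff)
    moreover have "leval q \<zeta> \<noteq> 1" using lt1[OF z] by auto
    ultimately show "G \<zeta> * leval f \<zeta> = 1" by (simp add: G_def)
  qed
qed

lemma zsq_torus [simp]: "\<zeta> \<in> torus \<Longrightarrow> zsq \<zeta> \<in> torus"
  by (simp add: torus_def zsq_def norm_power)

lemma zflip_torus [simp]: "\<zeta> \<in> torus \<Longrightarrow> zflip s \<zeta> \<in> torus"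
  by (simp add: torus_def zflip_def norm_mult norm_power)

lemma zsq_zflip [simp]: "zsq (zflip s \<zeta>) = zsq \<zeta>"
  by (simp add: zsq_def zflip_def power_mult_distrib flip: power_mult)

lemma Ldown_l1_I: "F \<in> L_l1 \<Longrightarrow> (\<lambda>\<zeta>. F (zsq \<zeta>)) \<in> Ldown_l1"
  unfolding Ldown_l1_def by blast

lemma Ldown_l1_mult:
  assumes "F \<in> Ldown_l1" "G \<in> Ldown_l1" shows "(\<lambda>\<zeta>. F \<zeta> * G \<zeta>) \<in> Ldown_l1"
proof -
  from assms obtain F' G' where "F' \<in> L_l1" "\<forall>\<zeta>\<in>torus. F \<zeta> = F' (zsq \<zeta>)" "G' \<in> L_l1" "\<forall>\<zeta>\<in>torus. G \<zeta> = G' (zsq \<zeta>)"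
    unfolding Ldown_l1_def by auto
  then show ?thesis
    using L_l1_mult[of F' G'] unfolding Ldown_l1_def by (intro CollectI bexI[of _ "\<lambda>\<zeta>. F' \<zeta> * G' \<zeta>"]) auto
qed

lemma Ldown_l1_add:
  assumes "F \<in> Ldown_l1" "G \<in> Ldown_l1" shows "(\<lambda>\<zeta>. F \<zeta> + G \<zeta>) \<in> Ldown_l1"
proof -
  from assms obtain F' G' where "F' \<in> L_l1" "\<forall>\<zeta>\<in>torus. F \<zeta> = F' (zsq \<zeta>)" "G' \<in> L_l1" "\<forall>\<zeta>\<in>torus. G \<zeta> = G' (zsq \<zeta>)"
    unfolding Ldown_l1_def by auto
  then show ?thesis
    using L_l1_add[of F' G'] unfolding Ldown_l1_def by (intro CollectI bexI[of _ "\<lambda>\<zeta>. F' \<zeta> + G' \<zeta>"]) auto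
qed

lemma Ldown_l1_const: "(\<lambda>\<zeta>. c) \<in> Ldown_l1"
  using Ldown_l1_I[OF leval_L_l1[of "C c"]] by simp

lemma leval_Ldown_l1: "p \<in> Ldown \<Longrightarrow> leval p \<in> Ldown_l1"
  by (rule Ldown_l1_cong[OF Ldown_l1_I[OF leval_L_l1[of "even_part p"]]])
     (simp add: Ldown_ldilate flip: leval_ldilate)

section \<open>Sums over sign changes\<close>

lemma zpow_zflip: "zpow (zflip s \<zeta>) k = (-1) powi (int (fst s) * fst k + int (snd s) * snd k) * zpow \<zeta> k"
  by (simp add: zpow_def zflip_def power_int_mult_distrib power_int_add flip: power_int_mult power_int_of_nat)

text \<open>Orthogonality of characters for the group of four sign changes.\<close>

lemma sum_zflip_zpow: "(\<Sum>s\<in>E. zpow (zflip s \<zeta>) k) = (if even_pt k then 4 * zpow \<zeta> k else 0)"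
  by (auto simp: sum_E zpow_zflip even_pt_def power_int_add elim!: evenE oddE)

lemma sum_zflip_leval: "(\<Sum>s\<in>E. leval p (zflip s \<zeta>)) = 4 * leval (even_part p) (zsq \<zeta>)"
proof (induction p rule: lpoly_induct)
  case (single k c)
  have "even_part (sg k c) = (if even_pt k then sg (half_pt k) c else 0)"
  proof (rule poly_mapping_eqI)
    fix m show "lk (even_part (sg k c)) m = lk (if even_pt k then sg (half_pt k) c else 0) m"
      using half_pt_double[of k] by (auto simp: lookup_single when_def)
  qed
  moreover have "even_pt k \<Longrightarrow> zpow (zsq \<zeta>) (half_pt k) = zpow \<zeta> k"
    by (metis half_pt_double zpow_double)
  ultimately show ?case
    using sum_zflip_zpow[of \<zeta> k] by (simp add: leval_single flip: sum_distrib_left)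
qed (simp_all add: even_part_add leval_add sum.distrib distrib_left)

text \<open>Only the terms with even exponents survive the summation, each four times; they form a
  series in zeta^2.\<close>

lemma sum_zflip_Ldown_l1:
  assumes "F \<in> L_l1" shows "(\<lambda>\<zeta>. \<Sum>s\<in>E. F (zflip s \<zeta>)) \<in> Ldown_l1"
proof -
  from assms obtain a where a: "(\<lambda>k. cmod (a k)) summable_on UNIV" "\<forall>\<zeta>\<in>torus. F \<zeta> = (\<Sum>\<^sub>\<infinity>k. a k * zpow \<zeta> k)"
    unfolding L_l1_def by blast
  define A where "A = {k. even_pt k}"
  define G where "G \<zeta> = (\<Sum>\<^sub>\<infinity>k\<in>A. (4 * a k) * zpow \<zeta> (half_pt k))" for \<zeta>
  have "(\<lambda>k. cmod (4 * a k)) summable_on UNIV"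
    using a(1) by (simp add: norm_mult summable_on_cmult_right')
  then have "(\<lambda>k. cmod (4 * a k)) summable_on A"
    by (rule summable_on_subset_banach) simp
  then have "G \<in> L_l1" by (rule L_l1_regroup) (simp add: G_def)
  moreover have "(\<Sum>s\<in>E. F (zflip s \<zeta>)) = G (zsq \<zeta>)" if z: "\<zeta> \<in> torus" for \<zeta>
  proof -
    have "(\<Sum>s\<in>E. F (zflip s \<zeta>)) = (\<Sum>s\<in>E. \<Sum>\<^sub>\<infinity>k. a k * zpow (zflip s \<zeta>) k)"
      using a(2) z by simp
    also have "\<dots> = (\<Sum>\<^sub>\<infinity>k. \<Sum>s\<in>E. a k * zpow (zflip s \<zeta>) k)"
      using abs_summable_zpow[OF a(1) zflip_torus[OF z], where e = "\<lambda>k. k"]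
      by (simp only: sum_E infsum_add summable_on_add)
    also have "\<dots> = (\<Sum>\<^sub>\<infinity>k. if even_pt k then 4 * a k * zpow \<zeta> k else 0)"
      by (intro infsum_cong) (simp add: sum_zflip_zpow flip: sum_distrib_left)
    also have "\<dots> = G (zsq \<zeta>)"
      unfolding G_def A_def
      by (rule infsum_cong_neutral) (auto, metis half_pt_double zpow_double)
    finally show ?thesis .
  qed
  ultimately show ?thesis unfolding Ldown_l1_def by blast
qed

lemma leval_zflip_Ldown: "p \<in> Ldown \<Longrightarrow> leval p (zflip s \<zeta>) = leval p \<zeta>"
  by (metis Ldown_ldilate leval_ldilate zsq_zflip)

lemma Ldown_l1_zflip: "F \<in> Ldown_l1 \<Longrightarrow> \<zeta> \<in> torus \<Longrightarrow> F (zflip s \<zeta>) = F \<zeta>"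
  unfolding Ldown_l1_def by auto

lemma leval_mult_torus: "\<zeta> \<in> torus \<Longrightarrow> leval (p * q) \<zeta> = leval p \<zeta> * leval q \<zeta>"
  using torus_nonzero by (simp add: leval_mult)

abbreviation HPhi :: lpoly where
  "HPhi \<equiv> lconj (C (2 ^ 6 * 362880) * H) * Phi"

text \<open>The fixed point equation of Phi multiplied by c, with 2^4 = 2^6 / 4.\<close>

lemma even_part_HPhi_H: "even_part (HPhi * H) = C (2 ^ 4 * 362880) * Phi"
proof (rule poly_mapping_eqI)
  fix k
  have "HPhi * H = C (2 ^ 6 * 362880) * (H * lconj H * Phi)"
    by (simp add: lconj_mult lconj_C mult_ac)
  then have "lk (even_part (HPhi * H)) k = 2 ^ 6 * 362880 * lk (H * lconj H * Phi) (k + k)"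
    by (simp only: C_def lookup_single_times lookup_even_part diff_zero)
  then show "lk (even_part (HPhi * H)) k = lk (C (2 ^ 4 * 362880) * Phi) k"
    by (simp only: even_lookup_HHPhi C_def lookup_single_times diff_zero) simp
qed

text \<open>Existence: pairing with W determines the coefficient of H. The parity classes s \<noteq>
  0 then determine the other three after division by \<open>w00\<close>, and class 0 is correct
  because the pairings agree. Uniqueness: the pairing removes H, and the four sign changes separate
  the rest.\<close>

lemma torus_basis_Hs: "torus_basis Ldown_l1 L_l1 E (\<lambda>s. leval (Hs s))"
proof -
  obtain IP where IP: "IP \<in> L_l1" "\<And>\<zeta>. \<zeta> \<in> torus \<Longrightarrow> IP \<zeta> * leval Phi \<zeta> = 1"
    using Phi_inverse L_l1_inverse by metis
  obtain Iw where Iw: "Iw \<in> Ldown_l1" "\<And>\<zeta>. \<zeta> \<in> torus \<Longrightarrow> Iw \<zeta> * leval w00 \<zeta> = 1"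
  proof -
    obtain P q where Pq: "P \<in> Ldown" "P * w00 = 1 - q" "norm1 q < 1" using w00_inverse by auto
    obtain G where G: "G \<in> L_l1" "\<forall>\<zeta>\<in>torus. G \<zeta> * leval w00 \<zeta> = 1"
      using L_l1_inverse[OF Pq(2,3)] by auto
    have w: "w00 \<in> Ldown" using w_Ldown[of "(0, 0)"] by (simp add: w_def)
    \<comment> \<open>The average over sign changes has only even exponents and is still an inverse,
      because \<open>w00\<close> is invariant under sign changes.\<close>
    have "(\<lambda>\<zeta>. (1 / 4) * (\<Sum>s\<in>E. G (zflip s \<zeta>))) \<in> Ldown_l1"
      by (intro Ldown_l1_mult Ldown_l1_const sum_zflip_Ldown_l1 G)
    moreover have "1 / 4 * (\<Sum>s\<in>E. G (zflip s \<zeta>)) * leval w00 \<zeta> = 1" if z: "\<zeta> \<in> torus" for \<zeta>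
    proof -
      have *: "G (zflip s \<zeta>) * leval w00 \<zeta> = 1" for s
        using G(2) z by (metis leval_zflip_Ldown[OF w] zflip_torus)
      have "1 / 4 * (\<Sum>s\<in>E. G (zflip s \<zeta>)) * leval w00 \<zeta> = 1 / 4 * (\<Sum>s\<in>E. G (zflip s \<zeta>) * leval w00 \<zeta>)"
        by (simp add: sum_distrib_right)
      then show ?thesis unfolding * by (simp only: sum_E) simp
    qed
    ultimately show thesis by (rule that)
  qed
  have w0_nz: "leval w00 \<zeta> \<noteq> 0" if "\<zeta> \<in> torus" for \<zeta> using Iw(2)[OF that] by auto
  have Phi_nz: "leval Phi \<zeta> \<noteq> 0" if "\<zeta> \<in> torus" for \<zeta> using IP(2)[OF that] by auto
  define W where "W s \<zeta> = leval (w s) \<zeta>" for s \<zeta>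
  have W_flip: "W s (zflip t \<zeta>) = W s \<zeta>" for s t \<zeta>
    by (simp add: W_def leval_zflip_Ldown w_Ldown)
  have W_Ldown: "W s \<in> Ldown_l1" for s
    unfolding W_def by (rule leval_Ldown_l1[OF w_Ldown])
  have Hs: "leval (Hs s) \<zeta> = W s \<zeta> - W (0, 0) \<zeta> * (fst \<zeta> ^ fst s * snd \<zeta> ^ snd s)"
    if "s \<in> E - {(0, 0)}" "\<zeta> \<in> torus" for s \<zeta>
    using torus_nonzero[OF that(2)] by (simp add: Hs_eq[OF that(1)] leval_diff leval_mult leval_mon W_def)
  have pair_H: "(\<Sum>s\<in>E. leval HPhi (zflip s \<zeta>) * leval H (zflip s \<zeta>)) = 2 ^ 6 * 362880 * leval Phi (zsq \<zeta>)"
    if z: "\<zeta> \<in> torus" for \<zeta>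
  proof -
    have "(\<Sum>s\<in>E. leval HPhi (zflip s \<zeta>) * leval H (zflip s \<zeta>)) = (\<Sum>s\<in>E. leval (HPhi * H) (zflip s \<zeta>))"
      by (simp only: leval_mult_torus[OF zflip_torus[OF z]])
    then show ?thesis
      by (simp only: sum_zflip_leval even_part_HPhi_H leval_mult_torus[OF zsq_torus[OF z]] leval_C) simp
  qed
  have pair_Hs: "(\<Sum>t\<in>E. leval HPhi (zflip t \<zeta>) * leval (Hs s) (zflip t \<zeta>)) = 0"
    if s: "s \<in> E - {(0, 0)}" and z: "\<zeta> \<in> torus" for \<zeta> s
  proof -
    have "(\<Sum>t\<in>E. leval HPhi (zflip t \<zeta>) * leval (Hs s) (zflip t \<zeta>)) = (\<Sum>t\<in>E. leval (HPhi * Hs s) (zflip t \<zeta>))"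
      by (simp only: leval_mult_torus[OF zflip_torus[OF z]])
    then show ?thesis by (simp only: sum_zflip_leval even_part_HPhi_Hs[OF s]) simp
  qed
  have HPhi_W: "leval HPhi \<zeta> = (\<Sum>s\<in>E. W s \<zeta> * leval (mon (- int (fst s)) (- int (snd s))) \<zeta>)"
    if z: "\<zeta> \<in> torus" for \<zeta>
    unfolding HPhi_split sum_E W_def
    by (simp only: leval_add leval_mult_torus[OF z]) (simp flip: one_lpoly)
  have ex: "\<exists>c. (\<forall>i\<in>E. c i \<in> Ldown_l1) \<and> (\<forall>\<zeta>\<in>torus. F \<zeta> = (\<Sum>i\<in>E. c i \<zeta> * leval (Hs i) \<zeta>))"
    if F: "F \<in> L_l1" for F
  proof -
    \<comment> \<open>The coefficient function of zeta^s when G is split into parity classes: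
      multiplication by zeta^(-s) moves this class to the even one, and averaging isolates
      it.\<close>
    define comp where "comp G s \<zeta> = (1 / 4) * (\<Sum>t\<in>E. leval (mon (- int (fst s)) (- int (snd s))) (zflip t \<zeta>) * G (zflip t \<zeta>))"
      for G :: "complex \<times> complex \<Rightarrow> complex" and s \<zeta>
    have comp_Ldown: "comp G s \<in> Ldown_l1" if "G \<in> L_l1" for G s
      unfolding comp_def by (intro Ldown_l1_mult Ldown_l1_const sum_zflip_Ldown_l1 L_l1_mult leval_L_l1 that)
    have comp_eq: "G \<zeta> = comp G (0, 0) \<zeta> + comp G (1, 0) \<zeta> * fst \<zeta> + comp G (0, 1) \<zeta> * snd \<zeta>
        + comp G (1, 1) \<zeta> * (fst \<zeta> * snd \<zeta>)" if z: "\<zeta> \<in> torus" for G \<zeta>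
      using torus_nonzero[OF z]
      by (cases \<zeta>) (simp add: comp_def sum_E leval_mon zflip_def power_int_minus field_simps)
    have pair_comp: "(\<Sum>s\<in>E. leval HPhi (zflip s \<zeta>) * G (zflip s \<zeta>)) = 4 * (\<Sum>s\<in>E. W s \<zeta> * comp G s \<zeta>)"
      if z: "\<zeta> \<in> torus" for G \<zeta>
    proof -
      have "(\<Sum>t\<in>E. leval HPhi (zflip t \<zeta>) * G (zflip t \<zeta>))
          = (\<Sum>t\<in>E. \<Sum>s\<in>E. W s \<zeta> * (leval (mon (- int (fst s)) (- int (snd s))) (zflip t \<zeta>) * G (zflip t \<zeta>)))"
        by (simp only: HPhi_W[OF zflip_torus[OF z]] W_flip sum_distrib_right mult.assoc)
      also have "\<dots> = (\<Sum>s\<in>E. W s \<zeta> * (4 * comp G s \<zeta>))"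
        by (subst sum.swap) (simp add: comp_def flip: sum_distrib_left)
      finally show ?thesis by (simp add: sum_distrib_left mult_ac)
    qed
    \<comment> \<open>The pairing of W with F divided by the pairing of W with H, which is 2^6 *
      362880 Phi(zeta^2).\<close>
    define c0 where "c0 \<zeta> = (\<Sum>s\<in>E. leval HPhi (zflip s \<zeta>) * F (zflip s \<zeta>)) * (IP (zsq \<zeta>) * (1 / (2 ^ 6 * 362880)))" for \<zeta>
    \<comment> \<open>In class s \<noteq> 0 of c0 H + sum_t c_t H_t only H and, with factor -
      w_(0,0), H_s occur. Comparison with F gives w_(0,0) c_s = c0 \<open>comp (leval H) s\<close> -
      \<open>comp F s\<close>.\<close>
    define c where "c s \<zeta> = (if s = (0, 0) then c0 \<zeta>
        else (c0 \<zeta> * comp (leval H) s \<zeta> + (-1) * comp F s \<zeta>) * Iw \<zeta>)" for s \<zeta>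
    have c0: "c0 \<in> Ldown_l1"
      unfolding c0_def by (intro Ldown_l1_mult sum_zflip_Ldown_l1 L_l1_mult leval_L_l1 F Ldown_l1_I IP Ldown_l1_const)
    have "c s \<in> Ldown_l1" for s
    proof (cases "s = (0, 0)")
      case False
      then have "c s = (\<lambda>\<zeta>. (c0 \<zeta> * comp (leval H) s \<zeta> + (-1) * comp F s \<zeta>) * Iw \<zeta>)"
        by (auto simp: c_def)
      then show ?thesis
        by (simp only:) (intro Ldown_l1_mult Ldown_l1_add c0 comp_Ldown leval_L_l1 F Ldown_l1_const Iw)
    next
      case True
      then have "c s = c0" by (auto simp: c_def)
      then show ?thesis using c0 by simp
    qed
    moreover have "F \<zeta> = (\<Sum>i\<in>E. c i \<zeta> * leval (Hs i) \<zeta>)" if z: "\<zeta> \<in> torus" for \<zeta>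
    proof -
      obtain x y where xy: "\<zeta> = (x, y)" by force
      define f where "f s = comp F s \<zeta>" for s
      define h where "h s = comp (leval H) s \<zeta>" for s
      define v where "v s = W s \<zeta>" for s
      define b where "b s = c s \<zeta>" for s
      have v0: "v (0, 0) \<noteq> 0" "Iw \<zeta> = 1 / v (0, 0)"
        using w0_nz[OF z] Iw(2)[OF z] by (auto simp: v_def W_def w_def field_simps)
      have D: "(\<Sum>s\<in>E. v s * h s) \<noteq> 0"
        using pair_comp[OF z, of "leval H"] pair_H[OF z] Phi_nz[OF zsq_torus[OF z]] by (auto simp: v_def h_def)
      have "4 * (\<Sum>s\<in>E. v s * h s) = 2 ^ 6 * 362880 * leval Phi (zsq \<zeta>)"
        using pair_comp[OF z, of "leval H"] pair_H[OF z] by (simp add: v_def h_def)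
      moreover have "c0 \<zeta> = 4 * (\<Sum>s\<in>E. v s * f s) * (IP (zsq \<zeta>) * (1 / (2 ^ 6 * 362880)))"
        using pair_comp[OF z, of F] by (simp add: c0_def v_def f_def)
      ultimately have "c0 \<zeta> * (4 * (\<Sum>s\<in>E. v s * h s)) = 4 * (\<Sum>s\<in>E. v s * f s) * (IP (zsq \<zeta>) * leval Phi (zsq \<zeta>))"
        by (simp add: mult_ac)
      then have c0: "c0 \<zeta> * (\<Sum>s\<in>E. v s * h s) = (\<Sum>s\<in>E. v s * f s)"
        using IP(2)[OF zsq_torus[OF z]] by simp
      have bs: "v (0, 0) * b s = c0 \<zeta> * h s - f s" if "s \<noteq> (0, 0)" for s
        using that v0 by (simp add: b_def c_def h_def f_def)
      \<comment> \<open>After multiplication by v (0, 0), the equations \<open>bs\<close> settle the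
        coefficients of x, y and x y, and \<open>c0\<close> is what the constant part
        requires.\<close>
      have "v (0, 0) * (\<Sum>i\<in>E. b i * leval (Hs i) \<zeta>) = v (0, 0) * F \<zeta>"
      proof -
        have "leval (Hs (0, 0)) \<zeta> = h (0, 0) + h (1, 0) * x + h (0, 1) * y + h (1, 1) * (x * y)"
          using comp_eq[OF z, of "leval H"] by (simp add: Hs_def h_def xy)
        moreover have "F \<zeta> = f (0, 0) + f (1, 0) * x + f (0, 1) * y + f (1, 1) * (x * y)"
          using comp_eq[OF z, of F] by (simp add: f_def xy)
        moreover have "leval (Hs (1, 0)) \<zeta> = v (1, 0) - v (0, 0) * x" "leval (Hs (0, 1)) \<zeta> = v (0, 1) - v (0, 0) * y"
          "leval (Hs (1, 1)) \<zeta> = v (1, 1) - v (0, 0) * (x * y)"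
          using Hs[OF _ z] by (simp_all add: E_eq v_def xy)
        moreover have "b (0, 0) = c0 \<zeta>" by (simp add: b_def c_def)
        ultimately show ?thesis
          using c0 bs[of "(1, 0)"] bs[of "(0, 1)"] bs[of "(1, 1)"]
          by (simp add: sum_E) algebra
      qed
      then show ?thesis using v0 by (simp add: b_def)
    qed
    ultimately show ?thesis by (intro exI[of _ c]) auto
  qed
  have uniq: "\<forall>i\<in>E. \<forall>\<zeta>\<in>torus. c i \<zeta> = 0"
    if c: "\<forall>i\<in>E. c i \<in> Ldown_l1" and 0: "\<forall>\<zeta>\<in>torus. (\<Sum>i\<in>E. c i \<zeta> * leval (Hs i) \<zeta>) = 0" for c
  proof -
    have c_flip: "c i (zflip s \<zeta>) = c i \<zeta>" if "i \<in> E" "\<zeta> \<in> torus" for i s \<zeta>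
      using c that by (blast intro: Ldown_l1_zflip)
    have "\<forall>i\<in>E. c i \<zeta> = 0" if z: "\<zeta> \<in> torus" for \<zeta>
    proof -
      have eq: "(\<Sum>i\<in>E. c i \<zeta> * leval (Hs i) (zflip t \<zeta>)) = 0" for t
        using 0 z c_flip by (metis (mono_tags, lifting) sum.cong zflip_torus)
      have "0 = (\<Sum>t\<in>E. leval HPhi (zflip t \<zeta>) * (\<Sum>i\<in>E. c i \<zeta> * leval (Hs i) (zflip t \<zeta>)))"
        unfolding eq by simp
      also have "\<dots> = (\<Sum>i\<in>E. c i \<zeta> * (\<Sum>t\<in>E. leval HPhi (zflip t \<zeta>) * leval (Hs i) (zflip t \<zeta>)))"
        unfolding sum_distrib_left by (subst sum.swap) (simp only: mult_ac)
      also have "\<dots> = c (0, 0) \<zeta> * (2 ^ 6 * 362880 * leval Phi (zsq \<zeta>))"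
        using pair_Hs[OF _ z] pair_H[OF z] by (simp only: sum_E) (simp add: E_eq Hs_def[of "(0, 0)"])
      finally have c0: "c (0, 0) \<zeta> = 0" using Phi_nz[OF zsq_torus[OF z]] by simp
      obtain x y where xy: "\<zeta> = (x, y)" by force
      have xy0: "x \<noteq> 0" "y \<noteq> 0" using torus_nonzero[OF z] by (auto simp: xy)
      have eq': "c (1, 0) \<zeta> * (W (1, 0) \<zeta> - W (0, 0) \<zeta> * ((-1) ^ fst t * x)) +
          c (0, 1) \<zeta> * (W (0, 1) \<zeta> - W (0, 0) \<zeta> * ((-1) ^ snd t * y)) +
          c (1, 1) \<zeta> * (W (1, 1) \<zeta> - W (0, 0) \<zeta> * ((-1) ^ fst t * x * ((-1) ^ snd t * y))) = 0" for t
        using eq[of t] Hs[OF _ zflip_torus[OF z], of _ t] c0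
        by (simp add: sum_E W_flip E_eq) (simp add: zflip_def xy add.assoc)
      \<comment> \<open>The four sign changes yield T - p X - q Y - p q Z = 0 for all signs p and q.
        The sign patterns of T, X, Y, Z are the four characters of the group, so each term
        vanishes.\<close>
      define X Y Z T where "X = c (1, 0) \<zeta> * (W (0, 0) \<zeta> * x)" and "Y = c (0, 1) \<zeta> * (W (0, 0) \<zeta> * y)"
        and "Z = c (1, 1) \<zeta> * (W (0, 0) \<zeta> * (x * y))"
        and "T = c (1, 0) \<zeta> * W (1, 0) \<zeta> + c (0, 1) \<zeta> * W (0, 1) \<zeta> + c (1, 1) \<zeta> * W (1, 1) \<zeta>"
      have XYZ: "c (1, 0) \<zeta> * (W (1, 0) \<zeta> - W (0, 0) \<zeta> * (p * x)) +
          c (0, 1) \<zeta> * (W (0, 1) \<zeta> - W (0, 0) \<zeta> * (q * y)) +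
          c (1, 1) \<zeta> * (W (1, 1) \<zeta> - W (0, 0) \<zeta> * (p * x * (q * y))) = T - p * X - q * Y - p * q * Z" for p q
        unfolding X_def Y_def Z_def T_def by algebra
      have "T - X - Y - Z = 0" "T + X - Y + Z = 0" "T - X + Y + Z = 0" "T + X + Y - Z = 0"
        using eq'[of "(0, 0)"] eq'[of "(1, 0)"] eq'[of "(0, 1)"] eq'[of "(1, 1)"] unfolding XYZ by simp_all
      then have "X = 0" "Y = 0" "Z = 0" by algebra+
      then show ?thesis
        using c0 w0_nz[OF z] xy0 by (simp add: ball_E X_def Y_def Z_def W_def w_def)
    qed
    then show ?thesis by blast
  qed
  have "finite E" by (simp add: E_eq)
  then show ?thesis
    unfolding torus_basis_def using ex uniq by (intro conjI allI impI ballI) (simp, simp, blast, blast)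
qed

text \<open>Since Phi is its own conjugate, the bracket is the conjugate of the sum over sign
  changes of Phi conj(H) H_s, and this sum sees only the vanishing even part.\<close>

lemma bracket_Hs:
  assumes s: "s \<in> E - {(0, 0)}" and z: "\<zeta> \<in> torus"
  shows "bracket (leval Phi) (leval H) (leval (Hs s)) \<zeta> = 0"
proof -
  have c: "C (1 / (2 ^ 6 * 362880)) * C (2 ^ 6 * 362880) = 1" by (simp add: C_mult)
  have "Phi * lconj H * Hs s = (C (1 / (2 ^ 6 * 362880)) * C (2 ^ 6 * 362880)) * Phi * lconj H * Hs s"
    by (simp only: c mult_1_left)
  also have "\<dots> = C (1 / (2 ^ 6 * 362880)) * (HPhi * Hs s)"
    by (simp add: lconj_mult lconj_C mult_ac)
  finally have 0: "even_part (Phi * lconj H * Hs s) = 0"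
    by (simp only: even_part_C_times even_part_HPhi_Hs[OF s]) simp
  have "bracket (leval Phi) (leval H) (leval (Hs s)) \<zeta>
      = (\<Sum>t\<in>E. leval (lconj (Phi * lconj H * Hs s)) (zflip t \<zeta>))"
    unfolding bracket_def
    by (intro sum.cong refl)
       (use torus_nonzero[OF zflip_torus[OF z]] in \<open>simp add: lconj_mult leval_mult leval_lconj zflip_torus[OF z]\<close>)
  also have "\<dots> = cnj (\<Sum>t\<in>E. leval (Phi * lconj H * Hs s) (zflip t \<zeta>))"
    using zflip_torus[OF z] by (simp add: leval_lconj)
  also have "\<dots> = 0" by (simp only: sum_zflip_leval 0) simp
  finally show ?thesis .
qed

text \<open>The four monomials lie in different parity classes, so the summands cannot
  interact.\<close>

lemma Ldown_mon_unique:
  assumes v: "\<And>s. s \<in> E \<Longrightarrow> v s \<in> Ldown"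
    and 0: "v (0, 0) + v (1, 0) * mon (-1) 0 + v (0, 1) * mon 0 (-1) + v (1, 1) * mon (-1) (-1) = 0"
    and "s \<in> E"
  shows "v s = 0"
proof (rule poly_mapping_eqI)
  fix k :: "int \<times> int"
  obtain i j where k: "k = (i, j)" by force
  have l: "lk (v (0, 0)) (a, b) + lk (v (1, 0)) (a + 1, b) + lk (v (0, 1)) (a, b + 1) + lk (v (1, 1)) (a + 1, b + 1) = 0" for a b
    using arg_cong[OF 0, of "\<lambda>p. lk p (a, b)"] by (simp add: lookup_add lookup_mon_times mult.commute[of _ "mon _ _"])
  have v0: "lk (v t) (a, b) = 0" if "t \<in> E" "\<not> (even a \<and> even b)" for t a b
    using v[OF that(1)] that(2) by (auto simp: Ldown_iff even_pt_def)
  \<comment> \<open>In the coefficient at k - s the other three summands are read at positions with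
    an odd entry, where they are 0.\<close>
  have ev: "lk (v s) (i, j) = 0" if "even i" "even j"
    using \<open>s \<in> E\<close> that l[of "i - int (fst s)" "j - int (snd s)"]
      v0[of "(0, 0)"] v0[of "(1, 0)"] v0[of "(0, 1)"] v0[of "(1, 1)"]
    by (auto simp: E_eq)
  show "lk (v s) k = lk 0 k"
    using ev v0[OF \<open>s \<in> E\<close>] by (auto simp: k)
qed

lemma HPhi_split_iff:
  "((\<forall>s\<in>E. v s \<in> Ldown) \<and>
      HPhi = v (0, 0) + v (1, 0) * mon (-1) 0 + v (0, 1) * mon 0 (-1) + v (1, 1) * mon (-1) (-1))
    \<longleftrightarrow> (\<forall>s\<in>E. v s = w s)"
proof
  assume *: "(\<forall>s\<in>E. v s \<in> Ldown) \<and>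
      HPhi = v (0, 0) + v (1, 0) * mon (-1) 0 + v (0, 1) * mon 0 (-1) + v (1, 1) * mon (-1) (-1)"
  show "\<forall>s\<in>E. v s = w s"
  proof
    fix s assume "s \<in> E"
    have "v s - w s = 0"
    proof (rule Ldown_mon_unique[of "\<lambda>s. v s - w s", OF _ _ \<open>s \<in> E\<close>])
      show "v s - w s \<in> Ldown" if "s \<in> E" for s using * that by (simp add: Ldown_diff w_Ldown)
      show "v (0, 0) - w (0, 0) + (v (1, 0) - w (1, 0)) * mon (-1) 0 + (v (0, 1) - w (0, 1)) * mon 0 (-1)
        + (v (1, 1) - w (1, 1)) * mon (-1) (-1) = 0"
      proof -
        have eq: "v (0, 0) + v (1, 0) * mon (-1) 0 + v (0, 1) * mon 0 (-1) + v (1, 1) * mon (-1) (-1)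
          = w (0, 0) + w (1, 0) * mon (-1) 0 + w (0, 1) * mon 0 (-1) + w (1, 1) * mon (-1) (-1)"
          using * HPhi_split by metis
        have "v (0, 0) - w (0, 0) + (v (1, 0) - w (1, 0)) * mon (-1) 0 + (v (0, 1) - w (0, 1)) * mon 0 (-1)
            + (v (1, 1) - w (1, 1)) * mon (-1) (-1)
          = (v (0, 0) + v (1, 0) * mon (-1) 0 + v (0, 1) * mon 0 (-1) + v (1, 1) * mon (-1) (-1))
            - (w (0, 0) + w (1, 0) * mon (-1) 0 + w (0, 1) * mon 0 (-1) + w (1, 1) * mon (-1) (-1))"
          by (simp only: left_diff_distrib) (simp only: add_diff_add)
        then show ?thesis by (simp only: eq) simp
      qed
    qed
    then show "v s = w s" by simp
  qed
next
  assume "\<forall>s\<in>E. v s = w s"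
  then show "(\<forall>s\<in>E. v s \<in> Ldown) \<and>
      HPhi = v (0, 0) + v (1, 0) * mon (-1) 0 + v (0, 1) * mon 0 (-1) + v (1, 1) * mon (-1) (-1)"
    using HPhi_split w_Ldown by (simp only: E_eq) auto
qed

subsection \<open>Square integrable functions\<close>

lemma cmod_add_power2: "(cmod (a + b))\<^sup>2 \<le> 2 * (cmod a)\<^sup>2 + 2 * (cmod b)\<^sup>2"
proof -
  have "(cmod (a + b))\<^sup>2 \<le> (cmod a + cmod b)\<^sup>2"
    by (intro power_mono norm_triangle_ineq) simp
  also have "\<dots> \<le> 2 * (cmod a)\<^sup>2 + 2 * (cmod b)\<^sup>2"
    using sum_squares_bound[of "cmod a" "cmod b"] by (simp add: power2_sum)
  finally show ?thesis .
qed

text \<open>A substitute for the triangle inequality that works on squared norms in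
  \<open>ennreal\<close>; the factor 2 is harmless in limits.\<close>

lemma L2sq_add:
  assumes [measurable]: "f \<in> borel_measurable borel" "g \<in> borel_measurable borel"
  shows "L2sq (\<lambda>x. f x + g x) \<le> 2 * L2sq f + 2 * L2sq g"
proof -
  have "L2sq (\<lambda>x. f x + g x) \<le> (\<integral>\<^sup>+x. 2 * ennreal ((cmod (f x))\<^sup>2) + 2 * ennreal ((cmod (g x))\<^sup>2) \<partial>lborel)"
    unfolding L2sq_def
  proof (rule nn_integral_mono)
    fix x
    have "ennreal ((cmod (f x + g x))\<^sup>2) \<le> ennreal (2 * (cmod (f x))\<^sup>2 + 2 * (cmod (g x))\<^sup>2)"
      by (intro ennreal_leI cmod_add_power2)
    then show "ennreal ((cmod (f x + g x))\<^sup>2) \<le> 2 * ennreal ((cmod (f x))\<^sup>2) + 2 * ennreal ((cmod (g x))\<^sup>2)"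
      by (simp add: ennreal_mult')
  qed
  also have "\<dots> = 2 * L2sq f + 2 * L2sq g"
    unfolding L2sq_def by (subst nn_integral_add) (auto simp: nn_integral_cmult)
  finally show ?thesis .
qed

lemma L2sq_cmult:
  assumes [measurable]: "f \<in> borel_measurable borel"
  shows "L2sq (\<lambda>x. c * f x) = ennreal ((cmod c)\<^sup>2) * L2sq f"
  unfolding L2sq_def by (subst nn_integral_cmult[symmetric]) (auto simp: norm_mult power_mult_distrib ennreal_mult')

lemma L2sq_uminus [simp]: "L2sq (\<lambda>x. - f x) = L2sq f"
  by (simp add: L2sq_def)

lemma L2sq_diff:
  assumes [measurable]: "f \<in> borel_measurable borel" "g \<in> borel_measurable borel"
  shows "L2sq (\<lambda>x. f x - g x) \<le> 2 * L2sq f + 2 * L2sq g"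
  using L2sq_add[of f "\<lambda>x. - g x"] by simp

lemma L2sq_cong_AE:
  "AE x in lborel. f x = g x \<Longrightarrow> L2sq f = L2sq g"
  unfolding L2sq_def by (rule nn_integral_cong_AE) auto

lemma L2sq_mono: "(\<And>x. cmod (f x) \<le> cmod (g x)) \<Longrightarrow> L2sq f \<le> L2sq g"
  unfolding L2sq_def by (intro nn_integral_mono ennreal_leI power_mono) auto

lemma L2_measurable [measurable_dest]: "f \<in> L2 \<Longrightarrow> f \<in> borel_measurable borel"
  by (simp add: L2_def)

lemma L2_finite: "f \<in> L2 \<Longrightarrow> L2sq f < \<infinity>"
  by (simp add: L2_def)

lemma L2_add [intro]: "f \<in> L2 \<Longrightarrow> g \<in> L2 \<Longrightarrow> (\<lambda>x. f x + g x) \<in> L2"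
  using L2sq_add[of f g] by (auto simp: L2_def ennreal_mult_less_top order_le_less_trans)

lemma L2_cmult [intro]: "f \<in> L2 \<Longrightarrow> (\<lambda>x. c * f x) \<in> L2"
  using L2sq_cmult[of f c] by (auto simp: L2_def ennreal_mult_less_top)

lemma L2_diff [intro]: "f \<in> L2 \<Longrightarrow> g \<in> L2 \<Longrightarrow> (\<lambda>x. f x - g x) \<in> L2"
  using L2_add[of f "\<lambda>x. (-1) * g x"] L2_cmult[of g "-1"] by simp

lemma L2_0 [simp]: "(\<lambda>x. 0) \<in> L2"
  by (simp add: L2_def L2sq_def)

lemma L2_sum [intro]: "(\<And>i. i \<in> I \<Longrightarrow> f i \<in> L2) \<Longrightarrow> (\<lambda>x. \<Sum>i\<in>I. f i x) \<in> L2"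
  by (induction I rule: infinite_finite_induct) auto

lemma L2sq_eq_0_iff:
  assumes [measurable]: "f \<in> borel_measurable borel"
  shows "L2sq f = 0 \<longleftrightarrow> (AE x in lborel. f x = 0)"
  unfolding L2sq_def by (subst nn_integral_0_iff_AE) auto

lemma L2_integrable_power2: "f \<in> L2 \<Longrightarrow> integrable lborel (\<lambda>x. (cmod (f x))\<^sup>2)"
  unfolding L2_def L2sq_def by (auto intro!: integrableI_nonneg)

lemma L2sq_integral: "f \<in> L2 \<Longrightarrow> L2sq f = ennreal (\<integral>x. (cmod (f x))\<^sup>2 \<partial>lborel)"
  unfolding L2sq_def by (rule nn_integral_eq_integral[OF L2_integrable_power2]) auto

lemma cnj_measurable [measurable]: "cnj \<in> borel_measurable borel"
  by (intro borel_measurable_continuous_onI continuous_intros)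

lemma L2_mult_integrable:
  assumes "f \<in> L2" "g \<in> L2"
  shows "integrable lborel (\<lambda>x. f x * cnj (g x))"
proof (rule Bochner_Integration.integrable_bound)
  show "integrable lborel (\<lambda>x. (cmod (f x))\<^sup>2 + (cmod (g x))\<^sup>2)"
    using assms by (intro Bochner_Integration.integrable_add L2_integrable_power2)
  show "(\<lambda>x. f x * cnj (g x)) \<in> borel_measurable lborel" using assms by measurable
  have "cmod (f x) * cmod (g x) \<le> (cmod (f x))\<^sup>2 + (cmod (g x))\<^sup>2" for x
  proof -
    have "0 \<le> cmod (f x) * cmod (g x)" by simp
    then show ?thesis using sum_squares_bound[of "cmod (f x)" "cmod (g x)"] by linarith
  qed
  then show "AE x in lborel. norm (f x * cnj (g x)) \<le> norm ((cmod (f x))\<^sup>2 + (cmod (g x))\<^sup>2)"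
    by (auto simp: norm_mult)
qed

lemma L2inner_diff_left:
  "f \<in> L2 \<Longrightarrow> f' \<in> L2 \<Longrightarrow> g \<in> L2 \<Longrightarrow> L2inner (\<lambda>x. f x - f' x) g = L2inner f g - L2inner f' g"
  unfolding L2inner_def left_diff_distrib by (intro Bochner_Integration.integral_diff L2_mult_integrable)

lemma L2inner_cnj: "L2inner g f = cnj (L2inner f g)"
  using Bochner_Integration.integral_cnj[of lborel "\<lambda>x. f x * cnj (g x)"] by (simp add: L2inner_def mult.commute)

lemma L2inner_diff_right:
  "f \<in> L2 \<Longrightarrow> g \<in> L2 \<Longrightarrow> g' \<in> L2 \<Longrightarrow> L2inner f (\<lambda>x. g x - g' x) = L2inner f g - L2inner f g'"
  using arg_cong[OF L2inner_diff_left[of g g' f], of cnj] by (simp flip: L2inner_cnj)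

lemma L2inner_sum_left:
  assumes "\<And>i. i \<in> I \<Longrightarrow> f i \<in> L2" "g \<in> L2"
  shows "L2inner (\<lambda>x. \<Sum>i\<in>I. c i * f i x) g = (\<Sum>i\<in>I. c i * L2inner (f i) g)"
proof -
  have "L2inner (\<lambda>x. \<Sum>i\<in>I. c i * f i x) g = (\<integral>x. (\<Sum>i\<in>I. c i * (f i x * cnj (g x))) \<partial>lborel)"
    by (simp only: L2inner_def sum_distrib_right mult.assoc)
  also have "\<dots> = (\<Sum>i\<in>I. \<integral>x. c i * (f i x * cnj (g x)) \<partial>lborel)"
    using assms by (intro Bochner_Integration.integral_sum integrable_mult_right L2_mult_integrable)
  finally show ?thesis by (simp add: L2inner_def)
qed

lemma L2inner_sum_right:
  assumes "\<And>i. i \<in> I \<Longrightarrow> f i \<in> L2" "g \<in> L2"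
  shows "L2inner g (\<lambda>x. \<Sum>i\<in>I. c i * f i x) = (\<Sum>i\<in>I. cnj (c i) * L2inner g (f i))"
  using L2inner_sum_left[OF assms, where c = c]
  by (subst L2inner_cnj) (simp add: cnj_sum L2inner_cnj[of g])

lemma L2inner_self: "f \<in> L2 \<Longrightarrow> L2sq f = ennreal (Re (L2inner f f))"
proof -
  assume f: "f \<in> L2"
  have "f x * cnj (f x) = of_real ((cmod (f x))\<^sup>2)" for x by (simp only: complex_norm_square)
  then have "L2inner f f = of_real (\<integral>x. (cmod (f x))\<^sup>2 \<partial>lborel)"
    by (simp only: L2inner_def integral_complex_of_real)
  then show ?thesis by (simp add: L2sq_integral[OF f])
qed

lemma L2inner_Cauchy_Schwarz:
  assumes "f \<in> L2" "g \<in> L2"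
  shows "ennreal ((cmod (L2inner f g))\<^sup>2) \<le> L2sq f * L2sq g"
proof -
  have [measurable]: "f \<in> borel_measurable borel" "g \<in> borel_measurable borel"
    using assms by auto
  have "ennreal (cmod (L2inner f g)) \<le> (\<integral>\<^sup>+x. ennreal (norm (f x * cnj (g x))) \<partial>lborel)"
    unfolding L2inner_def using L2_mult_integrable[OF assms]
    by (subst nn_integral_eq_integral) (auto intro!: ennreal_leI integral_norm_bound)
  also have "\<dots> = (\<integral>\<^sup>+x. ennreal (cmod (f x)) * ennreal (cmod (g x)) \<partial>lborel)"
    by (simp add: norm_mult ennreal_mult')
  finally have "(ennreal (cmod (L2inner f g)))\<^sup>2 \<le> (\<integral>\<^sup>+x. ennreal (cmod (f x)) * ennreal (cmod (g x)) \<partial>lborel)\<^sup>2"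
    by (intro power_mono) auto
  also have "\<dots> \<le> (\<integral>\<^sup>+x. ennreal (cmod (f x))^2 \<partial>lborel) * (\<integral>\<^sup>+x. ennreal (cmod (g x))^2 \<partial>lborel)"
    by (rule Cauchy_Schwarz_nn_integral) auto
  finally show ?thesis by (simp add: L2sq_def ennreal_power)
qed

subsection \<open>Affine substitutions\<close>

lemma nn_integral_lborel_affine:
  fixes t :: "'a::euclidean_space" and f :: "'a \<Rightarrow> ennreal"
  assumes [measurable]: "f \<in> borel_measurable borel" and "c \<noteq> 0"
  shows "(\<integral>\<^sup>+x. f x \<partial>lborel) = ennreal (\<bar>c\<bar> ^ DIM('a)) * (\<integral>\<^sup>+x. f (t + c *\<^sub>R x) \<partial>lborel)"
  by (subst lborel_affine[OF assms(2), of t]) (simp add: nn_integral_density nn_integral_distr nn_integral_cmult)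

lemma integral_lborel_affine:
  fixes t :: "'a::euclidean_space" and f :: "'a \<Rightarrow> 'b::{banach, second_countable_topology}"
  assumes [measurable]: "f \<in> borel_measurable borel" and "c \<noteq> 0"
  shows "(\<integral>x. f x \<partial>lborel) = \<bar>c\<bar> ^ DIM('a) *\<^sub>R (\<integral>x. f (t + c *\<^sub>R x) \<partial>lborel)"
  by (subst lborel_affine[OF assms(2), of t]) (simp add: integral_density integral_distr)

lemma integrable_lborel_affine:
  fixes t :: "'a::euclidean_space" and f :: "'a \<Rightarrow> 'b::{banach, second_countable_topology}"
  assumes f: "integrable lborel f" and c: "c \<noteq> 0"
  shows "integrable lborel (\<lambda>x. f (t + c *\<^sub>R x))"
proof -
  have [measurable]: "f \<in> borel_measurable borel" using f by simp
  have "(\<integral>\<^sup>+x. norm (f x) \<partial>lborel) < \<infinity>" using f by (simp add: integrable_iff_bounded)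
  then have "(\<integral>\<^sup>+x. norm (f (t + c *\<^sub>R x)) \<partial>lborel) < \<infinity>"
    using nn_integral_lborel_affine[of "\<lambda>x. ennreal (norm (f x))" c t] c
    by (auto simp: ennreal_mult_less_top)
  then show ?thesis by (simp add: integrable_iff_bounded)
qed

lemma AE_lborel_affine:
  fixes t :: "'a::euclidean_space"
  assumes P: "AE x in lborel. P x" and c: "c \<noteq> 0"
  shows "AE x in lborel. P (t + c *\<^sub>R x)"
proof -
  from P obtain N where N: "N \<in> null_sets lborel" "{x. \<not> P x} \<subseteq> N"
    by (auto simp: eventually_ae_filter)
  have [measurable]: "N \<in> sets borel" using N by auto
  have "(\<integral>\<^sup>+x. indicator N x \<partial>lborel) = ennreal (\<bar>c\<bar> ^ DIM('a)) * (\<integral>\<^sup>+x. indicator N (t + c *\<^sub>R x) \<partial>lborel)"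
    by (rule nn_integral_lborel_affine[OF _ c]) simp
  moreover have "(\<integral>\<^sup>+x. indicator N x \<partial>lborel) = 0" using N by auto
  ultimately have "(\<integral>\<^sup>+x. indicator N (t + c *\<^sub>R x) \<partial>lborel) = 0" using c by simp
  then have "AE x in lborel. (indicator N (t + c *\<^sub>R x) :: ennreal) = 0"
    by (subst (asm) nn_integral_0_iff_AE) auto
  then show ?thesis using N(2) by (auto elim!: eventually_mono simp: indicator_def split: if_splits)
qed

lemma L2sq_translate:
  assumes [measurable]: "f \<in> borel_measurable borel"
  shows "L2sq (\<lambda>x. f (x + z)) = L2sq f"
  unfolding L2sq_def using nn_integral_lborel_affine[of "\<lambda>x. ennreal ((cmod (f x))\<^sup>2)" 1 z]
  by (simp add: add.commute)

lemma L2_translate: "f \<in> L2 \<Longrightarrow> (\<lambda>x. f (x + z)) \<in> L2"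
  using L2sq_translate[of f z] by (auto simp: L2_def)

subsection \<open>The Fourier transform on integrable functions\<close>

lemma cis_measurable [measurable]: "cis \<in> borel_measurable borel"
  by (intro borel_measurable_continuous_onI continuous_on_cis continuous_on_id)

lemma norm_mult_cis [simp]: "cmod (z * cis t) = cmod z"
  by (simp add: norm_mult)

lemma cis_minus_add: "cis (- (a + b)) = cis (- a) * cis (- b)"
  by (simp add: cis_mult)

lemma integrable_mult_cis:
  assumes f: "integrable lborel f" and [measurable]: "h \<in> borel_measurable borel"
  shows "integrable lborel (\<lambda>x. f x * cis (h x))"
  by (rule Bochner_Integration.integrable_bound[OF f]) (use f in auto)

lemma fourier_measurable [measurable]:
  fixes f :: "'a::euclidean_space \<Rightarrow> complex"
  assumes [measurable]: "f \<in> borel_measurable borel"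
  shows "fourier f \<in> borel_measurable borel"
proof -
  have [measurable]: "(\<lambda>x. f (snd x) * cis (- (fst x \<bullet> snd x))) \<in> borel_measurable (borel \<Otimes>\<^sub>M lborel)"
    unfolding borel_prod[symmetric] by measurable
  have "(\<lambda>u. \<integral>x. f x * cis (- (u \<bullet> x)) \<partial>lborel) \<in> borel_measurable borel"
    by (rule lborel.borel_measurable_lebesgue_integral) (simp add: case_prod_unfold)
  then show ?thesis unfolding fourier_def[abs_def] .
qed

lemma fourier_add:
  "integrable lborel f \<Longrightarrow> integrable lborel g \<Longrightarrow> fourier (\<lambda>x. f x + g x) u = fourier f u + fourier g u"
  unfolding fourier_def distrib_right by (rule Bochner_Integration.integral_add; rule integrable_mult_cis) auto

lemma fourier_diff:
  "integrable lborel f \<Longrightarrow> integrable lborel g \<Longrightarrow> fourier (\<lambda>x. f x - g x) u = fourier f u - fourier g u"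
  unfolding fourier_def left_diff_distrib by (rule Bochner_Integration.integral_diff; rule integrable_mult_cis) auto

lemma fourier_cmult: "fourier (\<lambda>x. c * f x) u = c * fourier f u"
  unfolding fourier_def by (simp add: mult.assoc)

lemma fourier_cong_AE:
  assumes [measurable]: "f \<in> borel_measurable borel" "g \<in> borel_measurable borel" and "AE x in lborel. f x = g x"
  shows "fourier f u = fourier g u"
  unfolding fourier_def using assms(3) by (intro integral_cong_AE) auto

lemma cmod_fourier_le: "integrable lborel f \<Longrightarrow> cmod (fourier f u) \<le> (\<integral>x. cmod (f x) \<partial>lborel)"
  unfolding fourier_def by (rule order_trans[OF integral_norm_bound]) simp

lemma fourier_translate:
  assumes [measurable]: "f \<in> borel_measurable borel"
  shows "fourier (\<lambda>x. f (x - z)) u = cis (- (u \<bullet> z)) * fourier f u"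
proof -
  have "fourier (\<lambda>x. f (x - z)) u = (\<integral>x. f x * cis (- (u \<bullet> (z + x))) \<partial>lborel)"
    unfolding fourier_def
    by (subst integral_lborel_affine[of "\<lambda>x. f (x - z) * cis (- (u \<bullet> x))" 1 z]) simp_all
  also have "\<dots> = (\<integral>x. cis (- (u \<bullet> z)) * (f x * cis (- (u \<bullet> x))) \<partial>lborel)"
    by (simp only: inner_add_right cis_minus_add mult_ac)
  finally show ?thesis by (simp add: fourier_def)
qed

lemma integrable_lborel_times:
  fixes f :: "'a::euclidean_space \<Rightarrow> complex" and g :: "'b::euclidean_space \<Rightarrow> complex"
  assumes f: "integrable lborel f" and g: "integrable lborel g"
  shows "integrable (lborel \<Otimes>\<^sub>M lborel) (\<lambda>(x, y). f x * g y)"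
proof -
  have [measurable]: "f \<in> borel_measurable lborel" "g \<in> borel_measurable lborel" using f g by auto
  show ?thesis
    using f g by (intro lborel_pair.Fubini_integrable) (auto simp: norm_mult)
qed

lemma integral_lborel_times:
  fixes f :: "'a::euclidean_space \<Rightarrow> complex" and g :: "'b::euclidean_space \<Rightarrow> complex"
  assumes f: "integrable lborel f" and g: "integrable lborel g"
  shows "(\<integral>x. f (fst x) * g (snd x) \<partial>lborel) = (\<integral>x. f x \<partial>lborel) * (\<integral>x. g x \<partial>lborel)"
  unfolding lborel_prod[symmetric]
  using lborel_pair.integral_fst'[OF integrable_lborel_times[OF f g]] by (simp add: case_prod_unfold)

text \<open>The multiplication formula, by Fubini. With a Gaussian weight in g it takes the place of
  Fourier inversion.\<close>

lemma fourier_exchange: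
  fixes f g :: "'a::euclidean_space \<Rightarrow> complex"
  assumes f: "integrable lborel f" and g: "integrable lborel g"
  shows "(\<integral>u. g u * fourier f u \<partial>lborel) = (\<integral>x. f x * fourier g x \<partial>lborel)"
proof -
  have [measurable]: "f \<in> borel_measurable borel" "g \<in> borel_measurable borel" using f g by auto
  have m: "(\<lambda>(u, x). g u * f x * cis (- (u \<bullet> x))) \<in> borel_measurable (lborel \<Otimes>\<^sub>M lborel)"
    by measurable
  have int: "integrable (lborel \<Otimes>\<^sub>M lborel) (\<lambda>(u, x). g u * f x * cis (- (u \<bullet> x)))"
    by (rule Bochner_Integration.integrable_bound[OF integrable_lborel_times[OF g f] m]) auto
  have "(\<integral>u. g u * fourier f u \<partial>lborel) = (\<integral>u. \<integral>x. g u * f x * cis (- (u \<bullet> x)) \<partial>lborel \<partial>lborel)"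
    by (simp add: fourier_def mult.assoc)
  also have "\<dots> = (\<integral>x. \<integral>u. g u * f x * cis (- (u \<bullet> x)) \<partial>lborel \<partial>lborel)"
    using lborel_pair.Fubini_integral[OF int] by simp
  also have "\<dots> = (\<integral>x. f x * fourier g x \<partial>lborel)"
    by (simp add: fourier_def inner_commute mult_ac flip: integral_mult_right_zero)
  finally show ?thesis .
qed

subsection \<open>Gaussian means\<close>

definition gauss :: "real \<times> real \<Rightarrow> real" where
  "gauss u = exp (- (u \<bullet> u) / 2)"

lemma gauss_measurable [measurable]: "gauss \<in> borel_measurable borel"
  unfolding gauss_def by measurable

text \<open>The integral is the characteristic function of the standard normal law with the factor
  sqrt(2 pi) of its density restored.\<close>

lemma gauss_1d:
  "integrable lborel (\<lambda>t::real. complex_of_real (exp (- t\<^sup>2 / 2)))"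
  "(\<integral>t. complex_of_real (exp (- t\<^sup>2 / 2)) * cis (- (t * s)) \<partial>lborel)
     = complex_of_real (sqrt (2 * pi) * exp (- s\<^sup>2 / 2))"
proof -
  have d: "std_normal_density t * sqrt (2 * pi) = exp (- t\<^sup>2 / 2)" for t
    by (simp add: std_normal_density_def)
  have "integrable lborel (\<lambda>t. std_normal_density t * sqrt (2 * pi))"
    by (intro integrable_mult_left integrable_normal_density) simp
  then have "integrable lborel (\<lambda>t::real. exp (- t\<^sup>2 / 2))" unfolding d .
  then show "integrable lborel (\<lambda>t::real. complex_of_real (exp (- t\<^sup>2 / 2)))"
    by (rule integrable_of_real)
  have "complex_of_real (exp (- ((- s)\<^sup>2) / 2)) = char std_normal_distribution (- s)"
    by (simp add: char_std_normal_distribution)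
  also have "\<dots> = (\<integral>t. std_normal_density t *\<^sub>R iexp (- s * t) \<partial>lborel)"
    unfolding char_def by (subst integral_density) (auto intro: normal_density_nonneg)
  finally have "complex_of_real (sqrt (2 * pi) * exp (- s\<^sup>2 / 2))
      = of_real (sqrt (2 * pi)) * (\<integral>t. std_normal_density t *\<^sub>R iexp (- s * t) \<partial>lborel)"
    by simp
  also have "\<dots> = (\<integral>t. complex_of_real (exp (- t\<^sup>2 / 2)) * cis (- (t * s)) \<partial>lborel)"
    unfolding d[symmetric] by (subst integral_mult_right_zero[symmetric])
      (simp add: scaleR_conv_of_real cis_conv_exp mult_ac)
  finally show "(\<integral>t. complex_of_real (exp (- t\<^sup>2 / 2)) * cis (- (t * s)) \<partial>lborel)
     = complex_of_real (sqrt (2 * pi) * exp (- s\<^sup>2 / 2))" ..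
qed

lemma gauss_split: "gauss u = exp (- (fst u)\<^sup>2 / 2) * exp (- (snd u)\<^sup>2 / 2)"
  by (simp add: gauss_def inner_prod_def power2_eq_square diff_divide_distrib flip: exp_add)

lemma integrable_gauss: "integrable lborel (\<lambda>u. complex_of_real (gauss u))"
  using integrable_lborel_times[OF gauss_1d(1) gauss_1d(1)]
  by (simp add: gauss_split lborel_prod case_prod_unfold)

lemma integrable_gauss_real: "integrable lborel gauss"
  using integrable_gauss integrable_Re[of lborel "\<lambda>u. complex_of_real (gauss u)"] by simp

lemma fourier_gauss: "fourier (\<lambda>u. complex_of_real (gauss u)) z = 2 * pi * gauss z"
proof -
  have "fourier (\<lambda>u. complex_of_real (gauss u)) z =
      (\<integral>u. (complex_of_real (exp (- (fst u)\<^sup>2 / 2)) * cis (- (fst u * fst z))) *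
             (complex_of_real (exp (- (snd u)\<^sup>2 / 2)) * cis (- (snd u * snd z))) \<partial>lborel)"
    unfolding fourier_def gauss_split
    by (intro Bochner_Integration.integral_cong refl)
       (simp add: inner_prod_def cis_minus_add mult_ac del: minus_add_distrib)
  also have "\<dots> = complex_of_real (sqrt (2 * pi) * exp (- (fst z)\<^sup>2 / 2)) * complex_of_real (sqrt (2 * pi) * exp (- (snd z)\<^sup>2 / 2))"
    by (subst integral_lborel_times) (intro integrable_mult_cis gauss_1d(1), simp, intro integrable_mult_cis gauss_1d(1), simp, simp only: gauss_1d(2))
  also have "\<dots> = complex_of_real ((sqrt (2 * pi) * sqrt (2 * pi)) * gauss z)"
    by (simp only: gauss_split of_real_mult mult_ac)
  finally show ?thesis by simp
qed

lemma integral_gauss: "(\<integral>v. gauss v \<partial>lborel) = 2 * pi"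
proof -
  have "complex_of_real (\<integral>v. gauss v \<partial>lborel) = complex_of_real (2 * pi)"
    using fourier_gauss[of 0] by (simp add: fourier_def gauss_def[of 0])
  then show ?thesis by (simp only: of_real_eq_iff)
qed

lemma gauss_bounds: "0 \<le> gauss u" "gauss u \<le> 1"
  by (simp_all add: gauss_def)

lemma fourier_gauss_scale:
  assumes "0 < e"
  shows "fourier (\<lambda>u. complex_of_real (gauss (e *\<^sub>R u)) * cis (x \<bullet> u)) y
    = of_real (2 * pi / e\<^sup>2 * gauss ((1 / e) *\<^sub>R (y - x)))"
proof -
  let ?z = "(1 / e) *\<^sub>R (y - x)"
  have "(\<integral>u. complex_of_real (gauss u) * cis (- (u \<bullet> ?z)) \<partial>lborel)
      = \<bar>e\<bar> ^ 2 *\<^sub>R (\<integral>u. complex_of_real (gauss (e *\<^sub>R u)) * cis (- ((e *\<^sub>R u) \<bullet> ?z)) \<partial>lborel)"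
    using assms integral_lborel_affine[of "\<lambda>u. complex_of_real (gauss u) * cis (- (u \<bullet> ?z))" e 0]
    by (simp add: power2_eq_square)
  also have "(\<lambda>u. complex_of_real (gauss (e *\<^sub>R u)) * cis (- ((e *\<^sub>R u) \<bullet> ?z)))
      = (\<lambda>u. complex_of_real (gauss (e *\<^sub>R u)) * cis (x \<bullet> u) * cis (- (y \<bullet> u)))"
    using assms by (auto simp: cis_mult inner_diff_right inner_commute algebra_simps)
  finally have "2 * pi * gauss ?z = e\<^sup>2 * fourier (\<lambda>u. complex_of_real (gauss (e *\<^sub>R u)) * cis (x \<bullet> u)) y"
    using fourier_gauss[of ?z] assms by (simp add: fourier_def inner_commute scaleR_conv_of_real)
  then show ?thesis using assms by (simp add: field_simps)
qed

text \<open>The multiplication formula for a modulated Gaussian: the damped inversion integral is an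
  average of f around x at scale e. As the Gaussian has mass 2 pi, the right side stands for (2
  pi)^2 f x.\<close>

lemma fourier_gauss_mean:
  fixes f :: "real \<times> real \<Rightarrow> complex"
  assumes f: "integrable lborel f" and e: "0 < e"
  shows "(\<integral>u. complex_of_real (gauss (e *\<^sub>R u)) * cis (x \<bullet> u) * fourier f u \<partial>lborel)
    = 2 * pi * (\<integral>v. f (x + e *\<^sub>R v) * of_real (gauss v) \<partial>lborel)"
proof -
  have [measurable]: "f \<in> borel_measurable borel" using f by simp
  have "integrable lborel (\<lambda>u. complex_of_real (gauss (e *\<^sub>R u)))"
    using integrable_lborel_affine[OF integrable_gauss, of e 0] e by simp
  then have g: "integrable lborel (\<lambda>u. complex_of_real (gauss (e *\<^sub>R u)) * cis (x \<bullet> u))"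
    by (rule integrable_mult_cis) simp
  have "(\<integral>u. complex_of_real (gauss (e *\<^sub>R u)) * cis (x \<bullet> u) * fourier f u \<partial>lborel)
      = (\<integral>y. f y * of_real (2 * pi / e\<^sup>2 * gauss ((1 / e) *\<^sub>R (y - x))) \<partial>lborel)"
    by (simp only: fourier_exchange[OF f g] fourier_gauss_scale[OF e])
  also have "\<dots> = \<bar>e\<bar> ^ 2 *\<^sub>R (\<integral>v. f (x + e *\<^sub>R v) * of_real (2 * pi / e\<^sup>2 * gauss v) \<partial>lborel)"
    using e by (subst integral_lborel_affine[of _ e x]) (simp_all add: power2_eq_square)
  also have "(\<lambda>v. f (x + e *\<^sub>R v) * of_real (2 * pi / e\<^sup>2 * gauss v))
      = (\<lambda>v. of_real (2 * pi / e\<^sup>2) * (f (x + e *\<^sub>R v) * of_real (gauss v)))"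
    by (simp add: fun_eq_iff)
  finally have "(\<integral>u. complex_of_real (gauss (e *\<^sub>R u)) * cis (x \<bullet> u) * fourier f u \<partial>lborel)
      = (of_real (\<bar>e\<bar> ^ 2) * of_real (2 * pi / e\<^sup>2)) * (\<integral>v. f (x + e *\<^sub>R v) * of_real (gauss v) \<partial>lborel)"
    by (simp only: integral_mult_right_zero scaleR_conv_of_real mult.assoc)
  moreover have "of_real (\<bar>e\<bar> ^ 2) * of_real (2 * pi / e\<^sup>2) = (of_real (2 * pi) :: complex)"
    using e unfolding of_real_mult[symmetric] by simp
  ultimately show ?thesis by simp
qed

subsection \<open>Continuity of translations in the mean\<close>

text \<open>Continuity of translation at 0 in the L1 norm, phrased with sequences to suit dominated
  convergence.\<close>

definition translation_continuous :: "('a::euclidean_space \<Rightarrow> complex) \<Rightarrow> bool" where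
  "translation_continuous f \<longleftrightarrow>
     (\<forall>z. z \<longlonglongrightarrow> 0 \<longrightarrow> (\<lambda>n::nat. \<integral>x. cmod (f (x + z n) - f x) \<partial>lborel) \<longlonglongrightarrow> 0)"

lemma integrable_translate:
  fixes f :: "'a::euclidean_space \<Rightarrow> complex"
  assumes "integrable lborel f" shows "integrable lborel (\<lambda>x. f (x + z))"
  using integrable_lborel_affine[OF assms, of 1 z] by (simp add: add.commute)

lemma integral_translate:
  fixes f :: "'a::euclidean_space \<Rightarrow> 'b::{banach, second_countable_topology}"
  assumes "f \<in> borel_measurable borel" shows "(\<integral>x. f (x + z) \<partial>lborel) = (\<integral>x. f x \<partial>lborel)"
  using integral_lborel_affine[OF assms, of 1 z] by (simp add: add.commute)

lemma integrable_indicator_cball' [simp]: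
  "integrable lborel (indicator (cball (0::'a::euclidean_space) R) :: 'a \<Rightarrow> real)"
  using emeasure_bounded_finite[of "cball (0 :: 'a) R"] by (intro integrable_real_indicator) auto

lemma integrable_indicator_cball:
  "integrable lborel (\<lambda>x::'a::euclidean_space. indicator (cball 0 R) x * (B :: real))"
  by (intro integrable_mult_left integrable_indicator_cball')

lemma translation_continuous_compact_support:
  fixes h :: "'a::euclidean_space \<Rightarrow> complex"
  assumes cont: "continuous_on UNIV h" and supp: "\<And>x. R < norm x \<Longrightarrow> h x = 0" and B: "\<And>x. cmod (h x) \<le> B"
  shows "translation_continuous h"
  unfolding translation_continuous_def
proof (intro allI impI)
  fix z :: "nat \<Rightarrow> 'a" assume z: "z \<longlonglongrightarrow> 0"
  have [measurable]: "h \<in> borel_measurable borel"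
    using cont by (rule borel_measurable_continuous_onI)
  have "\<forall>\<^sub>F n in sequentially. norm (z n) < 1"
    using tendsto_norm[OF z] by (rule order_tendstoD) simp
  then obtain N where N: "\<And>n. N \<le> n \<Longrightarrow> norm (z n) < 1" by (auto simp: eventually_sequentially)
  have "(\<lambda>n. \<integral>x. cmod (h (x + z (n + N)) - h x) \<partial>lborel) \<longlonglongrightarrow> (\<integral>x. 0 \<partial>(lborel :: 'a measure))"
  proof (rule integral_dominated_convergence[where w = "\<lambda>x. indicator (cball 0 (R + 1)) x * (2 * B)"])
    show "AE x in lborel. (\<lambda>n. cmod (h (x + z (n + N)) - h x)) \<longlonglongrightarrow> 0"
    proof (rule AE_I2)
      fix x
      have "isCont h x" using cont by (simp add: continuous_on_eq_continuous_at)
      moreover have "(\<lambda>n. x + z (n + N)) \<longlonglongrightarrow> x"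
        using tendsto_add[OF tendsto_const LIMSEQ_ignore_initial_segment[OF z, of N], of x] by simp
      ultimately have "(\<lambda>n. h (x + z (n + N))) \<longlonglongrightarrow> h x" by (rule isCont_tendsto_compose)
      then show "(\<lambda>n. cmod (h (x + z (n + N)) - h x)) \<longlonglongrightarrow> 0"
        by (intro tendsto_norm_zero) (simp add: LIM_zero)
    qed
    show "AE x in lborel. norm (cmod (h (x + z (n + N)) - h x)) \<le> indicator (cball 0 (R + 1)) x * (2 * B)" for n
    proof (rule AE_I2)
      fix x
      show "norm (cmod (h (x + z (n + N)) - h x)) \<le> indicator (cball 0 (R + 1)) x * (2 * B)"
      proof (cases "norm x \<le> R + 1")
        case True
        have "cmod (h (x + z (n + N)) - h x) \<le> cmod (h (x + z (n + N))) + cmod (h x)" by (rule norm_triangle_ineq4)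
        then show ?thesis using True B[of x] B[of "x + z (n + N)"] by (simp add: mem_cball)
      next
        case False
        have "norm x \<le> norm (x + z (n + N)) + norm (z (n + N))"
          using norm_triangle_ineq4[of "x + z (n + N)" "z (n + N)"] by simp
        with N[of "n + N"] False have "R < norm (x + z (n + N))" "R < norm x" by auto
        then show ?thesis using supp order_trans[OF norm_ge_zero B] by (simp add: indicator_def)
      qed
    qed
  qed (simp_all add: integrable_indicator_cball)
  then show "(\<lambda>n. \<integral>x. cmod (h (x + z n) - h x) \<partial>lborel) \<longlonglongrightarrow> 0"
    by (simp only: integral_zero) (rule LIMSEQ_offset[of _ N])
qed

text \<open>Translation is an isometry of L1, so the property passes to L1 limits by the three-term
  estimate.\<close>

lemma translation_continuous_approx:
  fixes f :: "'a::euclidean_space \<Rightarrow> complex"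
  assumes f: "integrable lborel f"
    and approx: "\<And>e. 0 < e \<Longrightarrow> \<exists>h. integrable lborel h \<and> translation_continuous h \<and> (\<integral>x. cmod (f x - h x) \<partial>lborel) < e"
  shows "translation_continuous f"
  unfolding translation_continuous_def
proof (intro allI impI LIMSEQ_I)
  fix z :: "nat \<Rightarrow> 'a" and r :: real assume z: "z \<longlonglongrightarrow> 0" and r: "0 < r"
  obtain h where h: "integrable lborel h" "translation_continuous h" "(\<integral>x. cmod (f x - h x) \<partial>lborel) < r / 4"
    using approx[of "r / 4"] r by auto
  have [measurable]: "f \<in> borel_measurable borel" "h \<in> borel_measurable borel" using f h by auto
  have "(\<lambda>n. \<integral>x. cmod (h (x + z n) - h x) \<partial>lborel) \<longlonglongrightarrow> 0"
    using h(2) z by (simp add: translation_continuous_def)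
  then have "\<forall>\<^sub>F n in sequentially. (\<integral>x. cmod (h (x + z n) - h x) \<partial>lborel) < r / 2"
    using r by (intro order_tendstoD) auto
  then obtain N where N: "\<And>n. N \<le> n \<Longrightarrow> (\<integral>x. cmod (h (x + z n) - h x) \<partial>lborel) < r / 2"
    by (auto simp: eventually_sequentially)
  have "norm ((\<integral>x. cmod (f (x + z n) - f x) \<partial>lborel) - 0) < r" if n: "N \<le> n" for n
  proof -
    have int: "integrable lborel (\<lambda>x. cmod (f x - h x))" "integrable lborel (\<lambda>x. cmod (f (x + z n) - h (x + z n)))"
      "integrable lborel (\<lambda>x. cmod (h (x + z n) - h x))"
      by (intro integrable_norm Bochner_Integration.integrable_diff integrable_translate f h(1))+
    have "(\<integral>x. cmod (f (x + z n) - f x) \<partial>lborel)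
        \<le> (\<integral>x. cmod (f (x + z n) - h (x + z n)) + (cmod (h (x + z n) - h x) + cmod (f x - h x)) \<partial>lborel)"
    proof (rule integral_mono)
      show "integrable lborel (\<lambda>x. cmod (f (x + z n) - f x))"
        using f by (intro integrable_norm Bochner_Integration.integrable_diff integrable_translate)
      show "integrable lborel (\<lambda>x. cmod (f (x + z n) - h (x + z n)) + (cmod (h (x + z n) - h x) + cmod (f x - h x)))"
        using int by (intro Bochner_Integration.integrable_add)
      fix x
      have eq: "f (x + z n) - f x = (f (x + z n) - h (x + z n)) + ((h (x + z n) - h x) + (h x - f x))" by simp
      show "cmod (f (x + z n) - f x)
        \<le> cmod (f (x + z n) - h (x + z n)) + (cmod (h (x + z n) - h x) + cmod (f x - h x))"
        unfolding eq norm_minus_commute[of "f x" "h x"]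
        by (intro order_trans[OF norm_triangle_ineq] add_left_mono norm_triangle_ineq)
    qed
    also have "\<dots> = (\<integral>x. cmod (f (x + z n) - h (x + z n)) \<partial>lborel) +
        ((\<integral>x. cmod (h (x + z n) - h x) \<partial>lborel) + (\<integral>x. cmod (f x - h x) \<partial>lborel))"
      using int by simp
    also have "(\<integral>x. cmod (f (x + z n) - h (x + z n)) \<partial>lborel) = (\<integral>x. cmod (f x - h x) \<partial>lborel)"
      by (rule integral_translate[of "\<lambda>x. cmod (f x - h x)"]) simp
    finally show ?thesis using h(3) N[OF n] by simp
  qed
  then show "\<exists>N. \<forall>n\<ge>N. norm ((\<integral>x. cmod (f (x + z n) - f x) \<partial>lborel) - 0) < r" by blast
qed

lemma integrable_bounded_support:
  fixes f :: "'a::euclidean_space \<Rightarrow> complex"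
  assumes [measurable]: "f \<in> borel_measurable borel"
    and supp: "\<And>x. R < norm x \<Longrightarrow> f x = 0" and B: "\<And>x. cmod (f x) \<le> B"
  shows "integrable lborel f"
proof (rule Bochner_Integration.integrable_bound[OF integrable_indicator_cball[of R B]])
  show "AE x in lborel. cmod (f x) \<le> norm (indicator (cball 0 R) x * B)"
    using supp B order_trans[OF norm_ge_zero B]
    by (intro AE_I2) (auto simp: indicator_def mem_cball not_le)
qed simp

text \<open>Continuous functions tending to f almost everywhere are given a common bound and a
  common bounded support; dominated convergence then makes them approximate f in L1.\<close>

lemma translation_continuous_bounded:
  fixes f :: "'a::euclidean_space \<Rightarrow> complex"
  assumes [measurable]: "f \<in> borel_measurable borel"
    and supp: "\<And>x. R < norm x \<Longrightarrow> f x = 0" and B: "\<And>x. cmod (f x) \<le> B" "0 < B"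
  shows "translation_continuous f"
proof (rule translation_continuous_approx)
  show "integrable lborel f" using integrable_bounded_support[OF assms(1) supp B(1)] by simp
  have "f measurable_on UNIV"
    using measurable_on_iff_borel_measurable[of UNIV f] by (simp add: lebesgue_on_UNIV_eq measurable_completion)
  then obtain N g where N: "negligible N" and g: "\<And>n::nat. continuous_on UNIV (g n)"
    and lim: "\<And>x. x \<notin> N \<Longrightarrow> (\<lambda>n. g n x) \<longlonglongrightarrow> f x"
    unfolding measurable_on_def by auto
  \<comment> \<open>\<open>chi\<close> is 1 on the ball of radius R and 0 beyond R + 1, and
    \<open>clip\<close> is the radial retraction onto the disc of radius B. Both leave f itself
    unchanged, hence preserve the limit.\<close>
  define chi where "chi x = max 0 (min 1 (R + 1 - norm x))" for x :: 'a
  define clip where "clip w = (B / max B (norm w)) *\<^sub>R w" for w :: complex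
  define h where "h n x = chi x *\<^sub>R clip (g n x)" for n x
  have pos: "max B t \<noteq> 0" for t using B(2) by linarith
  have clip_cont: "continuous_on UNIV clip"
    unfolding clip_def using pos by (intro continuous_intros) auto
  have chi_cont: "continuous_on UNIV chi"
    unfolding chi_def by (intro continuous_intros)
  have h_cont: "continuous_on UNIV (h n)" for n
    unfolding h_def by (intro continuous_intros chi_cont continuous_on_compose2[OF clip_cont g]) auto
  have clip_norm: "cmod (clip w) \<le> B" for w
    using B(2) by (auto simp: clip_def max_def field_simps mult_left_mono)
  have chi: "0 \<le> chi x" "chi x \<le> 1" for x by (auto simp: chi_def)
  have h_norm: "cmod (h n x) \<le> B" for n x
    using mult_mono[OF chi(2)[of x] clip_norm[of "g n x"]] chi[of x] by (simp add: h_def)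
  have h_supp: "h n x = 0" if "R + 1 < norm x" for n x
    using that by (simp add: h_def chi_def)
  have h_meas [measurable]: "h n \<in> borel_measurable borel" for n
    using h_cont by (rule borel_measurable_continuous_onI)
  have h_lim: "(\<lambda>n. h n x) \<longlonglongrightarrow> f x" if "x \<notin> N" for x
  proof -
    have "isCont clip (f x)" using clip_cont by (simp add: continuous_on_eq_continuous_at)
    then have "(\<lambda>n. h n x) \<longlonglongrightarrow> chi x *\<^sub>R clip (f x)"
      unfolding h_def using lim[OF that] by (intro tendsto_intros) (rule isCont_tendsto_compose)
    moreover have "clip (f x) = f x" using B(1)[of x] B(2) by (simp add: clip_def max_def)
    moreover have "chi x *\<^sub>R f x = f x"
      using supp[of x] by (cases "norm x \<le> R") (auto simp: chi_def)
    ultimately show ?thesis by simp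
  qed
  have AE_lim: "AE x in lborel. (\<lambda>n. h n x) \<longlonglongrightarrow> f x"
  proof -
    have "AE x in lebesgue. x \<notin> N"
      using N by (intro AE_not_in) (simp add: negligible_iff_null_sets)
    then have "AE x in lborel. x \<notin> N" by (simp add: AE_completion_iff)
    then show ?thesis by eventually_elim (rule h_lim)
  qed
  have "(\<lambda>n. \<integral>x. cmod (f x - h n x) \<partial>lborel) \<longlonglongrightarrow> (\<integral>x. 0 \<partial>(lborel :: 'a measure))"
  proof (rule integral_dominated_convergence[where w = "\<lambda>x. indicator (cball 0 (R + 1)) x * (2 * B)"])
    show "AE x in lborel. (\<lambda>n. cmod (f x - h n x)) \<longlonglongrightarrow> 0"
      using AE_lim
    proof eventually_elim
      case (elim x)
      then have "(\<lambda>n. f x - h n x) \<longlonglongrightarrow> f x - f x" by (intro tendsto_intros)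
      then show ?case by (intro tendsto_norm_zero) simp
    qed
    show "AE x in lborel. norm (cmod (f x - h n x)) \<le> indicator (cball 0 (R + 1)) x * (2 * B)" for n
    proof (rule AE_I2)
      fix x
      have "cmod (f x - h n x) \<le> cmod (f x) + cmod (h n x)" by (rule norm_triangle_ineq4)
      then show "norm (cmod (f x - h n x)) \<le> indicator (cball 0 (R + 1)) x * (2 * B)"
        using B(1)[of x] h_norm[of n x] h_supp[of x n] supp[of x]
        by (cases "norm x \<le> R + 1") (auto simp: indicator_def mem_cball)
    qed
  qed (simp_all add: integrable_indicator_cball)
  then have lim0: "(\<lambda>n. \<integral>x. cmod (f x - h n x) \<partial>lborel) \<longlonglongrightarrow> 0" by simp
  fix e :: real assume "0 < e"
  then have "\<forall>\<^sub>F n in sequentially. (\<integral>x. cmod (f x - h n x) \<partial>lborel) < e"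
    by (rule order_tendstoD(2)[OF lim0])
  then obtain n where "(\<integral>x. cmod (f x - h n x) \<partial>lborel) < e"
    by (auto simp: eventually_sequentially)
  moreover have "integrable lborel (h n)"
    by (rule integrable_bounded_support[OF h_meas h_supp h_norm])
  moreover have "translation_continuous (h n)"
    by (rule translation_continuous_compact_support[OF h_cont h_supp h_norm])
  ultimately show "\<exists>h. integrable lborel h \<and> translation_continuous h \<and> (\<integral>x. cmod (f x - h x) \<partial>lborel) < e"
    by blast
qed

text \<open>Large values and large arguments are cut at the same level, so one index yields bounded
  functions of bounded support.\<close>

definition truncate :: "nat \<Rightarrow> ('a::euclidean_space \<Rightarrow> complex) \<Rightarrow> 'a \<Rightarrow> complex" where
  "truncate m f x = (if cmod (f x) \<le> real m \<and> norm x \<le> real m then f x else 0)"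

lemma truncate_measurable [measurable]:
  "f \<in> borel_measurable borel \<Longrightarrow> truncate m f \<in> borel_measurable borel"
proof -
  assume [measurable]: "f \<in> borel_measurable borel"
  show ?thesis unfolding truncate_def[abs_def] by measurable
qed

lemma truncate_eventually: "\<forall>\<^sub>F m in sequentially. truncate m f x = f x"
proof -
  obtain M where "max (cmod (f x)) (norm x) \<le> real M" using real_arch_simple by blast
  then have "\<forall>m\<ge>M. truncate m f x = f x" by (auto simp: truncate_def)
  then show ?thesis by (auto simp: eventually_sequentially)
qed

lemma translation_continuous:
  fixes f :: "'a::euclidean_space \<Rightarrow> complex"
  assumes f: "integrable lborel f"
  shows "translation_continuous f"
proof (rule translation_continuous_approx[OF f])
  have [measurable]: "f \<in> borel_measurable borel" using f by simp
  have "(\<lambda>m. \<integral>x. cmod (f x - truncate m f x) \<partial>lborel) \<longlonglongrightarrow> (\<integral>x. 0 \<partial>(lborel :: 'a measure))"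
  proof (rule integral_dominated_convergence[where w = "\<lambda>x. cmod (f x)"])
    show "AE x in lborel. (\<lambda>m. cmod (f x - truncate m f x)) \<longlonglongrightarrow> 0"
    proof (rule AE_I2)
      fix x
      show "(\<lambda>m. cmod (f x - truncate m f x)) \<longlonglongrightarrow> 0"
        by (rule tendsto_eventually, rule eventually_mono[OF truncate_eventually[of f x]]) simp
    qed
  qed (use f in \<open>auto simp: truncate_def\<close>)
  then have lim0: "(\<lambda>m. \<integral>x. cmod (f x - truncate m f x) \<partial>lborel) \<longlonglongrightarrow> 0" by simp
  fix e :: real assume "0 < e"
  then have "\<forall>\<^sub>F m in sequentially. (\<integral>x. cmod (f x - truncate m f x) \<partial>lborel) < e"
    by (rule order_tendstoD(2)[OF lim0])
  then obtain m where m: "(\<integral>x. cmod (f x - truncate m f x) \<partial>lborel) < e"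
    by (auto simp: eventually_sequentially)
  have supp: "real m < norm x \<Longrightarrow> truncate m f x = 0" and bd: "cmod (truncate m f x) \<le> real m + 1" for x
    by (auto simp: truncate_def)
  have "integrable lborel (truncate m f)"
    by (rule integrable_bounded_support[OF _ supp bd]) simp
  moreover have "translation_continuous (truncate m f)"
    by (rule translation_continuous_bounded[OF _ supp bd]) simp_all
  ultimately show "\<exists>h. integrable lborel h \<and> translation_continuous h \<and> (\<integral>x. cmod (f x - h x) \<partial>lborel) < e"
    using m by blast
qed

subsection \<open>Uniqueness of Fourier transforms\<close>

text \<open>S plays the role of a modulus of continuity, averaged at the scales 1 / (n + 1).\<close>

lemma gauss_mean_null:
  fixes S :: "real \<times> real \<Rightarrow> real"
  assumes [measurable]: "S \<in> borel_measurable borel" and bd: "\<And>z. \<bar>S z\<bar> \<le> B"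
    and lim: "\<And>z. z \<longlonglongrightarrow> 0 \<Longrightarrow> (\<lambda>n::nat. S (z n)) \<longlonglongrightarrow> 0"
  shows "(\<lambda>n. \<integral>v. gauss v * S (inverse (real (Suc n)) *\<^sub>R v) \<partial>lborel) \<longlonglongrightarrow> 0"
    and "integrable lborel (\<lambda>v. gauss v * S (c *\<^sub>R v))"
proof -
  have "(\<lambda>n. \<integral>v. gauss v * S (inverse (real (Suc n)) *\<^sub>R v) \<partial>lborel) \<longlonglongrightarrow> (\<integral>v. 0 \<partial>(lborel :: (real \<times> real) measure))"
  proof (rule integral_dominated_convergence[where w = "\<lambda>v. gauss v * B"])
    show "AE v in lborel. (\<lambda>n. gauss v * S (inverse (real (Suc n)) *\<^sub>R v)) \<longlonglongrightarrow> 0"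
    proof (rule AE_I2)
      fix v :: "real \<times> real"
      have "(\<lambda>n. inverse (real (Suc n)) *\<^sub>R v) \<longlonglongrightarrow> 0 *\<^sub>R v"
        by (intro tendsto_intros LIMSEQ_inverse_real_of_nat)
      then have "(\<lambda>n. S (inverse (real (Suc n)) *\<^sub>R v)) \<longlonglongrightarrow> 0" by (intro lim) simp
      then show "(\<lambda>n. gauss v * S (inverse (real (Suc n)) *\<^sub>R v)) \<longlonglongrightarrow> 0" by (rule tendsto_mult_right_zero)
    qed
  qed (auto simp: integrable_gauss_real abs_mult gauss_bounds intro!: mult_left_mono bd)
  then show "(\<lambda>n. \<integral>v. gauss v * S (inverse (real (Suc n)) *\<^sub>R v) \<partial>lborel) \<longlonglongrightarrow> 0" by simp
  show "integrable lborel (\<lambda>v. gauss v * S (c *\<^sub>R v))"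
  proof (rule Bochner_Integration.integrable_bound[of _ "\<lambda>v. gauss v * B"])
    have "\<bar>S z\<bar> \<le> \<bar>B\<bar>" for z using bd[of z] by linarith
    then show "AE v in lborel. norm (gauss v * S (c *\<^sub>R v)) \<le> norm (gauss v * B)"
      by (intro AE_I2) (simp add: abs_mult gauss_bounds mult_left_mono)
  qed (simp_all add: integrable_gauss_real)
qed

text \<open>2 pi f x is the Gaussian integral of the constant f x, so the difference is an integral
  of increments.\<close>

lemma gauss_mean_diff_le:
  fixes f :: "real \<times> real \<Rightarrow> complex"
  assumes f: "integrable lborel f" and e: "0 < e"
  shows "ennreal (cmod (2 * pi * f x - (\<integral>v. f (x + e *\<^sub>R v) * of_real (gauss v) \<partial>lborel)))
    \<le> (\<integral>\<^sup>+v. ennreal (gauss v * cmod (f (x + e *\<^sub>R v) - f x)) \<partial>lborel)"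
proof -
  have [measurable]: "f \<in> borel_measurable borel" using f by simp
  have i1: "integrable lborel (\<lambda>v. f x * complex_of_real (gauss v))"
    by (intro integrable_mult_right integrable_gauss)
  have i2: "integrable lborel (\<lambda>v. f (x + e *\<^sub>R v) * complex_of_real (gauss v))"
    by (rule Bochner_Integration.integrable_bound[OF integrable_lborel_affine[OF f, of e x]])
       (use e gauss_bounds in \<open>auto simp: norm_mult mult_left_le\<close>)
  have "(\<integral>v. f x * complex_of_real (gauss v) \<partial>lborel) = 2 * pi * f x"
    by (simp add: integral_gauss)
  then have "2 * pi * f x - (\<integral>v. f (x + e *\<^sub>R v) * of_real (gauss v) \<partial>lborel)
      = (\<integral>v. f x * of_real (gauss v) - f (x + e *\<^sub>R v) * of_real (gauss v) \<partial>lborel)"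
    using Bochner_Integration.integral_diff[OF i1 i2] by (simp only:)
  then have "ennreal (cmod (2 * pi * f x - (\<integral>v. f (x + e *\<^sub>R v) * of_real (gauss v) \<partial>lborel)))
      \<le> ennreal (\<integral>v. cmod (f x * of_real (gauss v) - f (x + e *\<^sub>R v) * of_real (gauss v)) \<partial>lborel)"
    by (simp only:) (intro ennreal_leI integral_norm_bound)
  also have "\<dots> = (\<integral>\<^sup>+v. ennreal (cmod (f x * of_real (gauss v) - f (x + e *\<^sub>R v) * of_real (gauss v))) \<partial>lborel)"
    using i1 i2 by (intro nn_integral_eq_integral[symmetric] integrable_norm Bochner_Integration.integrable_diff) auto
  also have "\<dots> = (\<integral>\<^sup>+v. ennreal (gauss v * cmod (f (x + e *\<^sub>R v) - f x)) \<partial>lborel)"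
    unfolding left_diff_distrib[symmetric] norm_mult
    by (intro nn_integral_cong arg_cong[where f = ennreal])
       (simp add: gauss_bounds norm_minus_commute)
  finally show ?thesis .
qed

text \<open>By \<open>fourier_gauss_mean\<close> all Gaussian averages of f vanish. So the L1 norm
  of 2 pi f is at most the Gaussian average of the L1 modulus of continuity, which tends to 0 with
  the scale.\<close>

lemma fourier_eq_0_imp_AE:
  fixes f :: "real \<times> real \<Rightarrow> complex"
  assumes f: "integrable lborel f" and 0: "\<And>u. fourier f u = 0"
  shows "AE x in lborel. f x = 0"
proof -
  have [measurable]: "f \<in> borel_measurable borel" using f by simp
  define S where "S z = (\<integral>x. cmod (f (x + z) - f x) \<partial>lborel)" for z
  have int: "integrable lborel (\<lambda>x. cmod (f (x + z) - f x))" for z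
    using f by (intro integrable_norm Bochner_Integration.integrable_diff integrable_translate)
  have S_meas [measurable]: "S \<in> borel_measurable borel"
    unfolding S_def[abs_def] by (rule lborel.borel_measurable_lebesgue_integral) simp
  have S_bd: "\<bar>S z\<bar> \<le> 2 * (\<integral>x. cmod (f x) \<partial>lborel)" for z
  proof -
    have "S z \<le> (\<integral>x. cmod (f (x + z)) + cmod (f x) \<partial>lborel)"
      unfolding S_def
      by (intro integral_mono int Bochner_Integration.integrable_add integrable_norm integrable_translate f norm_triangle_ineq4)
    also have "\<dots> = 2 * (\<integral>x. cmod (f x) \<partial>lborel)"
      using f integral_translate[of "\<lambda>x. cmod (f x)" z]
      by (subst Bochner_Integration.integral_add) (auto intro: integrable_norm integrable_translate)
    finally show ?thesis by (simp add: S_def)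
  qed
  have S_lim: "z \<longlonglongrightarrow> 0 \<Longrightarrow> (\<lambda>n::nat. S (z n)) \<longlonglongrightarrow> 0" for z
    using translation_continuous[OF f] by (simp add: translation_continuous_def S_def)
  have le: "(\<integral>\<^sup>+x. ennreal (2 * pi * cmod (f x)) \<partial>lborel) \<le> ennreal (\<integral>v. gauss v * S (inverse (real (Suc n)) *\<^sub>R v) \<partial>lborel)" for n
  proof -
    define e where "e = inverse (real (Suc n))"
    have e: "0 < e" by (simp add: e_def)
    have z: "(\<integral>v. f (x + e *\<^sub>R v) * of_real (gauss v) \<partial>lborel) = 0" for x
      using fourier_gauss_mean[OF f e, of x] by (simp add: 0)
    have "(\<integral>\<^sup>+x. ennreal (2 * pi * cmod (f x)) \<partial>lborel)
        \<le> (\<integral>\<^sup>+x. \<integral>\<^sup>+v. ennreal (gauss v * cmod (f (x + e *\<^sub>R v) - f x)) \<partial>lborel \<partial>lborel)"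
      using gauss_mean_diff_le[OF f e] by (intro nn_integral_mono) (simp add: z norm_mult)
    also have "\<dots> = (\<integral>\<^sup>+v. \<integral>\<^sup>+x. ennreal (gauss v * cmod (f (x + e *\<^sub>R v) - f x)) \<partial>lborel \<partial>lborel)"
      by (rule lborel_pair.Fubini'[symmetric]) measurable
    also have "\<dots> = (\<integral>\<^sup>+v. ennreal (gauss v * S (e *\<^sub>R v)) \<partial>lborel)"
      unfolding S_def using gauss_bounds
      by (intro nn_integral_cong)
         (simp add: ennreal_mult' nn_integral_cmult nn_integral_eq_integral[OF int])
    also have "\<dots> = ennreal (\<integral>v. gauss v * S (e *\<^sub>R v) \<partial>lborel)"
      by (rule nn_integral_eq_integral[OF gauss_mean_null(2)[OF S_meas S_bd S_lim]])
         (auto simp: gauss_bounds S_def)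
    finally show ?thesis by (simp add: e_def)
  qed
  have "(\<lambda>n. ennreal (\<integral>v. gauss v * S (inverse (real (Suc n)) *\<^sub>R v) \<partial>lborel)) \<longlonglongrightarrow> ennreal 0"
    by (intro tendsto_ennrealI gauss_mean_null(1)[OF S_meas S_bd S_lim])
  then have "(\<integral>\<^sup>+x. ennreal (2 * pi * cmod (f x)) \<partial>lborel) \<le> ennreal 0"
    by (rule LIMSEQ_le_const) (use le in blast)
  then have "(\<integral>\<^sup>+x. ennreal (2 * pi * cmod (f x)) \<partial>lborel) = 0" by simp
  then show ?thesis by (subst (asm) nn_integral_0_iff_AE) (auto elim!: eventually_mono simp: mult_le_0_iff)
qed

lemma fourier_unique_AE:
  fixes f g :: "real \<times> real \<Rightarrow> complex"
  assumes "integrable lborel f" "integrable lborel g" "\<And>u. fourier f u = fourier g u"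
  shows "AE x in lborel. f x = g x"
  using fourier_eq_0_imp_AE[of "\<lambda>x. f x - g x"] assms by (simp add: fourier_diff)

subsection \<open>A Plancherel inequality\<close>

text \<open>With K and D the squared norms of f and its transform, the pairing of the transform with
  its damped conjugate is at most D. By the multiplication formula it is also (2 pi)^2 K up to an
  error governed by the modulus S. The factor (2 pi)^2 >= 1 is dropped at the end.\<close>

lemma L2sq_le_fourier:
  fixes f :: "real \<times> real \<Rightarrow> complex"
  assumes f: "integrable lborel f" and f2: "f \<in> L2"
  shows "L2sq f \<le> L2sq (fourier f)"
proof (cases "L2sq (fourier f) < \<infinity>")
  case True
  have [measurable]: "f \<in> borel_measurable borel" using f by simp
  have F2: "fourier f \<in> L2" using True by (simp add: L2_def)
  define D where "D = (\<integral>u. (cmod (fourier f u))\<^sup>2 \<partial>lborel)"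
  define K where "K = (\<integral>x. (cmod (f x))\<^sup>2 \<partial>lborel)"
  \<comment> \<open>A modulus of continuity weighted by |f|. Splitting the weight into a bounded
    truncation and a small remainder reduces it to the L1 modulus.\<close>
  define S where "S z = (\<integral>x. cmod (f x) * cmod (f (x + z) - f x) \<partial>lborel)" for z
  have dL2: "(\<lambda>x. f (x + z) - f x) \<in> L2" for z
    using f2 by (intro L2_diff L2_translate)
  \<comment> \<open>A weighted mean inequality; the parameter d decides which of the two squares
    must be small.\<close>
  have ineq: "a * b \<le> d * a\<^sup>2 + (1 / d) * b\<^sup>2" if "0 < d" for a b d :: real
  proof -
    have "0 \<le> (d * a - b)\<^sup>2 + (d * a)\<^sup>2 + b\<^sup>2" by simp
    then have "d * (a * b) \<le> d * (d * a\<^sup>2 + (1 / d) * b\<^sup>2)"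
      using that by (simp add: power2_eq_square algebra_simps)
    then show ?thesis using that by simp
  qed
  have int: "integrable lborel (\<lambda>x. cmod (f x) * cmod (f (x + z) - f x))" for z
    using integrable_norm[OF L2_mult_integrable[OF f2 dL2[of z]]]
    unfolding norm_mult complex_mod_cnj .
  have d_bd: "(\<integral>x. (cmod (f (x + z) - f x))\<^sup>2 \<partial>lborel) \<le> 4 * K" for z
  proof -
    have "ennreal (\<integral>x. (cmod (f (x + z) - f x))\<^sup>2 \<partial>lborel) \<le> 2 * L2sq (\<lambda>x. f (x + z)) + 2 * L2sq f"
      unfolding L2sq_integral[OF dL2, symmetric] by (rule L2sq_diff) auto
    also have "\<dots> = ennreal (4 * K)"
      by (simp add: L2sq_translate L2sq_integral[OF f2] K_def ennreal_mult' flip: distrib_right)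
    finally show ?thesis by (simp add: K_def)
  qed
  have S_meas [measurable]: "S \<in> borel_measurable borel"
    unfolding S_def[abs_def] by (rule lborel.borel_measurable_lebesgue_integral) simp
  have S_nonneg: "0 \<le> S z" for z by (simp add: S_def)
  have S_le: "S z \<le> d * (\<integral>x. (cmod (f x))\<^sup>2 \<partial>lborel) + (1 / d) * (4 * K)" if "0 < d" for z d
  proof -
    have "S z \<le> (\<integral>x. d * (cmod (f x))\<^sup>2 + (1 / d) * (cmod (f (x + z) - f x))\<^sup>2 \<partial>lborel)"
      unfolding S_def
      by (intro integral_mono int ineq[OF that] Bochner_Integration.integrable_add integrable_mult_right L2_integrable_power2 f2 dL2)
    also have "\<dots> = d * (\<integral>x. (cmod (f x))\<^sup>2 \<partial>lborel) + (1 / d) * (\<integral>x. (cmod (f (x + z) - f x))\<^sup>2 \<partial>lborel)"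
      using L2_integrable_power2[OF f2] L2_integrable_power2[OF dL2[of z]] by simp
    also have "\<dots> \<le> d * (\<integral>x. (cmod (f x))\<^sup>2 \<partial>lborel) + (1 / d) * (4 * K)"
      using d_bd[of z] that by (intro add_left_mono mult_left_mono) auto
    finally show ?thesis .
  qed
  have S_bd: "\<bar>S z\<bar> \<le> 5 * K" for z
    using S_le[of 1 z] S_nonneg[of z] by (simp add: K_def)
  have S_lim: "(\<lambda>n::nat. S (z n)) \<longlonglongrightarrow> 0" if z: "z \<longlonglongrightarrow> 0" for z
  proof (rule LIMSEQ_I)
    fix r :: real assume r: "0 < r"
    have "0 \<le> K" by (simp add: K_def)
    \<comment> \<open>Makes 4 K / d <= r / 4. The truncation level m is chosen next, so that d times
      the squared norm of the remainder is below r / 4, and n comes last.\<close>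
    define d where "d = 16 * (K + 1) / r"
    have d: "0 < d" using r \<open>0 \<le> K\<close> by (simp add: d_def)
    define R where "R m x = f x - truncate m f x" for m x
    have "(\<lambda>m. \<integral>x. (cmod (R m x))\<^sup>2 \<partial>lborel) \<longlonglongrightarrow> (\<integral>x. 0 \<partial>(lborel :: (real \<times> real) measure))"
    proof (rule integral_dominated_convergence[where w = "\<lambda>x. (cmod (f x))\<^sup>2"])
      show "AE x in lborel. (\<lambda>m. (cmod (R m x))\<^sup>2) \<longlonglongrightarrow> 0"
      proof (rule AE_I2)
        fix x
        show "(\<lambda>m. (cmod (R m x))\<^sup>2) \<longlonglongrightarrow> 0"
          by (rule tendsto_eventually, rule eventually_mono[OF truncate_eventually[of f x]]) (simp add: R_def)
      qed
    qed (use L2_integrable_power2[OF f2] in \<open>auto simp: R_def truncate_def\<close>)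
    then have "(\<lambda>m. \<integral>x. (cmod (R m x))\<^sup>2 \<partial>lborel) \<longlonglongrightarrow> 0" by simp
    then have "\<forall>\<^sub>F m in sequentially. (\<integral>x. (cmod (R m x))\<^sup>2 \<partial>lborel) < r / (4 * d)"
      using r d by (intro order_tendstoD(2)) auto
    then obtain m where m: "(\<integral>x. (cmod (R m x))\<^sup>2 \<partial>lborel) < r / (4 * d)"
      by (auto simp: eventually_sequentially)
    have RL2: "R m \<in> L2"
    proof -
      have "L2sq (R m) \<le> L2sq f" by (rule L2sq_mono) (simp add: R_def truncate_def)
      then show ?thesis using f2 by (auto simp: L2_def R_def[abs_def])
    qed
    define T where "T z = (\<integral>x. cmod (f (x + z) - f x) \<partial>lborel)" for z
    have T_lim: "(\<lambda>n. real m * T (z n)) \<longlonglongrightarrow> 0"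
      using translation_continuous[OF f] z by (intro tendsto_mult_right_zero) (simp add: translation_continuous_def T_def)
    then have "\<forall>\<^sub>F n in sequentially. real m * T (z n) < r / 4"
      using r by (intro order_tendstoD(2)) auto
    then obtain N where N: "\<And>n. N \<le> n \<Longrightarrow> real m * T (z n) < r / 4"
      by (auto simp: eventually_sequentially)
    have "norm (S (z n) - 0) < r" if n: "N \<le> n" for n
    proof -
      have i: "integrable lborel (\<lambda>x. cmod (f (x + z n) - f x))"
        using f by (intro integrable_norm Bochner_Integration.integrable_diff integrable_translate)
      have "S (z n) \<le> (\<integral>x. real m * cmod (f (x + z n) - f x) +
          (d * (cmod (R m x))\<^sup>2 + (1 / d) * (cmod (f (x + z n) - f x))\<^sup>2) \<partial>lborel)"
        unfolding S_def
      proof (rule integral_mono[OF int])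
        show "integrable lborel (\<lambda>x. real m * cmod (f (x + z n) - f x) +
          (d * (cmod (R m x))\<^sup>2 + (1 / d) * (cmod (f (x + z n) - f x))\<^sup>2))"
          by (intro Bochner_Integration.integrable_add integrable_mult_right i L2_integrable_power2 RL2 dL2)
        fix x
        have "cmod (f x) \<le> cmod (truncate m f x) + cmod (R m x)"
          using norm_triangle_ineq[of "truncate m f x" "R m x"] by (simp add: R_def)
        also have "\<dots> \<le> real m + cmod (R m x)" by (simp add: truncate_def)
        finally have "cmod (f x) * cmod (f (x + z n) - f x) \<le> (real m + cmod (R m x)) * cmod (f (x + z n) - f x)"
          by (intro mult_right_mono) auto
        also have "\<dots> \<le> real m * cmod (f (x + z n) - f x) + (d * (cmod (R m x))\<^sup>2 + (1 / d) * (cmod (f (x + z n) - f x))\<^sup>2)"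
          using ineq[OF d, of "cmod (R m x)" "cmod (f (x + z n) - f x)"] by (simp add: distrib_right)
        finally show "cmod (f x) * cmod (f (x + z n) - f x) \<le> real m * cmod (f (x + z n) - f x) +
          (d * (cmod (R m x))\<^sup>2 + (1 / d) * (cmod (f (x + z n) - f x))\<^sup>2)" .
      qed
      also have "\<dots> = real m * T (z n) + (d * (\<integral>x. (cmod (R m x))\<^sup>2 \<partial>lborel)
          + (1 / d) * (\<integral>x. (cmod (f (x + z n) - f x))\<^sup>2 \<partial>lborel))"
        using i L2_integrable_power2[OF RL2] L2_integrable_power2[OF dL2[of "z n"]]
        by (simp add: T_def)
      also have "\<dots> < r / 4 + (d * (r / (4 * d)) + (1 / d) * (4 * K))"
        using N[OF n] m d d_bd[of "z n"]
        by (intro add_less_le_mono add_mono mult_left_mono) auto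
      also have "(1 / d) * (4 * K) \<le> r / 4"
        using r \<open>0 \<le> K\<close> by (simp add: d_def field_simps)
      also have "r / 4 + (d * (r / (4 * d)) + r / 4) < r" using d r by simp
      finally show ?thesis using S_nonneg[of "z n"] by simp
    qed
    then show "\<exists>N. \<forall>n\<ge>N. norm (S (z n) - 0) < r" by blast
  qed
  have main: "(2 * pi)\<^sup>2 * K \<le> D + 2 * pi * (\<integral>v. gauss v * S (inverse (real (Suc n)) *\<^sub>R v) \<partial>lborel)" for n
  proof -
    define e where "e = inverse (real (Suc n))"
    have e: "0 < e" by (simp add: e_def)
    define M where "M x = (\<integral>v. f (x + e *\<^sub>R v) * of_real (gauss v) \<partial>lborel)" for x
    \<comment> \<open>The damped conjugate transform. Multiplied by the transform of f it stays
      below the squared modulus, and its own transform is 2 pi times the conjugate of the Gaussian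
      average \<open>M\<close>.\<close>
    define g where "g u = complex_of_real (gauss (e *\<^sub>R u)) * cnj (fourier f u)" for u
    define B where "B = (\<integral>x. cmod (f x) \<partial>lborel)"
    have ge: "integrable lborel (\<lambda>u. complex_of_real (gauss (e *\<^sub>R u)))"
      using integrable_lborel_affine[OF integrable_gauss, of e 0] e by simp
    have g: "integrable lborel g"
    proof (rule Bochner_Integration.integrable_bound[OF integrable_mult_left[OF ge, of "of_real B"]])
      show "AE u in lborel. cmod (g u) \<le> cmod (complex_of_real (gauss (e *\<^sub>R u)) * of_real B)"
        using cmod_fourier_le[OF f] by (intro AE_I2) (auto simp: g_def norm_mult B_def intro!: mult_left_mono)
    qed (simp add: g_def[abs_def])
    have fg: "fourier g x = 2 * pi * cnj (M x)" for x
    proof -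
      have "fourier g x = (\<integral>u. cnj (complex_of_real (gauss (e *\<^sub>R u)) * cis (x \<bullet> u) * fourier f u) \<partial>lborel)"
        by (simp add: fourier_def[of g] g_def cis_cnj mult_ac)
      also have "\<dots> = cnj (2 * pi * M x)"
        unfolding Bochner_Integration.integral_cnj M_def by (simp only: fourier_gauss_mean[OF f e])
      finally show ?thesis by simp
    qed
    have J: "(\<integral>u. g u * fourier f u \<partial>lborel) = (\<integral>x. f x * (2 * pi * cnj (M x)) \<partial>lborel)"
      by (simp only: fourier_exchange[OF f g] fg)
    have "cmod (\<integral>u. g u * fourier f u \<partial>lborel) \<le> (\<integral>u. cmod (g u * fourier f u) \<partial>lborel)"
      by (rule integral_norm_bound)
    also have "\<dots> \<le> D"
      unfolding D_def
    proof (rule integral_mono)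
      have "cmod (g u * fourier f u) \<le> (cmod (fourier f u))\<^sup>2" for u
        using gauss_bounds[of "e *\<^sub>R u"] by (simp add: g_def norm_mult power2_eq_square mult.assoc mult_left_le_one_le)
      then show "integrable lborel (\<lambda>u. cmod (g u * fourier f u))" "\<And>u. cmod (g u * fourier f u) \<le> (cmod (fourier f u))\<^sup>2"
        by (auto intro!: Bochner_Integration.integrable_bound[OF L2_integrable_power2[OF F2]] simp: g_def)
    qed (rule L2_integrable_power2[OF F2])
    finally have JD: "cmod (\<integral>u. g u * fourier f u \<partial>lborel) \<le> D" .
    have i1: "integrable lborel (\<lambda>x. f x * (2 * pi * cnj (M x)))"
    proof (rule Bochner_Integration.integrable_bound[OF integrable_mult_left[OF f, of "of_real (\<integral>u. cmod (g u) \<partial>lborel)"]])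
      have [measurable]: "(\<lambda>x. 2 * pi * cnj (M x)) \<in> borel_measurable borel"
        unfolding fg[symmetric] using g by (intro fourier_measurable) simp
      show "(\<lambda>x. f x * (2 * pi * cnj (M x))) \<in> borel_measurable lborel" by measurable
      show "AE x in lborel. cmod (f x * (2 * pi * cnj (M x))) \<le> cmod (f x * of_real (\<integral>u. cmod (g u) \<partial>lborel))"
        unfolding fg[symmetric] using cmod_fourier_le[OF g]
        by (intro AE_I2) (auto simp: norm_mult intro!: mult_left_mono)
    qed
    have i2: "integrable lborel (\<lambda>x. (2 * pi)\<^sup>2 * (f x * cnj (f x)))"
      by (intro integrable_mult_right L2_mult_integrable f2)
    have K: "(\<integral>x. (2 * pi)\<^sup>2 * (f x * cnj (f x)) \<partial>lborel) = of_real ((2 * pi)\<^sup>2 * K)"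
    proof -
      have "f x * cnj (f x) = of_real ((cmod (f x))\<^sup>2)" for x by (simp only: complex_norm_square)
      then have "(\<integral>x. f x * cnj (f x) \<partial>lborel) = of_real K"
        by (simp only: K_def integral_complex_of_real)
      then show ?thesis by simp
    qed
    have M_meas [measurable]: "M \<in> borel_measurable borel"
      unfolding M_def[abs_def] by (rule lborel.borel_measurable_lebesgue_integral) simp
    have "ennreal (cmod (of_real ((2 * pi)\<^sup>2 * K) - (\<integral>x. f x * (2 * pi * cnj (M x)) \<partial>lborel)))
        = ennreal (cmod (\<integral>x. (2 * pi)\<^sup>2 * (f x * cnj (f x)) - f x * (2 * pi * cnj (M x)) \<partial>lborel))"
      using Bochner_Integration.integral_diff[OF i2 i1] K by simp
    also have "\<dots> \<le> ennreal (\<integral>x. cmod ((2 * pi)\<^sup>2 * (f x * cnj (f x)) - f x * (2 * pi * cnj (M x))) \<partial>lborel)"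
      by (intro ennreal_leI integral_norm_bound)
    also have "\<dots> = (\<integral>\<^sup>+x. ennreal (cmod ((2 * pi)\<^sup>2 * (f x * cnj (f x)) - f x * (2 * pi * cnj (M x)))) \<partial>lborel)"
      using i1 i2 by (intro nn_integral_eq_integral[symmetric] integrable_norm Bochner_Integration.integrable_diff) auto
    also have "\<dots> = (\<integral>\<^sup>+x. ennreal (2 * pi) * (ennreal (cmod (f x)) * ennreal (cmod (2 * pi * f x - M x))) \<partial>lborel)"
    proof (rule nn_integral_cong)
      fix x
      have "(2 * pi)\<^sup>2 * (f x * cnj (f x)) - f x * (2 * pi * cnj (M x)) = 2 * pi * (f x * cnj (2 * pi * f x - M x))"
        by (simp add: power2_eq_square algebra_simps)
      then show "ennreal (cmod ((2 * pi)\<^sup>2 * (f x * cnj (f x)) - f x * (2 * pi * cnj (M x))))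
          = ennreal (2 * pi) * (ennreal (cmod (f x)) * ennreal (cmod (2 * pi * f x - M x)))"
        by (simp only: norm_mult complex_mod_cnj) (simp add: ennreal_mult')
    qed
    also have "\<dots> = ennreal (2 * pi) * (\<integral>\<^sup>+x. ennreal (cmod (f x)) * ennreal (cmod (2 * pi * f x - M x)) \<partial>lborel)"
      by (rule nn_integral_cmult) measurable
    also have "\<dots> \<le> ennreal (2 * pi) * (\<integral>\<^sup>+x. ennreal (cmod (f x)) *
        (\<integral>\<^sup>+v. ennreal (gauss v * cmod (f (x + e *\<^sub>R v) - f x)) \<partial>lborel) \<partial>lborel)"
      using gauss_mean_diff_le[OF f e] by (intro mult_left_mono nn_integral_mono) (auto simp: M_def)
    also have "(\<integral>\<^sup>+x. ennreal (cmod (f x)) * (\<integral>\<^sup>+v. ennreal (gauss v * cmod (f (x + e *\<^sub>R v) - f x)) \<partial>lborel) \<partial>lborel)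
        = (\<integral>\<^sup>+x. \<integral>\<^sup>+v. ennreal (gauss v) * ennreal (cmod (f x) * cmod (f (x + e *\<^sub>R v) - f x)) \<partial>lborel \<partial>lborel)"
      by (intro nn_integral_cong, subst nn_integral_cmult[symmetric])
         (auto simp: ennreal_mult' gauss_bounds mult_ac intro!: nn_integral_cong)
    also have "\<dots> = (\<integral>\<^sup>+v. \<integral>\<^sup>+x. ennreal (gauss v) * ennreal (cmod (f x) * cmod (f (x + e *\<^sub>R v) - f x)) \<partial>lborel \<partial>lborel)"
      by (rule lborel_pair.Fubini'[symmetric]) measurable
    also have "\<dots> = (\<integral>\<^sup>+v. ennreal (gauss v * S (e *\<^sub>R v)) \<partial>lborel)"
    proof (rule nn_integral_cong)
      fix v :: "real \<times> real"
      have "(\<integral>\<^sup>+x. ennreal (gauss v) * ennreal (cmod (f x) * cmod (f (x + e *\<^sub>R v) - f x)) \<partial>lborel)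
          = ennreal (gauss v) * (\<integral>\<^sup>+x. ennreal (cmod (f x) * cmod (f (x + e *\<^sub>R v) - f x)) \<partial>lborel)"
        by (rule nn_integral_cmult) simp
      also have "\<dots> = ennreal (gauss v * S (e *\<^sub>R v))"
        unfolding S_def by (subst nn_integral_eq_integral[OF int]) (simp_all add: ennreal_mult' gauss_bounds)
      finally show "(\<integral>\<^sup>+x. ennreal (gauss v) * ennreal (cmod (f x) * cmod (f (x + e *\<^sub>R v) - f x)) \<partial>lborel)
          = ennreal (gauss v * S (e *\<^sub>R v))" .
    qed
    also have "\<dots> = ennreal (\<integral>v. gauss v * S (e *\<^sub>R v) \<partial>lborel)"
      by (rule nn_integral_eq_integral[OF gauss_mean_null(2)[OF S_meas S_bd S_lim]])
         (auto simp: gauss_bounds S_nonneg)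
    finally have "cmod (of_real ((2 * pi)\<^sup>2 * K) - (\<integral>x. f x * (2 * pi * cnj (M x)) \<partial>lborel))
        \<le> 2 * pi * (\<integral>v. gauss v * S (e *\<^sub>R v) \<partial>lborel)"
      by (simp add: ennreal_mult'[symmetric] gauss_bounds S_nonneg integral_nonneg_AE)
    moreover have "cmod (of_real ((2 * pi)\<^sup>2 * K)) = (2 * pi)\<^sup>2 * K"
      unfolding norm_of_real by (simp add: K_def)
    ultimately show ?thesis
      using JD norm_triangle_ineq2[of "of_real ((2 * pi)\<^sup>2 * K)" "\<integral>x. f x * (2 * pi * cnj (M x)) \<partial>lborel"]
      unfolding J e_def by linarith
  qed
  have "(\<lambda>n. D + 2 * pi * (\<integral>v. gauss v * S (inverse (real (Suc n)) *\<^sub>R v) \<partial>lborel)) \<longlonglongrightarrow> D + 2 * pi * 0"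
    by (intro tendsto_intros gauss_mean_null(1)[OF S_meas S_bd S_lim])
  then have "(2 * pi)\<^sup>2 * K \<le> D + 2 * pi * 0"
    by (rule LIMSEQ_le_const) (use main in blast)
  moreover have "1 * K \<le> (2 * pi)\<^sup>2 * K"
  proof (rule mult_right_mono)
    have "1 \<le> 2 * pi" using pi_gt3 by linarith
    then show "1 \<le> (2 * pi)\<^sup>2" by (rule one_le_power)
  qed (simp add: K_def)
  ultimately have "K \<le> D" by simp
  then show ?thesis
    using L2sq_integral[OF f2] L2sq_integral[OF F2] by (simp add: K_def D_def ennreal_leI)
qed (simp add: not_less top_unique)

subsection \<open>Plancherel transforms\<close>

definition ball_trunc :: "nat \<Rightarrow> ('a::euclidean_space \<Rightarrow> complex) \<Rightarrow> 'a \<Rightarrow> complex" where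
  "ball_trunc n f x = indicator (cball 0 (real n)) x * f x"

lemma ball_trunc_measurable [measurable]:
  fixes f :: "'a::euclidean_space \<Rightarrow> complex"
  shows "f \<in> borel_measurable borel \<Longrightarrow> ball_trunc n f \<in> borel_measurable borel"
proof -
  assume [measurable]: "f \<in> borel_measurable borel"
  have [measurable]: "cball (0 :: 'a) (real n) \<in> sets borel" by simp
  show ?thesis unfolding ball_trunc_def[abs_def] by measurable
qed

lemma ball_trunc_L2: "f \<in> L2 \<Longrightarrow> ball_trunc n f \<in> L2"
proof -
  assume f: "f \<in> L2"
  have "L2sq (ball_trunc n f) \<le> L2sq f"
    by (rule L2sq_mono) (simp add: ball_trunc_def indicator_def)
  then show ?thesis using f by (auto simp: L2_def)
qed

lemma L2_bounded_support_integrable: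
  fixes f :: "'a::euclidean_space \<Rightarrow> complex"
  assumes f: "f \<in> L2" and supp: "\<And>x. R < norm x \<Longrightarrow> f x = 0"
  shows "integrable lborel f"
proof (rule Bochner_Integration.integrable_bound)
  show "integrable lborel (\<lambda>x. indicator (cball 0 R) x * 1 + (cmod (f x))\<^sup>2)"
    by (intro Bochner_Integration.integrable_add integrable_indicator_cball L2_integrable_power2 f)
  have "cmod (f x) \<le> indicator (cball 0 R) x * 1 + (cmod (f x))\<^sup>2" for x
  proof (cases "norm x \<le> R")
    case True
    have "0 \<le> (cmod (f x) - 1)\<^sup>2 + (cmod (f x))\<^sup>2 + 1" by simp
    then show ?thesis using True by (simp add: power2_diff mem_cball)
  qed (simp add: supp)
  then show "AE x in lborel. cmod (f x) \<le> norm (indicator (cball 0 R) x * 1 + (cmod (f x))\<^sup>2)"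
    by (intro AE_I2) (auto intro: order_trans[OF _ abs_ge_self])
  show "f \<in> borel_measurable lborel" using f by auto
qed

lemma ball_trunc_integrable: "f \<in> L2 \<Longrightarrow> integrable lborel (ball_trunc n f)"
  by (rule L2_bounded_support_integrable[OF ball_trunc_L2, where R = "real n"])
     (auto simp: ball_trunc_def mem_cball)

lemma ball_trunc_tendsto:
  assumes f: "f \<in> L2"
  shows "(\<lambda>n. L2sq (\<lambda>x. f x - ball_trunc n f x)) \<longlonglongrightarrow> 0"
proof -
  have [measurable]: "f \<in> borel_measurable borel" using f by auto
  have "(\<lambda>n. \<integral>\<^sup>+x. ennreal ((cmod (f x - ball_trunc n f x))\<^sup>2) \<partial>lborel) \<longlonglongrightarrow> (\<integral>\<^sup>+x. 0 \<partial>(lborel :: 'a measure))"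
  proof (rule nn_integral_dominated_convergence[where w = "\<lambda>x. ennreal ((cmod (f x))\<^sup>2)"])
    show "(\<integral>\<^sup>+x. ennreal ((cmod (f x))\<^sup>2) \<partial>lborel) < \<infinity>" using L2_finite[OF f] by (simp add: L2sq_def)
    show "AE x in lborel. (\<lambda>n. ennreal ((cmod (f x - ball_trunc n f x))\<^sup>2)) \<longlonglongrightarrow> 0"
    proof (rule AE_I2)
      fix x :: 'a
      obtain N where "norm x \<le> real N" using real_arch_simple by blast
      then have "\<forall>\<^sub>F n in sequentially. ennreal ((cmod (f x - ball_trunc n f x))\<^sup>2) = 0"
        by (auto simp: eventually_sequentially ball_trunc_def mem_cball intro!: exI[of _ N])
      then show "(\<lambda>n. ennreal ((cmod (f x - ball_trunc n f x))\<^sup>2)) \<longlonglongrightarrow> 0"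
        by (rule tendsto_eventually)
    qed
  qed (auto simp: ball_trunc_def indicator_def intro!: ennreal_leI)
  then show ?thesis by (simp add: L2sq_def)
qed

lemma has_fourier_alt:
  "has_fourier f g \<longleftrightarrow> f \<in> L2 \<and> g \<in> L2 \<and> (\<lambda>n. L2sq (\<lambda>u. fourier (ball_trunc n f) u - g u)) \<longlonglongrightarrow> 0"
  by (simp add: has_fourier_def ball_trunc_def[abs_def])

lemma has_fourier_L2: "has_fourier f g \<Longrightarrow> f \<in> L2" "has_fourier f g \<Longrightarrow> g \<in> L2"
  by (simp_all add: has_fourier_def)

lemma has_fourier_diff:
  assumes 1: "has_fourier f g" and 2: "has_fourier f' g'"
  shows "has_fourier (\<lambda>x. f x - f' x) (\<lambda>u. g u - g' u)"
proof -
  note L = has_fourier_L2[OF 1] has_fourier_L2[OF 2]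
  have [measurable]: "f \<in> borel_measurable borel" "f' \<in> borel_measurable borel"
    "g \<in> borel_measurable borel" "g' \<in> borel_measurable borel" using L by auto
  have t: "ball_trunc n (\<lambda>x. f x - f' x) = (\<lambda>x. ball_trunc n f x - ball_trunc n f' x)" for n
    by (simp add: ball_trunc_def fun_eq_iff right_diff_distrib)
  have "(\<lambda>n. L2sq (\<lambda>u. fourier (ball_trunc n (\<lambda>x. f x - f' x)) u - (g u - g' u))) \<longlonglongrightarrow> 0"
  proof (rule tendsto_sandwich[OF _ _ tendsto_const])
    show "\<forall>\<^sub>F n in sequentially. L2sq (\<lambda>u. fourier (ball_trunc n (\<lambda>x. f x - f' x)) u - (g u - g' u))
      \<le> 2 * L2sq (\<lambda>u. fourier (ball_trunc n f) u - g u) + 2 * L2sq (\<lambda>u. fourier (ball_trunc n f') u - g' u)"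
    proof (intro always_eventually allI)
      fix n
      have "L2sq (\<lambda>u. fourier (ball_trunc n (\<lambda>x. f x - f' x)) u - (g u - g' u))
          = L2sq (\<lambda>u. (fourier (ball_trunc n f) u - g u) - (fourier (ball_trunc n f') u - g' u))"
        by (simp add: t fourier_diff ball_trunc_integrable L algebra_simps)
      then show "L2sq (\<lambda>u. fourier (ball_trunc n (\<lambda>x. f x - f' x)) u - (g u - g' u))
        \<le> 2 * L2sq (\<lambda>u. fourier (ball_trunc n f) u - g u) + 2 * L2sq (\<lambda>u. fourier (ball_trunc n f') u - g' u)"
        by (simp only:) (rule L2sq_diff; measurable)
    qed
    have "(\<lambda>n. 2 * L2sq (\<lambda>u. fourier (ball_trunc n f) u - g u) + 2 * L2sq (\<lambda>u. fourier (ball_trunc n f') u - g' u))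
      \<longlonglongrightarrow> 2 * 0 + 2 * 0"
      using 1 2 unfolding has_fourier_alt by (intro tendsto_add ennreal_tendsto_cmult) auto
    then show "(\<lambda>n. 2 * L2sq (\<lambda>u. fourier (ball_trunc n f) u - g u) + 2 * L2sq (\<lambda>u. fourier (ball_trunc n f') u - g' u))
      \<longlonglongrightarrow> 0" by simp
  qed simp
  then show ?thesis using L by (auto simp: has_fourier_alt)
qed

text \<open>The integrable truncations satisfy \<open>L2sq_le_fourier\<close>; the limit is taken
  afterwards. The factor 4 comes from splitting squares twice.\<close>

lemma has_fourier_L2sq_le:
  fixes f :: "real \<times> real \<Rightarrow> complex"
  assumes fg: "has_fourier f g"
  shows "L2sq f \<le> 4 * L2sq g"
proof -
  note L = has_fourier_L2[OF fg]
  have [measurable]: "f \<in> borel_measurable borel" "g \<in> borel_measurable borel" using L by auto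
  have "L2sq f \<le> 2 * L2sq (\<lambda>x. f x - ball_trunc n f x) + (4 * L2sq (\<lambda>u. fourier (ball_trunc n f) u - g u) + 4 * L2sq g)" for n
  proof -
    have "L2sq (ball_trunc n f) \<le> L2sq (fourier (ball_trunc n f))"
      by (rule L2sq_le_fourier[OF ball_trunc_integrable[OF L(1)] ball_trunc_L2[OF L(1)]])
    also have "\<dots> \<le> 2 * L2sq (\<lambda>u. fourier (ball_trunc n f) u - g u) + 2 * L2sq g"
      using L2sq_add[of "\<lambda>u. fourier (ball_trunc n f) u - g u" g] by simp
    finally have "2 * L2sq (ball_trunc n f) \<le> 2 * (2 * L2sq (\<lambda>u. fourier (ball_trunc n f) u - g u) + 2 * L2sq g)"
      by (rule mult_left_mono) simp
    moreover have "L2sq f \<le> 2 * L2sq (\<lambda>x. f x - ball_trunc n f x) + 2 * L2sq (ball_trunc n f)"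
      using L2sq_add[of "\<lambda>x. f x - ball_trunc n f x" "ball_trunc n f"] by simp
    ultimately show ?thesis
      by (simp add: distrib_left flip: mult.assoc) (meson add_left_mono order_trans)
  qed
  moreover have "(\<lambda>n. 2 * L2sq (\<lambda>x. f x - ball_trunc n f x) + (4 * L2sq (\<lambda>u. fourier (ball_trunc n f) u - g u) + 4 * L2sq g))
      \<longlonglongrightarrow> 2 * 0 + (4 * 0 + 4 * L2sq g)"
    using fg ball_trunc_tendsto[OF L(1)] unfolding has_fourier_alt
    by (intro tendsto_add ennreal_tendsto_cmult tendsto_const) auto
  ultimately have "L2sq f \<le> 2 * 0 + (4 * 0 + 4 * L2sq g)"
    by (intro LIMSEQ_le_const) auto
  then show ?thesis by simp
qed

lemma has_fourier_unique:
  fixes f f' :: "real \<times> real \<Rightarrow> complex"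
  assumes "has_fourier f g" "has_fourier f' g"
  shows "AE x in lborel. f x = f' x"
proof -
  have "L2sq (\<lambda>x. f x - f' x) \<le> 4 * L2sq (\<lambda>u. g u - g u)"
    by (rule has_fourier_L2sq_le[OF has_fourier_diff[OF assms]])
  then have "L2sq (\<lambda>x. f x - f' x) = 0" by (simp add: L2sq_def)
  then have "AE x in lborel. f x - f' x = 0"
    using assms[THEN has_fourier_L2(1)] by (subst (asm) L2sq_eq_0_iff) auto
  then show ?thesis by eventually_elim simp
qed

lemma has_fourier_image_unique:
  assumes 1: "has_fourier f g" and 2: "has_fourier f h"
  shows "AE u in lborel. g u = h u"
proof -
  have [measurable]: "f \<in> borel_measurable borel" "g \<in> borel_measurable borel" "h \<in> borel_measurable borel"
    using 1 2 by (auto dest: has_fourier_L2)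
  have "L2sq (\<lambda>u. g u - h u) \<le> 2 * L2sq (\<lambda>u. fourier (ball_trunc n f) u - h u) + 2 * L2sq (\<lambda>u. fourier (ball_trunc n f) u - g u)" for n
    using L2sq_diff[of "\<lambda>u. fourier (ball_trunc n f) u - h u" "\<lambda>u. fourier (ball_trunc n f) u - g u"] by simp
  moreover have "(\<lambda>n. 2 * L2sq (\<lambda>u. fourier (ball_trunc n f) u - h u) + 2 * L2sq (\<lambda>u. fourier (ball_trunc n f) u - g u)) \<longlonglongrightarrow> 2 * 0 + 2 * 0"
    using 1 2 unfolding has_fourier_alt by (intro tendsto_add ennreal_tendsto_cmult) auto
  ultimately have "L2sq (\<lambda>u. g u - h u) \<le> 2 * 0 + 2 * 0"
    by (intro LIMSEQ_le_const) auto
  then have "L2sq (\<lambda>u. g u - h u) = 0" by simp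
  then have "AE u in lborel. g u - h u = 0" by (subst (asm) L2sq_eq_0_iff) auto
  then show ?thesis by eventually_elim simp
qed

text \<open>Truncations beyond R agree with f almost everywhere, so the defining sequence is
  eventually 0.\<close>

lemma has_fourier_bounded_support:
  assumes f: "f \<in> L2" and supp: "AE x in lborel. R < norm x \<longrightarrow> f x = 0" and g: "fourier f \<in> L2"
  shows "has_fourier f (fourier f)"
proof -
  have [measurable]: "f \<in> borel_measurable borel" using f by auto
  obtain N where N: "R \<le> real N" using real_arch_simple by blast
  have "fourier (ball_trunc n f) u = fourier f u" if "N \<le> n" for n u
  proof (rule fourier_cong_AE)
    show "AE x in lborel. ball_trunc n f x = f x"
      using supp by eventually_elim (use N that in \<open>auto simp: ball_trunc_def indicator_def\<close>)
  qed auto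
  then have "L2sq (\<lambda>u. fourier (ball_trunc n f) u - fourier f u) = 0" if "N \<le> n" for n
    using that by (simp add: L2sq_def)
  then have "(\<lambda>n. L2sq (\<lambda>u. fourier (ball_trunc n f) u - fourier f u)) \<longlonglongrightarrow> 0"
    by (intro tendsto_eventually) (auto simp: eventually_sequentially)
  then show ?thesis using f g by (simp add: has_fourier_alt)
qed

subsection \<open>Box splines as iterated averages\<close>

text \<open>Convolution with the uniform measure on the segment from 0 to \<xi>, which adds the
  column \<xi> to a box spline.\<close>

definition avg :: "real \<times> real \<Rightarrow> (real \<times> real \<Rightarrow> complex) \<Rightarrow> real \<times> real \<Rightarrow> complex" where
  "avg \<xi> f x = (\<integral>t. indicator {0..1::real} t *\<^sub>R f (x - t *\<^sub>R \<xi>) \<partial>lborel)"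

lemma avg_measurable [measurable]:
  "f \<in> borel_measurable borel \<Longrightarrow> avg \<xi> f \<in> borel_measurable borel"
proof -
  assume [measurable]: "f \<in> borel_measurable borel"
  show ?thesis
    unfolding avg_def[abs_def] by (rule lborel.borel_measurable_lebesgue_integral) measurable
qed

lemma integrable_unit_interval:
  fixes g :: "real \<Rightarrow> complex"
  assumes [measurable]: "g \<in> borel_measurable borel" and B: "\<And>t. cmod (g t) \<le> B"
  shows "integrable lborel (\<lambda>t. indicator {0..1::real} t *\<^sub>R g t)"
proof (rule Bochner_Integration.integrable_bound[of _ "\<lambda>t. indicator {0..1::real} t * B"])
  show "integrable lborel (\<lambda>t. indicator {0..1::real} t * B)"
    by (intro integrable_mult_left integrable_real_indicator) auto
  show "AE t in lborel. cmod (indicator {0..1} t *\<^sub>R g t) \<le> norm (indicator {0..1::real} t * B)"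
    using B by (intro AE_I2) (auto simp: indicator_def intro: order_trans[OF _ abs_ge_self])
qed simp

lemma avg_bound:
  assumes [measurable]: "f \<in> borel_measurable borel" and f: "\<And>x. cmod (f x) \<le> 1"
  shows "cmod (avg \<xi> f x) \<le> 1"
proof -
  have "cmod (avg \<xi> f x) \<le> (\<integral>t. cmod (indicator {0..1::real} t *\<^sub>R f (x - t *\<^sub>R \<xi>)) \<partial>lborel)"
    unfolding avg_def by (rule integral_norm_bound)
  also have "\<dots> \<le> (\<integral>t. indicator {0..1::real} t \<partial>lborel)"
  proof (rule integral_mono)
    show "integrable lborel (\<lambda>t. cmod (indicator {0..1::real} t *\<^sub>R f (x - t *\<^sub>R \<xi>)))"
      by (intro integrable_norm integrable_unit_interval[OF _ f]) measurable
    show "integrable lborel (indicator {0..1::real} :: real \<Rightarrow> real)"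
      by (rule integrable_real_indicator) auto
    show "cmod (indicator {0..1} t *\<^sub>R f (x - t *\<^sub>R \<xi>)) \<le> indicator {0..1::real} t" for t
      using f by (auto simp: indicator_def)
  qed
  finally show ?thesis by simp
qed

lemma avg_nonzero: "avg \<xi> f x \<noteq> 0 \<Longrightarrow> \<exists>t\<in>{0..1}. f (x - t *\<^sub>R \<xi>) \<noteq> 0"
proof (rule ccontr)
  assume nz: "avg \<xi> f x \<noteq> 0" and "\<not> (\<exists>t\<in>{0..1}. f (x - t *\<^sub>R \<xi>) \<noteq> 0)"
  then have "indicator {0..1::real} t *\<^sub>R f (x - t *\<^sub>R \<xi>) = 0" for t by (auto simp: indicator_def)
  then have "avg \<xi> f x = 0" unfolding avg_def by (simp only: integral_zero)
  with nz show False by simp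
qed

lemma integral_cis_unit_interval:
  "(\<integral>t. indicator {0..1::real} t *\<^sub>R cis (- (t * s)) \<partial>lborel) = box_factor s"
proof (cases "s = 0")
  case False
  define F where "F t = \<i> / of_real s * cis (- (t * s))" for t
  have "(F has_vector_derivative cis (- (t * s))) (at t within {0..1})" for t
  proof -
    have cis_eq: "cis (- (t * s)) = exp (- (\<i> * of_real s) * of_real t)" for t
      by (simp add: cis_conv_exp mult_ac)
    have "((\<lambda>t. \<i> / of_real s * exp (- (\<i> * of_real s) * of_real t)) has_vector_derivative
        exp (- (\<i> * of_real s) * of_real t)) (at t within {0..1})"
      by (rule has_vector_derivative_real_field[where f = "\<lambda>z. \<i> / of_real s * exp (- (\<i> * of_real s) * z)"])
         (use False in \<open>auto intro!: derivative_eq_intros\<close>)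
    then show ?thesis by (simp only: F_def[abs_def] cis_eq)
  qed
  then have "(\<integral>t. indicator {0..1::real} t *\<^sub>R cis (- (t * s)) \<partial>lborel) = F 1 - F 0"
    by (intro integral_FTC_Icc) (auto intro!: continuous_intros)
  also have "\<dots> = box_factor s"
    using False by (simp add: F_def box_factor_def field_simps)
  finally show ?thesis .
qed (simp add: box_factor_def)

lemma avg_fourier:
  assumes f: "integrable lborel f"
  shows "fourier (avg \<xi> f) u = box_factor (\<xi> \<bullet> u) * fourier f u"
proof -
  have [measurable]: "f \<in> borel_measurable borel" using f by simp
  let ?g = "\<lambda>(t::real, x). indicator {0..1::real} t *\<^sub>R (f (x - t *\<^sub>R \<xi>) * cis (- (u \<bullet> x)))"
  have shift: "(\<integral>x. f (x - t *\<^sub>R \<xi>) * cis (- (u \<bullet> x)) \<partial>lborel) = cis (- (t * (\<xi> \<bullet> u))) * fourier f u" for t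
    using fourier_translate[of f "t *\<^sub>R \<xi>" u] by (simp add: fourier_def inner_commute)
  have tr: "integrable lborel (\<lambda>x. f (x - t *\<^sub>R \<xi>))" for t
    using integrable_translate[OF f, of "- (t *\<^sub>R \<xi>)"] by simp
  have int: "integrable (lborel \<Otimes>\<^sub>M lborel) ?g"
  proof (rule lborel_pair.Fubini_integrable)
    have "(\<integral>x. norm (?g (t, x)) \<partial>lborel) = indicator {0..1} t * (\<integral>x. cmod (f x) \<partial>lborel)" for t
      using integral_translate[of "\<lambda>x. cmod (f x)" "- (t *\<^sub>R \<xi>)"] by simp
    then show "integrable lborel (\<lambda>t. \<integral>x. norm (?g (t, x)) \<partial>lborel)"
      by (simp only:) (intro integrable_mult_left integrable_real_indicator; simp)
    show "AE t in lborel. integrable lborel (\<lambda>x. ?g (t, x))"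
      by (intro AE_I2) (auto intro!: integrable_scaleR_right integrable_mult_cis tr)
  qed measurable
  have "fourier (avg \<xi> f) u = (\<integral>x. \<integral>t. ?g (t, x) \<partial>lborel \<partial>lborel)"
    unfolding fourier_def avg_def by (simp flip: integral_mult_left_zero)
  also have "\<dots> = (\<integral>t. \<integral>x. ?g (t, x) \<partial>lborel \<partial>lborel)"
    using lborel_pair.Fubini_integral[OF int] by simp
  also have "\<dots> = (\<integral>t. indicator {0..1} t *\<^sub>R cis (- (t * (\<xi> \<bullet> u))) * fourier f u \<partial>lborel)"
    by (simp add: shift)
  also have "\<dots> = box_factor (\<xi> \<bullet> u) * fourier f u"
    using integral_cis_unit_interval[of "\<xi> \<bullet> u"] by (simp only: integral_mult_left_zero)
  finally show ?thesis .
qed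

text \<open>A finite window of shifts. For arguments up to 15 it contains the shift of the unit
  square that is hit, so partitions of unity are finite sums; it also contains
  \<open>hex3\<close>.\<close>

definition int_square :: "(int \<times> int) set" where
  "int_square = {-20..20} \<times> {-20..20}"

definition unity_on :: "real \<Rightarrow> (real \<times> real \<Rightarrow> complex) \<Rightarrow> bool" where
  "unity_on R f \<longleftrightarrow> (\<forall>x. \<bar>fst x\<bar> \<le> R \<and> \<bar>snd x\<bar> \<le> R \<longrightarrow> (\<Sum>k\<in>int_square. f (x - lat k)) = 1)"

text \<open>Averaging preserves the identity but evaluates it at arguments moved by up to 1 in each
  coordinate, hence R - 1.\<close>

lemma avg_unity:
  assumes [measurable]: "f \<in> borel_measurable borel" and f: "\<And>x. cmod (f x) \<le> 1"
    and u: "unity_on R f" and \<xi>: "\<bar>fst \<xi>\<bar> \<le> 1" "\<bar>snd \<xi>\<bar> \<le> 1"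
  shows "unity_on (R - 1) (avg \<xi> f)"
  unfolding unity_on_def
proof (intro allI impI)
  fix x :: "real \<times> real" assume x: "\<bar>fst x\<bar> \<le> R - 1 \<and> \<bar>snd x\<bar> \<le> R - 1"
  have "(\<Sum>k\<in>int_square. avg \<xi> f (x - lat k))
      = (\<integral>t. (\<Sum>k\<in>int_square. indicator {0..1} t *\<^sub>R f (x - lat k - t *\<^sub>R \<xi>)) \<partial>lborel)"
    unfolding avg_def
    by (rule Bochner_Integration.integral_sum[symmetric]) (rule integrable_unit_interval[OF _ f], measurable)
  also have "\<dots> = (\<integral>t. indicator {0..1::real} t *\<^sub>R (1 :: complex) \<partial>lborel)"
  proof (rule Bochner_Integration.integral_cong[OF refl])
    fix t :: real
    show "(\<Sum>k\<in>int_square. indicator {0..1} t *\<^sub>R f (x - lat k - t *\<^sub>R \<xi>)) = indicator {0..1::real} t *\<^sub>R (1 :: complex)"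
    proof (cases "t \<in> {0..1}")
      case True
      have "\<bar>t * fst \<xi>\<bar> \<le> 1" "\<bar>t * snd \<xi>\<bar> \<le> 1"
        using True \<xi> by (auto simp: abs_mult intro!: mult_le_one)
      then have "\<bar>fst (x - t *\<^sub>R \<xi>)\<bar> \<le> R \<and> \<bar>snd (x - t *\<^sub>R \<xi>)\<bar> \<le> R"
        using x by auto
      then have "(\<Sum>k\<in>int_square. f (x - t *\<^sub>R \<xi> - lat k)) = 1" using u unfolding unity_on_def by blast
      moreover have "x - lat k - t *\<^sub>R \<xi> = x - t *\<^sub>R \<xi> - lat k" for k by (simp add: algebra_simps)
      ultimately have "(\<Sum>k\<in>int_square. f (x - lat k - t *\<^sub>R \<xi>)) = 1" by (simp only:)
      then show ?thesis using True by simp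
    qed simp
  qed
  finally show "(\<Sum>k\<in>int_square. avg \<xi> f (x - lat k)) = 1" by simp
qed

text \<open>Half-open, so that its integer translates tile the plane exactly. It is the box spline
  of the columns (1, 0) and (0, 1).\<close>

definition unit_square :: "real \<times> real \<Rightarrow> complex" where
  "unit_square x = indicator {0..<1} (fst x) * indicator {0..<1} (snd x)"

lemma fst_snd_borel [measurable]:
  "fst \<in> borel_measurable (borel :: ('a::euclidean_space \<times> 'b::euclidean_space) measure)"
  "snd \<in> borel_measurable (borel :: ('a::euclidean_space \<times> 'b::euclidean_space) measure)"
  by (auto intro!: borel_measurable_continuous_onI continuous_intros)

lemma unit_square_measurable [measurable]: "unit_square \<in> borel_measurable borel"
  unfolding unit_square_def[abs_def] by measurable

lemma unit_square_unity: "unity_on 15 unit_square"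
  unfolding unity_on_def
proof (intro allI impI)
  fix x :: "real \<times> real" assume x: "\<bar>fst x\<bar> \<le> 15 \<and> \<bar>snd x\<bar> \<le> 15"
  have one: "(\<Sum>i\<in>{-20..20::int}. indicator {0..<1} (t - of_int i) :: complex) = 1" if "\<bar>t\<bar> \<le> 15" for t :: real
  proof -
    have "indicator {0..<1} (t - of_int i) = (if i = \<lfloor>t\<rfloor> then 1 else 0 :: complex)" for i
      by (simp add: indicator_def) linarith
    moreover have "\<lfloor>t\<rfloor> \<in> {-20..20}" using that by (auto simp: le_floor_iff floor_le_iff)
    ultimately show ?thesis by simp
  qed
  have "(\<Sum>k\<in>int_square. unit_square (x - lat k))
      = (\<Sum>i\<in>{-20..20}. \<Sum>j\<in>{-20..20}. indicator {0..<1} (fst x - of_int i) * indicator {0..<1} (snd x - of_int j))"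
    unfolding int_square_def sum.cartesian_product by (simp add: unit_square_def lat_def case_prod_unfold)
  also have "\<dots> = (\<Sum>i\<in>{-20..20::int}. indicator {0..<1} (fst x - of_int i)) * (\<Sum>j\<in>{-20..20::int}. indicator {0..<1} (snd x - of_int j))"
    by (simp only: sum_product)
  also have "\<dots> = 1" using one x by simp
  finally show "(\<Sum>k\<in>int_square. unit_square (x - lat k)) = 1" .
qed

lemma unit_square_fourier: "fourier unit_square u = box_factor (fst u) * box_factor (snd u)"
proof -
  have int: "integrable lborel (\<lambda>t::real. indicator {0..<1} t * cis (- (t * s)))" for s
  proof (rule integrable_mult_cis)
    have "integrable lborel (indicator {0..<1::real} :: real \<Rightarrow> real)"
      by (rule integrable_real_indicator) auto
    then have "integrable lborel (\<lambda>t. complex_of_real (indicator {0..<1::real} t))"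
      by (rule integrable_of_real)
    moreover have "(\<lambda>t. complex_of_real (indicator {0..<1::real} t)) = indicator {0..<1}"
      by (auto simp: indicator_def fun_eq_iff)
    ultimately show "integrable lborel (indicator {0..<1} :: real \<Rightarrow> complex)" by simp
  qed simp
  have val: "(\<integral>t. indicator {0..<1} t * cis (- (t * s)) \<partial>lborel) = box_factor s" for s
  proof -
    have "(\<integral>t. indicator {0..<1} t * cis (- (t * s)) \<partial>lborel) = (\<integral>t. indicator {0..1::real} t *\<^sub>R cis (- (t * s)) \<partial>lborel)"
      by (rule integral_cong_AE) (use AE_lborel_singleton[of "1::real"] in \<open>auto simp: indicator_def elim!: eventually_mono\<close>)
    then show ?thesis by (simp add: integral_cis_unit_interval)
  qed
  have "fourier unit_square u = (\<integral>x. (indicator {0..<1} (fst x) * cis (- (fst x * fst u))) *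
      (indicator {0..<1} (snd x) * cis (- (snd x * snd u))) \<partial>lborel)"
    unfolding fourier_def unit_square_def
    by (simp add: inner_prod_def cis_minus_add mult_ac del: minus_add_distrib)
  also have "\<dots> = box_factor (fst u) * box_factor (snd u)"
    by (subst integral_lborel_times[OF int int]) (simp add: val)
  finally show ?thesis .
qed

text \<open>The unit square accounts for one column (1, 0) and one column (0, 1); the four averages
  supply the rest of \<open>Xi\<close>.\<close>

definition box_function :: "real \<times> real \<Rightarrow> complex" where
  "box_function = avg (1, 0) (avg (0, 1) (avg (1, 1) (avg (1, 1) unit_square)))"

text \<open>The zonotope of \<open>Xi\<close>: each coordinate of a combination of the columns with
  weights in [0, 1] collects four weights, and in the difference the two columns (1, 1)
  cancel.\<close>

definition in_hexagon :: "real \<times> real \<Rightarrow> bool" where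
  "in_hexagon x \<longleftrightarrow> 0 \<le> fst x \<and> fst x \<le> 4 \<and> 0 \<le> snd x \<and> snd x \<le> 4 \<and> \<bar>fst x - snd x\<bar> \<le> 2"

lemma norm_bounds_prod: "\<bar>fst x\<bar> \<le> a \<Longrightarrow> \<bar>snd x\<bar> \<le> a \<Longrightarrow> norm x \<le> 2 * a" for x :: "real \<times> real"
  using norm_Pair_le[of "fst x" "snd x"] by simp

lemma zero_outside_ball:
  fixes x :: "real \<times> real"
  assumes "\<And>x. f x \<noteq> 0 \<Longrightarrow> \<bar>fst x\<bar> \<le> a \<and> \<bar>snd x\<bar> \<le> a" "2 * a < norm x"
  shows "f x = 0"
  using assms(1)[of x] assms(2) norm_bounds_prod[of x a] by linarith

text \<open>All properties are carried through the four averages one at a time: the region of unity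
  shrinks from 15 to 11 while the support grows from the square to the hexagon.\<close>

lemma box_function_props:
  shows "box_function \<in> borel_measurable borel"
    and "cmod (box_function x) \<le> 1"
    and "box_function x \<noteq> 0 \<Longrightarrow> in_hexagon x"
    and "unity_on 11 box_function"
    and "fourier box_function u = (\<Prod>\<xi>\<leftarrow>Xi. box_factor (lat \<xi> \<bullet> u))"
proof -
  define f1 where "f1 = avg (1, 1) unit_square"
  define f2 where "f2 = avg (1, 1) f1"
  define f3 where "f3 = avg (0, 1) f2"
  have bf: "box_function = avg (1, 0) f3"
    by (simp add: box_function_def f3_def f2_def f1_def)
  have m [measurable]: "f1 \<in> borel_measurable borel" "f2 \<in> borel_measurable borel" "f3 \<in> borel_measurable borel"
    by (simp_all add: f1_def f2_def f3_def)
  have b0: "cmod (unit_square x) \<le> 1" for x by (simp add: unit_square_def indicator_def)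
  have b1: "cmod (f1 x) \<le> 1" for x unfolding f1_def by (rule avg_bound[OF unit_square_measurable b0])
  have b2: "cmod (f2 x) \<le> 1" for x unfolding f2_def by (rule avg_bound[OF m(1) b1])
  have b3: "cmod (f3 x) \<le> 1" for x unfolding f3_def by (rule avg_bound[OF m(2) b2])
  show "box_function \<in> borel_measurable borel" unfolding bf by measurable
  show "cmod (box_function x) \<le> 1" unfolding bf by (rule avg_bound[OF m(3) b3])
  have s0: "0 \<le> fst x \<and> fst x \<le> 1 \<and> 0 \<le> snd x \<and> snd x \<le> 1 \<and> \<bar>fst x - snd x\<bar> \<le> 1" if "unit_square x \<noteq> 0" for x
    using that by (auto simp: unit_square_def indicator_def split: if_splits)
  have s1: "0 \<le> fst x \<and> fst x \<le> 2 \<and> 0 \<le> snd x \<and> snd x \<le> 2 \<and> \<bar>fst x - snd x\<bar> \<le> 1" if "f1 x \<noteq> 0" for x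
    using avg_nonzero[OF that[unfolded f1_def]] s0 by fastforce
  have s2: "0 \<le> fst x \<and> fst x \<le> 3 \<and> 0 \<le> snd x \<and> snd x \<le> 3 \<and> \<bar>fst x - snd x\<bar> \<le> 1" if "f2 x \<noteq> 0" for x
    using avg_nonzero[OF that[unfolded f2_def]] s1 by fastforce
  \<comment> \<open>The bounds are asymmetric here: an average along (0, 1) lowers the difference of
    the coordinates, and only the last one along (1, 0) restores the symmetry.\<close>
  have s3: "0 \<le> fst x \<and> fst x \<le> 3 \<and> 0 \<le> snd x \<and> snd x \<le> 4 \<and> fst x - snd x \<le> 1 \<and> -2 \<le> fst x - snd x" if nz: "f3 x \<noteq> 0" for x
  proof -
    obtain t where t: "0 \<le> t" "t \<le> 1" "f2 (x - t *\<^sub>R (0, 1)) \<noteq> 0"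
      using avg_nonzero[OF nz[unfolded f3_def]] by auto
    from s2[OF t(3)] t(1,2) show ?thesis by (auto simp: abs_le_iff)
  qed
  show "in_hexagon x" if nz: "box_function x \<noteq> 0" for x
  proof -
    obtain t where t: "0 \<le> t" "t \<le> 1" "f3 (x - t *\<^sub>R (1, 0)) \<noteq> 0"
      using avg_nonzero[OF nz[unfolded bf]] by auto
    from s3[OF t(3)] t(1,2) show ?thesis by (auto simp: in_hexagon_def abs_le_iff)
  qed
  have u1: "unity_on 14 f1" using avg_unity[OF unit_square_measurable b0 unit_square_unity, of "(1, 1)"] by (simp add: f1_def)
  have u2: "unity_on 13 f2" using avg_unity[OF m(1) b1 u1, of "(1, 1)"] by (simp add: f2_def)
  have u3: "unity_on 12 f3" using avg_unity[OF m(2) b2 u2, of "(0, 1)"] by (simp add: f3_def)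
  show "unity_on 11 box_function" using avg_unity[OF m(3) b3 u3, of "(1, 0)"] by (simp add: bf)
  have i0: "integrable lborel unit_square"
    by (rule integrable_bounded_support[OF unit_square_measurable _ b0, of "2 * 1"], rule zero_outside_ball[where a = 1]) (use s0 in force)+
  have i1: "integrable lborel f1"
    by (rule integrable_bounded_support[OF m(1) _ b1, of "2 * 2"], rule zero_outside_ball[where a = 2]) (use s1 in force)+
  have i2: "integrable lborel f2"
    by (rule integrable_bounded_support[OF m(2) _ b2, of "2 * 3"], rule zero_outside_ball[where a = 3]) (use s2 in force)+
  have i3: "integrable lborel f3"
    by (rule integrable_bounded_support[OF m(3) _ b3, of "2 * 4"], rule zero_outside_ball[where a = 4]) (use s3 in force)+
  show "fourier box_function u = (\<Prod>\<xi>\<leftarrow>Xi. box_factor (lat \<xi> \<bullet> u))"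
    using avg_fourier[OF i0, of "(1, 1)" u, folded f1_def] avg_fourier[OF i1, of "(1, 1)" u, folded f2_def]
      avg_fourier[OF i2, of "(0, 1)" u, folded f3_def] avg_fourier[OF i3, of "(1, 0)" u, folded bf]
    by (simp add: unit_square_fourier Xi_def lat_def inner_prod_def mult_ac)
qed

lemma is_box_spline_AE:
  assumes "is_box_spline Xi \<phi>"
  shows "AE x in lborel. \<phi> x = box_function x"
proof (rule fourier_unique_AE)
  show "integrable lborel \<phi>" "\<And>u. fourier \<phi> u = fourier box_function u"
    using assms by (auto simp: is_box_spline_def box_function_props(5))
  have "box_function x = 0" if "8 < norm x" for x
  proof (rule ccontr)
    assume "box_function x \<noteq> 0"
    then have "in_hexagon x" by (rule box_function_props(3))
    then have "norm x \<le> 2 * 4" by (intro norm_bounds_prod) (auto simp: in_hexagon_def)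
    with that show False by simp
  qed
  then show "integrable lborel box_function"
    by (rule integrable_bounded_support[OF box_function_props(1) _ box_function_props(2)])
qed

section \<open>Laurent polynomials as periodic functions of the frequency\<close>

lemma expm_zpow: "zpow (expm u) k = cis (- (u \<bullet> lat k))"
  by (simp add: zpow_def expm_def lat_def inner_prod_def cis_power_int cis_mult mult.commute)

lemma expm_torus [simp]: "expm u \<in> torus"
  by (simp add: expm_def torus_def)

lemma leval_expm_measurable [measurable]: "(\<lambda>u. leval p (expm u)) \<in> borel_measurable borel"
  unfolding leval_def expm_zpow by measurable

lemma leval_expm_bound: "cmod (leval p (expm u)) \<le> norm1 p"
  unfolding leval_def norm1_def by (rule order_trans[OF norm_sum]) (simp add: norm_mult cmod_zpow)

text \<open>The square partial sums that define convergence in \<open>L_l2\<close>.\<close>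

definition box_poly :: "(int \<times> int \<Rightarrow> complex) \<Rightarrow> nat \<Rightarrow> lpoly" where
  "box_poly a n = (\<Sum>k\<in>{-int n..int n} \<times> {-int n..int n}. sg k (a k))"

lemma lookup_box_poly: "lk (box_poly a n) k = (if k \<in> {-int n..int n} \<times> {-int n..int n} then a k else 0)"
  by (simp add: box_poly_def lookup_sum lookup_single when_def)

lemma leval_box_poly: "leval (box_poly a n) \<zeta> = (\<Sum>k\<in>{-int n..int n} \<times> {-int n..int n}. a k * zpow \<zeta> k)"
  by (simp add: box_poly_def leval_sum leval_single)

lemma box_poly_lookup: "\<exists>N. \<forall>n\<ge>N. box_poly (lk p) n = p"
proof -
  obtain N where N: "\<And>k. k \<in> Poly_Mapping.keys p \<Longrightarrow> max \<bar>fst k\<bar> \<bar>snd k\<bar> \<le> int N"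
  proof -
    define M where "M = Max (insert 0 ((\<lambda>k. max \<bar>fst k\<bar> \<bar>snd k\<bar>) ` Poly_Mapping.keys p))"
    have "max \<bar>fst k\<bar> \<bar>snd k\<bar> \<le> M" if "k \<in> Poly_Mapping.keys p" for k
      unfolding M_def using that by (intro Max_ge) auto
    moreover have "0 \<le> M" unfolding M_def by (intro Max_ge) auto
    ultimately show thesis by (intro that[of "nat M"]) auto
  qed
  have "box_poly (lk p) n = p" if "N \<le> n" for n
  proof (rule poly_mapping_eqI)
    fix k
    show "lk (box_poly (lk p) n) k = lk p k"
    proof (cases "k \<in> Poly_Mapping.keys p")
      case True
      then show ?thesis using N[OF True] that by (cases k) (auto simp: lookup_box_poly)
    qed (auto simp: lookup_box_poly in_keys_iff)
  qed
  then show ?thesis by blast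
qed

lemma leval_L_l2: "leval p \<in> L_l2"
proof -
  obtain N where N: "\<And>n. N \<le> n \<Longrightarrow> box_poly (lk p) n = p" using box_poly_lookup by blast
  have "(\<lambda>k. (cmod (lk p k))\<^sup>2) summable_on UNIV"
    by (rule finite_nonzero_values_imp_summable_on) (simp add: finite_lookup)
  moreover have "(\<lambda>n::nat. \<integral>\<^sup>+u\<in>{-pi..pi} \<times> {-pi..pi}. ennreal ((cmod (leval p (expm u) -
      (\<Sum>k\<in>{-int n..int n} \<times> {-int n..int n}. lk p k * zpow (expm u) k)))\<^sup>2) \<partial>lborel) \<longlonglongrightarrow> 0"
    unfolding leval_box_poly[symmetric]
    by (rule tendsto_eventually) (auto simp: eventually_sequentially N intro!: exI[of _ N])
  ultimately show ?thesis unfolding L_l2_def by (intro CollectI conjI exI[of _ "lk p"]) auto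
qed

subsection \<open>Decay of the Fourier transform of the box spline\<close>

lemma box_factor_le_1: "cmod (box_factor t) \<le> 1"
proof -
  have "cmod (box_factor t) \<le> (\<integral>s. cmod (indicator {0..1::real} s *\<^sub>R cis (- (s * t))) \<partial>lborel)"
    unfolding integral_cis_unit_interval[symmetric] by (rule integral_norm_bound)
  then show ?thesis by simp
qed

lemma box_factor_le_inverse: "t \<noteq> 0 \<Longrightarrow> cmod (box_factor t) \<le> 2 / \<bar>t\<bar>"
  using norm_triangle_ineq4[of 1 "cis (- t)"]
  by (simp add: box_factor_def norm_divide norm_mult divide_right_mono)

definition cell_weight :: "int \<Rightarrow> real" where
  "cell_weight k = 4 / (\<bar>of_int k\<bar> + 1)\<^sup>2"

text \<open>For k \<noteq> 0, |t + 2 pi k| >= pi |k| >= 2 |k| >= |k| + 1 and the decay bound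
  applies; for k = 0 the weight 4 dominates the trivial bound 1.\<close>

lemma box_factor_cell:
  assumes "\<bar>t\<bar> \<le> pi"
  shows "(cmod (box_factor (t + 2 * pi * of_int k)))\<^sup>2 \<le> cell_weight k"
proof (cases "k = 0")
  case True
  have "(cmod (box_factor t))\<^sup>2 \<le> 1" using box_factor_le_1[of t] by (simp add: power_le_one)
  then show ?thesis using True by (simp add: cell_weight_def)
next
  case False
  define K where "K = real_of_int \<bar>k\<bar>"
  have K: "1 \<le> K" using False unfolding K_def by linarith
  have "2 * pi * K \<le> \<bar>t + 2 * pi * of_int k\<bar> + \<bar>t\<bar>"
    using abs_triangle_ineq4[of "t + 2 * pi * of_int k" t] by (simp add: K_def abs_mult)
  moreover have "pi * 1 \<le> pi * K" using K by (intro mult_left_mono) auto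
  ultimately have "pi * K \<le> \<bar>t + 2 * pi * of_int k\<bar>" using assms by linarith
  moreover have "2 * K \<le> pi * K" using pi_gt3 K by (intro mult_right_mono) auto
  moreover have "K + 1 \<le> 2 * K" using K by simp
  ultimately have le: "K + 1 \<le> \<bar>t + 2 * pi * of_int k\<bar>" by linarith
  then have "cmod (box_factor (t + 2 * pi * of_int k)) \<le> 2 / \<bar>t + 2 * pi * of_int k\<bar>"
    using K by (intro box_factor_le_inverse) auto
  also have "\<dots> \<le> 2 / (K + 1)" using le K by (intro divide_left_mono) auto
  finally have "(cmod (box_factor (t + 2 * pi * of_int k)))\<^sup>2 \<le> (2 / (K + 1))\<^sup>2"
    by (intro power_mono) auto
  then show ?thesis by (simp add: cell_weight_def K_def power_divide)
qed

lemma cell_weight_pos: "0 \<le> cell_weight k"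
  by (simp add: cell_weight_def)

lemma cell_weight_summable: "(\<integral>\<^sup>+k. ennreal (cell_weight k) \<partial>count_space UNIV) < \<infinity>"
proof -
  define b where "b n = 4 * inverse ((real (Suc n))\<^sup>2)" for n
  have "summable b"
    unfolding b_def using inverse_squares_sums
    by (intro summable_mult) (simp add: sums_iff inverse_eq_divide add.commute)
  then have fin: "(\<integral>\<^sup>+n. ennreal (b n) \<partial>count_space (UNIV :: nat set)) < \<infinity>"
    unfolding nn_integral_count_space_nat by (subst suminf_ennreal2) (auto simp: b_def)
  \<comment> \<open>The integers are covered by the n and the - n; counting 0 twice only enlarges
    the bound.\<close>
  have r: "range (\<lambda>n. int n) \<union> range (\<lambda>n. - int n) = UNIV"
    by (auto intro: int_cases2)
  have le: "(\<integral>\<^sup>+k. ennreal (cell_weight k) \<partial>count_space UNIV) \<le>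
      (\<integral>\<^sup>+k. ennreal (cell_weight k) * indicator (range int) k \<partial>count_space UNIV) +
      (\<integral>\<^sup>+k. ennreal (cell_weight k) * indicator (range (\<lambda>n. - int n)) k \<partial>count_space UNIV)"
    by (subst nn_integral_add[symmetric], simp, simp, rule nn_integral_mono)
       (use r in \<open>auto simp: indicator_def set_eq_iff split: if_splits\<close>)
  have 1: "(\<integral>\<^sup>+k. ennreal (cell_weight k) * indicator (range int) k \<partial>count_space UNIV) = (\<integral>\<^sup>+n. ennreal (b n) \<partial>count_space UNIV)"
    by (subst nn_integral_count_space_indicator[symmetric], simp add: NO_MATCH_def, subst nn_integral_bij_count_space[symmetric, of int UNIV])
       (auto simp: bij_betw_def cell_weight_def b_def inverse_eq_divide add.commute)
  have 2: "(\<integral>\<^sup>+k. ennreal (cell_weight k) * indicator (range (\<lambda>n. - int n)) k \<partial>count_space UNIV) = (\<integral>\<^sup>+n. ennreal (b n) \<partial>count_space UNIV)"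
    by (subst nn_integral_count_space_indicator[symmetric], simp add: NO_MATCH_def, subst nn_integral_bij_count_space[symmetric, of "\<lambda>n. - int n" UNIV])
       (auto simp: bij_betw_def inj_def cell_weight_def b_def inverse_eq_divide add.commute)
  show ?thesis using le fin unfolding 1 2 by (auto simp: ennreal_add_less_top intro: order_le_less_trans)
qed

section \<open>Period cells and dilation of frequencies\<close>

definition cell_norm :: "(complex \<times> complex \<Rightarrow> complex) \<Rightarrow> ennreal" where
  "cell_norm F = (\<integral>\<^sup>+u\<in>{-pi..pi} \<times> {-pi..pi}. ennreal ((cmod (F (expm u)))\<^sup>2) \<partial>lborel)"

lemma expm_periodic: "expm (u + (2 * pi) *\<^sub>R lat k) = expm u"
proof -
  have "cis (- (t + 2 * pi * of_int n)) = cis (- t)" for t and n :: int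
    using cis_multiple_2pi[of "- of_int n"] by (simp add: cis_minus_add del: minus_add_distrib)
  then show ?thesis by (simp add: expm_def lat_def)
qed

lemma cell_cover: "\<exists>k. u - (2 * pi) *\<^sub>R lat k \<in> {-pi..pi} \<times> {-pi..pi}"
proof -
  have "\<exists>n::int. t - 2 * pi * of_int n \<in> {-pi..pi}" for t
  proof
    define n where "n = \<lfloor>(t + pi) / (2 * pi)\<rfloor>"
    have "of_int n \<le> (t + pi) / (2 * pi)" "(t + pi) / (2 * pi) < of_int n + 1"
      unfolding n_def by linarith+
    then have "2 * pi * of_int n \<le> t + pi" "t + pi < 2 * pi * of_int n + 2 * pi"
      by (simp_all add: field_simps)
    then show "t - 2 * pi * of_int n \<in> {-pi..pi}" by auto
  qed
  then obtain m n :: int where "fst u - 2 * pi * of_int m \<in> {-pi..pi}" "snd u - 2 * pi * of_int n \<in> {-pi..pi}"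
    by metis
  then show ?thesis by (intro exI[of _ "(m, n)"]) (cases u, auto simp: lat_def)
qed

lemma cis_double: "1 - cis (- (2 * t)) = (1 + cis (- t)) * (1 - cis (- t))"
proof -
  have "cis (- (2 * t)) = cis (- t) * cis (- t)" by (simp add: cis_mult)
  then show ?thesis by (simp add: algebra_simps)
qed

text \<open>From 1 - z^2 = (1 + z) (1 - z) with z = exp(-it); (1 + z) / 2 is the factor of H that
  belongs to one column.\<close>

lemma box_factor_double: "box_factor (2 * t) = (1 + cis (- t)) / 2 * box_factor t"
proof (cases "t = 0")
  case False
  then show ?thesis by (simp add: box_factor_def cis_double)
qed (simp add: box_factor_def)

lemma AE_not_hyperplane:
  fixes a :: "'a::euclidean_space"
  assumes "a \<noteq> 0" shows "AE x in lborel. a \<bullet> x \<noteq> b"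
proof -
  have "AE x in lebesgue. x \<notin> {x. a \<bullet> x = b}"
    using negligible_hyperplane[of a b] assms by (intro AE_not_in) (simp add: negligible_iff_null_sets)
  then show ?thesis by (simp add: AE_completion_iff)
qed

text \<open>Here \<phi> is an arbitrary integrable representative, so pointwise facts about it are
  stated almost everywhere.\<close>

locale box_spline_Xi =
  fixes \<phi> :: "real \<times> real \<Rightarrow> complex"
  assumes spline: "is_box_spline Xi \<phi>"
begin

lemma phi_measurable [measurable]: "\<phi> \<in> borel_measurable borel"
  and phi_integrable: "integrable lborel \<phi>"
  using spline by (auto simp: is_box_spline_def)

lemma fourier_phi:
  "fourier \<phi> u = (box_factor (fst u) * box_factor (snd u) * box_factor (fst u + snd u))\<^sup>2"
  using spline by (cases u) (simp add: is_box_spline_def Xi_def lat_def inner_prod_def power2_eq_square mult_ac)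

lemma phi_AE: "AE x in lborel. \<phi> x = box_function x"
  by (rule is_box_spline_AE[OF spline])

lemma phi_L2: "\<phi> \<in> L2"
proof -
  have "L2sq \<phi> = L2sq box_function" by (rule L2sq_cong_AE[OF phi_AE])
  also have "\<dots> \<le> (\<integral>\<^sup>+x. indicator (cball 0 8) x \<partial>(lborel :: (real \<times> real) measure))"
    unfolding L2sq_def
  proof (rule nn_integral_mono)
    fix x
    have "box_function x = 0" if "8 < norm x"
      using that by (intro zero_outside_ball[of box_function 4]) (auto dest!: box_function_props(3) simp: in_hexagon_def)
    then show "ennreal ((cmod (box_function x))\<^sup>2) \<le> indicator (cball 0 8) x"
      using box_function_props(2)[of x] by (auto simp: indicator_def mem_cball power_le_one)
  qed
  also have "\<dots> < \<infinity>" using emeasure_bounded_finite[of "cball (0 :: real \<times> real) 8"] by simp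
  finally show ?thesis by (simp add: L2_def)
qed

definition in_open_hexagon :: "real \<times> real \<Rightarrow> bool" where
  "in_open_hexagon x \<longleftrightarrow> 0 < fst x \<and> fst x < 4 \<and> 0 < snd x \<and> snd x < 4 \<and> \<bar>fst x - snd x\<bar> < 2"

text \<open>The six boundary lines are null sets. Strictness matters for
  \<open>autocorr_outside\<close>: when a coordinate of the shift, or their difference, is 4 in
  absolute value, two closed hexagons may still touch while the open ones are disjoint.\<close>

lemma phi_support: "AE x in lborel. \<phi> x \<noteq> 0 \<longrightarrow> in_open_hexagon x"
proof -
  have h: "AE x in lborel. (1 :: real, 0 :: real) \<bullet> x \<noteq> b" "AE x in lborel. (0 :: real, 1 :: real) \<bullet> x \<noteq> b"
    "AE x in lborel. (1 :: real, -1 :: real) \<bullet> x \<noteq> b"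
    for b :: real
    using AE_not_hyperplane[of "(1, 0) :: real \<times> real" b] AE_not_hyperplane[of "(0, 1) :: real \<times> real" b]
      AE_not_hyperplane[of "(1, -1) :: real \<times> real" b] by (simp_all add: zero_prod_def)
  show ?thesis
    using phi_AE h(1)[of 0] h(1)[of 4] h(2)[of 0] h(2)[of 4] h(3)[of 2] h(3)[of "-2"]
  proof eventually_elim
    case (elim x)
    then show ?case
      using box_function_props(3)[of x] by (auto simp: in_open_hexagon_def in_hexagon_def inner_prod_def)
  qed
qed

text \<open>The plane is cut into translates of the period cell. F is the same on each, and the
  squared transform of \<phi>, summed over the translates, is bounded by the product of two
  convergent series.\<close>

lemma cell_bound:
  "\<exists>K::real. \<forall>F. (\<lambda>u. F (expm u)) \<in> borel_measurable borel \<longrightarrow>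
    L2sq (\<lambda>u. F (expm u) * fourier \<phi> u) \<le> ennreal K * cell_norm F"
proof -
  define I where "I = (\<integral>\<^sup>+k. ennreal (cell_weight k) \<partial>count_space UNIV)"
  have I: "I < \<infinity>" unfolding I_def by (rule cell_weight_summable)
  have key: "L2sq (\<lambda>u. F (expm u) * fourier \<phi> u) \<le> (I * I) * cell_norm F"
    if [measurable]: "(\<lambda>u. F (expm u)) \<in> borel_measurable borel" for F
  proof -
    define G where "G u = ennreal ((cmod (F (expm u)))\<^sup>2)" for u
    define W where "W u = ennreal ((cmod (fourier \<phi> u))\<^sup>2)" for u
    define c where "c = {-pi..pi::real} \<times> {-pi..pi::real}"
    define s where "s k = (2 * pi) *\<^sub>R lat k" for k
    have [measurable]: "G \<in> borel_measurable borel" "W \<in> borel_measurable borel" "c \<in> sets borel"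
      unfolding G_def W_def c_def by (measurable, auto intro!: borel_closed closed_Times)
    \<comment> \<open>The squared modulus contains every box factor to the fourth power. Two powers
      of the first two factors are kept for summability; everything else is bounded by 1.\<close>
    have W_le: "W (u + s k) \<le> ennreal (cell_weight (fst k)) * ennreal (cell_weight (snd k))" if "u \<in> c" for u k
    proof -
      have b: "(cmod (box_factor t))\<^sup>2 \<le> 1" for t using box_factor_le_1[of t] by (simp add: power_le_one)
      have b': "((cmod (box_factor t))\<^sup>2)\<^sup>2 \<le> (cmod (box_factor t))\<^sup>2" for t
        unfolding power2_eq_square[of "(cmod (box_factor t))\<^sup>2"] using b[of t] by (intro mult_left_le) auto
      have "(cmod (fourier \<phi> (u + s k)))\<^sup>2 = ((cmod (box_factor (fst (u + s k))))\<^sup>2)\<^sup>2 *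
          ((cmod (box_factor (snd (u + s k))))\<^sup>2)\<^sup>2 * ((cmod (box_factor (fst (u + s k) + snd (u + s k))))\<^sup>2)\<^sup>2"
        by (simp add: fourier_phi norm_mult norm_power power_mult_distrib)
      also have "\<dots> \<le> (cmod (box_factor (fst (u + s k))))\<^sup>2 * (cmod (box_factor (snd (u + s k))))\<^sup>2 * 1"
        using b by (intro mult_mono b' power_le_one) (auto intro: box_factor_le_1)
      also have "\<dots> \<le> cell_weight (fst k) * cell_weight (snd k)"
        using that box_factor_cell[of "fst u" "fst k"] box_factor_cell[of "snd u" "snd k"]
        by (auto simp: c_def s_def lat_def mem_Times_iff cell_weight_pos intro!: mult_mono)
      finally show ?thesis
        by (simp add: W_def cell_weight_pos ennreal_leI flip: ennreal_mult)
    qed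
    have "L2sq (\<lambda>u. F (expm u) * fourier \<phi> u) = (\<integral>\<^sup>+u. G u * W u \<partial>lborel)"
      by (simp add: L2sq_def G_def W_def norm_mult power_mult_distrib ennreal_mult')
    also have "\<dots> \<le> (\<integral>\<^sup>+u. \<integral>\<^sup>+k. indicator c (u - s k) * (G u * W u) \<partial>count_space UNIV \<partial>lborel)"
    proof (rule nn_integral_mono)
      fix u :: "real \<times> real"
      obtain k where "u - (2 * pi) *\<^sub>R lat k \<in> {-pi..pi} \<times> {-pi..pi}" using cell_cover[of u] by (elim exE)
      then have "u - s k \<in> c" by (simp only: c_def s_def)
      then show "G u * W u \<le> (\<integral>\<^sup>+k. indicator c (u - s k) * (G u * W u) \<partial>count_space UNIV)"
        using nn_integral_ge_point[of k UNIV "\<lambda>k. indicator c (u - s k) * (G u * W u)"] by simp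
    qed
    also have "\<dots> = (\<integral>\<^sup>+k. \<integral>\<^sup>+u. indicator c (u - s k) * (G u * W u) \<partial>lborel \<partial>count_space UNIV)"
      by (rule nn_integral_count_space_nn_integral) (auto intro: countableI_type)
    also have "\<dots> = (\<integral>\<^sup>+k. \<integral>\<^sup>+u. indicator c u * (G u * W (u + s k)) \<partial>lborel \<partial>count_space UNIV)"
    proof (rule nn_integral_cong)
      fix k :: "int \<times> int"
      have "G (s k + u) = G u" for u using expm_periodic[of u k] by (simp add: G_def s_def add.commute)
      then show "(\<integral>\<^sup>+u. indicator c (u - s k) * (G u * W u) \<partial>lborel) = (\<integral>\<^sup>+u. indicator c u * (G u * W (u + s k)) \<partial>lborel)"
        using nn_integral_lborel_affine[of "\<lambda>u. indicator c (u - s k) * (G u * W u)" 1 "s k"]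
        by (simp add: add.commute)
    qed
    also have "\<dots> \<le> (\<integral>\<^sup>+k. \<integral>\<^sup>+u. (ennreal (cell_weight (fst k)) * ennreal (cell_weight (snd k))) * (G u * indicator c u) \<partial>lborel \<partial>count_space UNIV)"
    proof (intro nn_integral_mono)
      fix k :: "int \<times> int" and u :: "real \<times> real"
      show "indicator c u * (G u * W (u + s k)) \<le> (ennreal (cell_weight (fst k)) * ennreal (cell_weight (snd k))) * (G u * indicator c u)"
        using mult_left_mono[OF W_le[of u k], of "G u"] by (auto simp: indicator_def mult_ac)
    qed
    also have "\<dots> = (\<integral>\<^sup>+k. (ennreal (cell_weight (fst k)) * ennreal (cell_weight (snd k))) * cell_norm F \<partial>count_space UNIV)"
    proof (rule nn_integral_cong)
      fix k :: "int \<times> int"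
      have "(\<lambda>u. G u * indicator c u) \<in> borel_measurable lborel" by measurable
      from nn_integral_cmult[OF this, of "ennreal (cell_weight (fst k)) * ennreal (cell_weight (snd k))"]
      show "(\<integral>\<^sup>+u. (ennreal (cell_weight (fst k)) * ennreal (cell_weight (snd k))) * (G u * indicator c u) \<partial>lborel)
          = (ennreal (cell_weight (fst k)) * ennreal (cell_weight (snd k))) * cell_norm F"
        by (simp only: cell_norm_def G_def c_def)
    qed
    also have "\<dots> = (\<integral>\<^sup>+k. ennreal (cell_weight (fst k)) * ennreal (cell_weight (snd k)) \<partial>count_space UNIV) * cell_norm F"
      by (rule nn_integral_multc) simp
    also have "(\<integral>\<^sup>+k. ennreal (cell_weight (fst k)) * ennreal (cell_weight (snd k)) \<partial>count_space UNIV) = I * I"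
      unfolding nn_integral_fst_count_space[symmetric] by (simp add: nn_integral_cmult nn_integral_multc I_def)
    finally show ?thesis .
  qed
  define K where "K = enn2real (I * I) + 1"
  have "I * I < top" using I by (simp add: ennreal_mult_less_top)
  then have "I * I \<le> ennreal K" by (simp add: K_def ennreal_plus[symmetric] del: ennreal_plus) (metis ennreal_enn2real ennreal_leI enn2real_nonneg le_add_same_cancel1 zero_le_one)
  then have "(I * I) * cell_norm F \<le> ennreal K * cell_norm F" for F by (intro mult_right_mono) auto
  then show ?thesis using key by (blast intro: order_trans)
qed

lemma cell_norm_leval: "cell_norm (leval p) < \<infinity>"
proof -
  have "cell_norm (leval p) \<le> (\<integral>\<^sup>+u. ennreal ((norm1 p)\<^sup>2) * indicator ({-pi..pi} \<times> {-pi..pi}) u \<partial>(lborel :: (real \<times> real) measure))"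
    unfolding cell_norm_def
    by (intro nn_integral_mono mult_right_mono ennreal_leI power_mono leval_expm_bound) auto
  also have "\<dots> = ennreal ((norm1 p)\<^sup>2) * emeasure lborel ({-pi..pi} \<times> {-pi..pi} :: (real \<times> real) set)"
    by (intro nn_integral_cmult_indicator) (auto intro!: borel_closed closed_Times)
  also have "\<dots> < \<infinity>"
    using emeasure_bounded_finite[OF bounded_Times[OF bounded_closed_interval bounded_closed_interval], of "-pi" pi "-pi" pi]
    by (auto simp: ennreal_mult_less_top)
  finally show ?thesis .
qed

section \<open>Finite combinations of integer translates\<close>

definition syn :: "lpoly \<Rightarrow> real \<times> real \<Rightarrow> complex" where
  "syn p x = (\<Sum>k\<in>Poly_Mapping.keys p. lk p k * \<phi> (x - lat k))"

lemma syn_superset: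
  "finite S \<Longrightarrow> Poly_Mapping.keys p \<subseteq> S \<Longrightarrow> syn p x = (\<Sum>k\<in>S. lk p k * \<phi> (x - lat k))"
  unfolding syn_def by (rule sum.mono_neutral_left) (auto simp: in_keys_iff)

lemma syn_add: "syn (p + q) x = syn p x + syn q x"
proof -
  let ?S = "Poly_Mapping.keys p \<union> Poly_Mapping.keys q"
  have "syn (p + q) x = (\<Sum>k\<in>?S. lk (p + q) k * \<phi> (x - lat k))"
    using Poly_Mapping.keys_add[of p q] by (intro syn_superset) auto
  then show ?thesis
    by (simp add: syn_superset[of ?S p] syn_superset[of ?S q] lookup_add sum.distrib distrib_right)
qed

lemma syn_0 [simp]: "syn 0 x = 0"
  by (simp add: syn_def)

lemma syn_diff: "syn (p - q) x = syn p x - syn q x"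
  using syn_add[of "p - q" q x] by simp

lemma syn_single: "syn (sg k c) x = c * \<phi> (x - lat k)"
  by (simp add: syn_def)

lemma syn_sum: "syn (sum f S) x = (\<Sum>i\<in>S. syn (f i) x)"
  by (induction S rule: infinite_finite_induct) (auto simp: syn_add)

lemma lat_add: "lat (k + l) = lat k + lat l"
  by (simp add: lat_def)

lemma syn_single_times: "syn (sg k c * p) x = c * syn p (x - lat k)"
  by (induction p rule: lpoly_induct)
     (simp_all add: mult_single syn_single syn_add distrib_left lat_add diff_diff_eq)

lemma phi_translate_L2: "(\<lambda>x. \<phi> (x - lat k)) \<in> L2"
  using L2_translate[OF phi_L2, of "- lat k"] by simp

lemma syn_L2: "syn p \<in> L2"
  unfolding syn_def[abs_def] by (intro L2_sum L2_cmult phi_translate_L2)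

lemma syn_measurable [measurable]: "syn p \<in> borel_measurable borel"
  using syn_L2 by auto

lemma phi_translate_integrable: "integrable lborel (\<lambda>x. \<phi> (x - z))"
  using integrable_translate[OF phi_integrable, of "- z"] by simp

lemma syn_integrable: "integrable lborel (syn p)"
  unfolding syn_def[abs_def]
  by (intro Bochner_Integration.integrable_sum integrable_mult_right phi_translate_integrable)

lemma syn_fourier: "fourier (syn p) u = leval p (expm u) * fourier \<phi> u"
proof (induction p rule: lpoly_induct)
  case zero
  then show ?case by (simp add: fourier_def)
next
  case (single k c)
  have "fourier (syn (sg k c)) u = c * fourier (\<lambda>x. \<phi> (x - lat k)) u"
    unfolding fourier_cmult[symmetric] by (simp add: syn_single[abs_def])
  then show ?case by (simp add: fourier_translate leval_single expm_zpow)
next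
  case (add p q)
  have "fourier (syn (p + q)) u = fourier (syn p) u + fourier (syn q) u"
    unfolding fourier_add[OF syn_integrable syn_integrable, symmetric] by (simp add: syn_add[abs_def])
  then show ?case using add by (simp add: leval_add distrib_right)
qed

lemma AE_translate_lborel:
  "AE x in lborel. P x \<Longrightarrow> AE x in lborel. P (x - z)" for P :: "real \<times> real \<Rightarrow> bool"
  using AE_lborel_affine[of P 1 "- z"] by simp

lemma syn_support: "\<exists>R. AE x in lborel. R < norm x \<longrightarrow> syn p x = 0"
proof -
  define R where "R = 8 + (\<Sum>k\<in>Poly_Mapping.keys p. norm (lat k))"
  have "AE x in lborel. \<forall>k\<in>Poly_Mapping.keys p. \<phi> (x - lat k) \<noteq> 0 \<longrightarrow> in_open_hexagon (x - lat k)"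
    by (rule AE_finite_allI) (auto intro: AE_translate_lborel[OF phi_support])
  then have "AE x in lborel. R < norm x \<longrightarrow> syn p x = 0"
  proof eventually_elim
    case (elim x)
    show ?case
    proof
      assume R: "R < norm x"
      have "\<phi> (x - lat k) = 0" if k: "k \<in> Poly_Mapping.keys p" for k
      proof (rule ccontr)
        assume "\<phi> (x - lat k) \<noteq> 0"
        then have "in_open_hexagon (x - lat k)" using elim k by blast
        then have "norm (x - lat k) \<le> 2 * 4"
          by (intro norm_bounds_prod) (auto simp: in_open_hexagon_def)
        moreover have "norm (lat k) \<le> (\<Sum>k\<in>Poly_Mapping.keys p. norm (lat k))"
          by (rule member_le_sum[OF k]) auto
        ultimately show False using R norm_triangle_ineq[of "x - lat k" "lat k"] by (simp add: R_def)
      qed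
      then show "syn p x = 0" by (simp add: syn_def)
    qed
  qed
  then show ?thesis ..
qed

lemma fourier_syn_L2: "(\<lambda>u. leval p (expm u) * fourier \<phi> u) \<in> L2"
proof -
  obtain K :: real where K: "\<And>F. (\<lambda>u. F (expm u)) \<in> borel_measurable borel \<Longrightarrow>
    L2sq (\<lambda>u. F (expm u) * fourier \<phi> u) \<le> ennreal K * cell_norm F" using cell_bound by blast
  have "L2sq (\<lambda>u. leval p (expm u) * fourier \<phi> u) \<le> ennreal K * cell_norm (leval p)"
    by (rule K) simp
  also have "\<dots> < \<infinity>" using cell_norm_leval[of p] by (simp add: ennreal_mult_less_top)
  finally show ?thesis by (simp add: L2_def)
qed

text \<open>A finite combination has bounded support almost everywhere, so its integral transform is
  also its Plancherel transform.\<close>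

lemma has_fourier_syn: "has_fourier (syn p) (\<lambda>u. leval p (expm u) * fourier \<phi> u)"
proof -
  obtain R where "AE x in lborel. R < norm x \<longrightarrow> syn p x = 0" using syn_support by blast
  moreover have "fourier (syn p) = (\<lambda>u. leval p (expm u) * fourier \<phi> u)" by (simp add: syn_fourier fun_eq_iff)
  ultimately show ?thesis
    using has_fourier_bounded_support[OF syn_L2, of R p] fourier_syn_L2[of p] by simp
qed

lemma has_fourier_AE_left:
  assumes "has_fourier f g" "f' \<in> borel_measurable borel" "AE x in lborel. f x = f' x"
  shows "has_fourier f' g"
proof -
  have [measurable]: "f \<in> borel_measurable borel" "f' \<in> borel_measurable borel"
    using assms by (auto dest: has_fourier_L2)
  have "L2sq f' = L2sq f" by (rule L2sq_cong_AE) (use assms(3) in auto)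
  moreover have "fourier (ball_trunc n f') u = fourier (ball_trunc n f) u" for n u
    by (rule fourier_cong_AE) (use assms(3) in \<open>auto simp: ball_trunc_def elim!: eventually_mono\<close>)
  ultimately show ?thesis using assms(1) by (auto simp: has_fourier_alt L2_def)
qed

lemma has_mask_syn:
  assumes "f \<in> borel_measurable borel" "AE x in lborel. syn p x = f x"
  shows "has_mask \<phi> f (leval p)"
  using has_fourier_AE_left[OF has_fourier_syn assms] by (simp add: has_mask_def leval_L_l2)

lemma has_mask_leval_AE:
  assumes "has_mask \<phi> f (leval p)"
  shows "AE x in lborel. f x = syn p x"
  using assms has_fourier_unique[OF _ has_fourier_syn] by (auto simp: has_mask_def)

text \<open>\<open>cell_bound\<close> turns convergence of masks on one period into convergence of
  transforms on the whole plane.\<close>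

lemma L_l2_approx:
  assumes "F \<in> L_l2"
  obtains a where "(\<lambda>k. (cmod (a k))\<^sup>2) summable_on UNIV"
    "(\<lambda>n. L2sq (\<lambda>u. F (expm u) * fourier \<phi> u - leval (box_poly a n) (expm u) * fourier \<phi> u)) \<longlonglongrightarrow> 0"
proof -
  from assms obtain a where m [measurable]: "(\<lambda>u. F (expm u)) \<in> borel_measurable borel"
    and a: "(\<lambda>k. (cmod (a k))\<^sup>2) summable_on UNIV"
    and lim: "(\<lambda>n. cell_norm (\<lambda>\<zeta>. F \<zeta> - leval (box_poly a n) \<zeta>)) \<longlonglongrightarrow> 0"
    unfolding L_l2_def cell_norm_def leval_box_poly by blast
  obtain K :: real where K: "\<And>F. (\<lambda>u. F (expm u)) \<in> borel_measurable borel \<Longrightarrow>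
    L2sq (\<lambda>u. F (expm u) * fourier \<phi> u) \<le> ennreal K * cell_norm F" using cell_bound by blast
  have "(\<lambda>n. L2sq (\<lambda>u. (F (expm u) - leval (box_poly a n) (expm u)) * fourier \<phi> u)) \<longlonglongrightarrow> 0"
  proof (rule tendsto_sandwich[OF _ _ tendsto_const])
    show "\<forall>\<^sub>F n in sequentially. L2sq (\<lambda>u. (F (expm u) - leval (box_poly a n) (expm u)) * fourier \<phi> u)
      \<le> ennreal K * cell_norm (\<lambda>\<zeta>. F \<zeta> - leval (box_poly a n) \<zeta>)"
      by (intro always_eventually allI K) measurable
    show "(\<lambda>n. ennreal K * cell_norm (\<lambda>\<zeta>. F \<zeta> - leval (box_poly a n) \<zeta>)) \<longlonglongrightarrow> 0"
      using ennreal_tendsto_cmult[OF _ lim, of "ennreal K"] by simp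
  qed simp
  then show ?thesis using that[OF a] by (simp add: left_diff_distrib)
qed

subsection \<open>The refinement equation and the autocorrelation\<close>

lemma fourier_phi_double: "fourier \<phi> (2 *\<^sub>R u) = leval H (expm u) * fourier \<phi> u"
proof -
  have "leval H (expm u) = 1 / 64 * (1 + cis (- fst u))\<^sup>2 * (1 + cis (- snd u))\<^sup>2 * (1 + cis (- fst u) * cis (- snd u))\<^sup>2"
    unfolding H_factors power2_eq_square
    by (simp only: leval_mult_torus[OF expm_torus] leval_add leval_1 leval_C leval_mon) (simp add: expm_def)
  moreover have "cis (- fst u) * cis (- snd u) = cis (- (fst u + snd u))" by (simp add: cis_mult)
  moreover have "fst (2 *\<^sub>R u) + snd (2 *\<^sub>R u) = 2 * (fst u + snd u)" by simp
  ultimately show ?thesis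
    unfolding fourier_phi by (simp only: fst_scaleR snd_scaleR real_scaleR_def box_factor_double)
      (simp add: power_mult_distrib power_divide)
qed

text \<open>Both sides have the same transform; 4 is the Jacobian of doubling in the plane.\<close>

lemma refinement: "AE x in lborel. \<phi> ((1 / 2) *\<^sub>R x) = 4 * syn H x"
proof (rule fourier_unique_AE)
  show i: "integrable lborel (\<lambda>x. \<phi> ((1 / 2) *\<^sub>R x))"
    using integrable_lborel_affine[OF phi_integrable, of "1 / 2" 0] by simp
  show "integrable lborel (\<lambda>x. 4 * syn H x)" by (intro integrable_mult_right syn_integrable)
  fix u :: "real \<times> real"
  have "fourier (\<lambda>x. \<phi> ((1 / 2) *\<^sub>R x)) u = 4 * fourier \<phi> (2 *\<^sub>R u)"
    unfolding fourier_def
    by (subst integral_lborel_affine[of "\<lambda>x. \<phi> ((1 / 2) *\<^sub>R x) * cis (- (u \<bullet> x))" 2 0])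
       (simp_all add: power2_eq_square scaleR_conv_of_real)
  then show "fourier (\<lambda>x. \<phi> ((1 / 2) *\<^sub>R x)) u = fourier (\<lambda>x. 4 * syn H x) u"
    by (simp add: fourier_cmult syn_fourier fourier_phi_double)
qed

lemma refinement_translate: "AE x in lborel. \<phi> ((1 / 2) *\<^sub>R x - lat k) = 4 * syn (H * sg (k + k) 1) x"
proof -
  have "AE x in lborel. \<phi> ((1 / 2) *\<^sub>R (x - lat (k + k))) = 4 * syn H (x - lat (k + k))"
    by (rule AE_translate_lborel[OF refinement])
  moreover have "(1 / 2) *\<^sub>R (x - lat (k + k)) = (1 / 2) *\<^sub>R x - lat k" for x
    by (cases x) (simp add: lat_def)
  ultimately show ?thesis by (simp add: mult.commute[of H] syn_single_times)
qed

lemma L2inner_translates: "L2inner (\<lambda>x. \<phi> (x - lat i)) (\<lambda>x. \<phi> (x - lat j)) = autocorr \<phi> (lat (j - i))"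
proof -
  have "L2inner (\<lambda>x. \<phi> (x - lat i)) (\<lambda>x. \<phi> (x - lat j)) = (\<integral>t. \<phi> t * cnj (\<phi> (t + lat i - lat j)) \<partial>lborel)"
    unfolding L2inner_def
    using integral_translate[of "\<lambda>x. \<phi> (x - lat i) * cnj (\<phi> (x - lat j))" "lat i"] by simp
  moreover have "t + lat i - lat j = t - lat (j - i)" for t
    using lat_add[of "j - i" i] by (simp add: algebra_simps)
  ultimately show ?thesis by (simp add: autocorr_def)
qed

lemma autocorr_outside: "k \<notin> hex3 \<Longrightarrow> autocorr \<phi> (lat k) = 0"
proof -
  assume k: "k \<notin> hex3"
  have "AE t in lborel. \<phi> t * cnj (\<phi> (t - lat k)) = 0"
    using phi_support AE_translate_lborel[OF phi_support, of "lat k"]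
  proof eventually_elim
    case (elim t)
    show ?case
    proof (rule ccontr)
      assume "\<phi> t * cnj (\<phi> (t - lat k)) \<noteq> 0"
      then have "in_open_hexagon t" "in_open_hexagon (t - lat k)" using elim by auto
      then have "\<bar>real_of_int (fst k)\<bar> < 4" "\<bar>real_of_int (snd k)\<bar> < 4" "\<bar>real_of_int (fst k - snd k)\<bar> < 4"
        by (auto simp: in_open_hexagon_def lat_def)
      then have "\<bar>fst k\<bar> < 4" "\<bar>snd k\<bar> < 4" "\<bar>fst k - snd k\<bar> < 4" by linarith+
      then show False using k by (auto simp: hex3_def)
    qed
  qed
  then have "autocorr \<phi> (lat k) = (\<integral>t. 0 \<partial>(lborel :: (real \<times> real) measure))"
    unfolding autocorr_def by (intro integral_cong_AE) auto
  then show ?thesis by simp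
qed

definition autocorr_poly :: lpoly where
  "autocorr_poly = (\<Sum>k\<in>hex3. sg k (autocorr \<phi> (lat k)))"

lemma lookup_autocorr_poly: "lk autocorr_poly k = autocorr \<phi> (lat k)"
  using autocorr_outside[of k] by (auto simp: autocorr_poly_def lookup_sum lookup_single when_def)

text \<open>Both sides are additive in p and in q, so the claim reduces to two single terms, where
  it is the autocorrelation at the difference of the shifts.\<close>

lemma L2inner_syn_autocorr: "L2inner (syn p) (syn q) = lk (p * lconj q * autocorr_poly) 0"
proof (induction p rule: lpoly_induct)
  case zero
  then show ?case by (simp add: L2inner_def)
next
  case (add p p')
  \<comment> \<open>The two summands are labelled by \<open>True\<close> and \<open>False\<close> so
    that the rule for finite sums applies.\<close>
  have "L2inner (syn (p + p')) (syn q) = L2inner (\<lambda>x. \<Sum>i\<in>{True, False}. 1 * syn (if i then p else p') x) (syn q)"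
    by (simp add: syn_add[abs_def])
  also have "\<dots> = L2inner (syn p) (syn q) + L2inner (syn p') (syn q)"
    by (subst L2inner_sum_left) (simp_all add: syn_L2)
  finally show ?case using add by (simp add: distrib_right lookup_add)
next
  case (single k c)
  show ?case
  proof (induction q rule: lpoly_induct)
    case zero
    then show ?case by (simp add: L2inner_def)
  next
    case (add q q')
    have "L2inner (syn (sg k c)) (syn (q + q')) = L2inner (syn (sg k c)) (\<lambda>x. \<Sum>i\<in>{True, False}. 1 * syn (if i then q else q') x)"
      by (simp add: syn_add[abs_def])
    also have "\<dots> = L2inner (syn (sg k c)) (syn q) + L2inner (syn (sg k c)) (syn q')"
      by (subst L2inner_sum_right) (simp_all add: syn_L2)
    finally show ?case using add by (simp add: distrib_left distrib_right lookup_add lconj_add)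
  next
    case (single l d)
    have "L2inner (syn (sg k c)) (syn (sg l d)) = (\<integral>x. (c * cnj d) * (\<phi> (x - lat k) * cnj (\<phi> (x - lat l))) \<partial>lborel)"
      by (simp add: L2inner_def syn_single mult_ac)
    also have "\<dots> = c * cnj d * autocorr \<phi> (lat (l - k))"
      unfolding L2inner_translates[symmetric] L2inner_def by (rule integral_mult_right_zero)
    finally show ?case
      by (simp add: lconj_single mult_single lookup_single_times lookup_autocorr_poly)
  qed
qed

text \<open>Substituting x / 2 gives the factor 1/4 and the two refinement equations give 16. On the
  finer lattice the shift k becomes k + k.\<close>

lemma autocorr_refinement: "autocorr \<phi> (lat k) = 4 * lk (H * lconj H * autocorr_poly) (k + k)"
proof -
  have "autocorr \<phi> (lat k) = (1 / 2) ^ 2 *\<^sub>R (\<integral>x. \<phi> ((1 / 2) *\<^sub>R x) * cnj (\<phi> ((1 / 2) *\<^sub>R x - lat k)) \<partial>lborel)"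
    unfolding autocorr_def
    by (subst integral_lborel_affine[of "\<lambda>t. \<phi> t * cnj (\<phi> (t - lat k))" "1 / 2" 0]) (simp_all add: power2_eq_square)
  also have "(\<integral>x. \<phi> ((1 / 2) *\<^sub>R x) * cnj (\<phi> ((1 / 2) *\<^sub>R x - lat k)) \<partial>lborel)
      = (\<integral>x. 16 * (syn H x * cnj (syn (H * sg (k + k) 1) x)) \<partial>lborel)"
  proof (rule integral_cong_AE)
    show "AE x in lborel. \<phi> ((1 / 2) *\<^sub>R x) * cnj (\<phi> ((1 / 2) *\<^sub>R x - lat k)) = 16 * (syn H x * cnj (syn (H * sg (k + k) 1) x))"
      using refinement refinement_translate[of k] by eventually_elim simp
  qed auto
  also have "\<dots> = 16 * L2inner (syn H) (syn (H * sg (k + k) 1))"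
    by (simp add: L2inner_def)
  also have "L2inner (syn H) (syn (H * sg (k + k) 1)) = lk (sg (- (k + k)) 1 * (H * lconj H * autocorr_poly)) 0"
    by (simp add: L2inner_syn_autocorr lconj_mult lconj_single mult_ac)
  also have "\<dots> = lk (H * lconj H * autocorr_poly) (k + k)"
    by (simp only: lookup_single_times) simp
  finally show ?thesis by (simp add: power2_eq_square scaleR_conv_of_real)
qed

text \<open>The translates sum to 1 on the support of \<phi>, so the sum collapses to the integral
  of \<phi>, the value of its transform at 0.\<close>

lemma sum_autocorr: "(\<Sum>k\<in>hex3. autocorr \<phi> (lat k)) = 1"
proof -
  have sub: "hex3 \<subseteq> int_square" by (auto simp: hex3_def int_square_def)
  have fin: "finite int_square" by (simp add: int_square_def)
  have "(\<Sum>k\<in>hex3. autocorr \<phi> (lat k)) = (\<Sum>k\<in>int_square. autocorr \<phi> (lat k))"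
    by (rule sum.mono_neutral_left[OF fin sub]) (auto intro: autocorr_outside)
  also have "\<dots> = (\<integral>t. (\<Sum>k\<in>int_square. \<phi> t * cnj (\<phi> (t - lat k))) \<partial>lborel)"
    unfolding autocorr_def
    by (rule Bochner_Integration.integral_sum[symmetric]) (intro L2_mult_integrable phi_L2 phi_translate_L2)
  also have "\<dots> = (\<integral>t. \<phi> t \<partial>lborel)"
  proof (rule integral_cong_AE)
    have "AE t in lborel. \<forall>k\<in>int_square. \<phi> (t - lat k) = box_function (t - lat k)"
      by (rule AE_finite_allI[OF fin]) (rule AE_translate_lborel[OF phi_AE])
    then show "AE t in lborel. (\<Sum>k\<in>int_square. \<phi> t * cnj (\<phi> (t - lat k))) = \<phi> t"
      using phi_support
    proof eventually_elim
      case (elim t)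
      show ?case
      proof (cases "\<phi> t = 0")
        case False
        then have "in_open_hexagon t" using elim by blast
        then have "(\<Sum>k\<in>int_square. box_function (t - lat k)) = 1"
          using box_function_props(4)[unfolded unity_on_def, rule_format, of t] by (simp add: in_open_hexagon_def)
        then have "(\<Sum>k\<in>int_square. \<phi> (t - lat k)) = 1" using elim by simp
        then show ?thesis by (simp flip: sum_distrib_left cnj_sum)
      qed simp
    qed
  qed auto
  also have "\<dots> = fourier \<phi> 0" by (simp add: fourier_def)
  also have "\<dots> = 1" by (simp add: fourier_phi box_factor_def)
  finally show ?thesis .
qed

text \<open>Both sequences are stationary for the same column-stochastic matrix on the hexagon; its row \<open>0\<close> is
  positive, so the matrix contracts vectors of sum \<open>0\<close>.\<close>

lemma autocorr_eq_Phi: "autocorr \<phi> (lat k) = lk Phi k"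
proof -
  define e where "e k = autocorr \<phi> (lat k) - lk Phi k" for k
  \<comment> \<open>The matrix of the transition operator. Both coefficient vectors are fixed by it,
    hence so is their difference \<open>e\<close>.\<close>
  define T where "T k j = 4 * lk (H * lconj H) (k + k - j)" for k j
  define r where "r k j = real_of_int (rows_entry HH_rows (2 * fst k - fst j + 4) (2 * snd k - snd j + 4)) / 1024" for k j
  have T: "T k j = of_real (r k j)" for k j
  proof -
    have "k + k - j = (2 * fst k - fst j, 2 * snd k - snd j)" by (simp add: prod_eq_iff)
    then show ?thesis by (simp only: T_def r_def HH_lookup) simp
  qed
  have r_nonneg: "0 \<le> r k j" for k j using HH_entry_nonneg by (simp add: r_def)
  have r0: "1 / 1024 \<le> r 0 j" if "j \<in> hex3" for j
    using HH_entry_pos[of "fst j" "snd j"] that by (simp add: r_def)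
  have r_sum: "(\<Sum>k\<in>hex3. r k j) \<le> 1" if j: "j \<in> hex3" for j
  proof -
    have "(\<Sum>k\<in>hex3. r k j) = real_of_int (\<Sum>(k, l)\<in>hex3. rows_entry HH_rows (2 * k - fst j + 4) (2 * l - snd j + 4)) / 1024"
      by (simp add: r_def sum_divide_distrib case_prod_unfold)
    also have "\<dots> \<le> real_of_int 1024 / 1024"
      using HH_entry_sum[of "fst j" "snd j"] j by (intro divide_right_mono of_int_le_iff[THEN iffD2]) auto
    also have "\<dots> = 1" by simp
    finally show ?thesis .
  qed
  have e_out: "e k = 0" if "k \<notin> hex3" for k
    using that by (simp add: e_def autocorr_outside lookup_Phi_outside)
  have lkT: "4 * lk (H * lconj H * p) (k + k) = (\<Sum>j\<in>hex3. T k j * lk p j)" if "Poly_Mapping.keys p \<subseteq> hex3" for p k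
    using lookup_times[OF finite_hex3 that, of "H * lconj H" "k + k"]
    by (simp add: mult.commute[of _ p] T_def sum_distrib_left mult_ac)
  have e_T: "e k = (\<Sum>j\<in>hex3. T k j * e j)" for k
  proof -
    have "Poly_Mapping.keys autocorr_poly \<subseteq> hex3" "Poly_Mapping.keys Phi \<subseteq> hex3"
      using autocorr_outside lookup_Phi_outside by (auto simp only: in_keys_iff lookup_autocorr_poly subset_iff)
    then have "e k = (\<Sum>j\<in>hex3. T k j * lk autocorr_poly j) - (\<Sum>j\<in>hex3. T k j * lk Phi j)"
      by (simp add: e_def autocorr_refinement[of k] even_lookup_HHPhi[of k] flip: lkT)
    then show ?thesis by (simp add: e_def lookup_autocorr_poly right_diff_distrib sum_subtractf)
  qed
  have e_sum: "(\<Sum>j\<in>hex3. e j) = 0"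
    by (simp add: e_def sum_subtractf sum_autocorr sum_lookup_Phi)
  define N where "N = (\<Sum>k\<in>hex3. cmod (e k))"
  \<comment> \<open>Subtracting 1/1024 throughout row 0 does not change the product with a vector of
    sum 0, keeps all entries nonnegative and lowers every column sum to at most 1 - 1/1024.\<close>
  define r' where "r' k j = (if k = 0 then r k j - 1 / 1024 else r k j)" for k j
  have r'_nonneg: "0 \<le> r' k j" if "j \<in> hex3" for k j
    using r0[OF that] r_nonneg by (simp add: r'_def)
  have e_r': "e k = (\<Sum>j\<in>hex3. of_real (r' k j) * e j)" for k
  proof (cases "k = 0")
    case True
    have "(\<Sum>j\<in>hex3. of_real (r' k j) * e j) = (\<Sum>j\<in>hex3. T k j * e j) - (1 / 1024) * (\<Sum>j\<in>hex3. e j)"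
      unfolding sum_distrib_left sum_subtractf[symmetric]
      using True by (intro sum.cong) (simp_all add: r'_def T left_diff_distrib)
    then show ?thesis using e_T[of k] e_sum by simp
  next
    case False
    then show ?thesis using e_T[of k] by (simp add: r'_def T)
  qed
  have zero: "0 \<in> hex3" by (simp add: hex3_def)
  have "N \<le> (\<Sum>k\<in>hex3. \<Sum>j\<in>hex3. r' k j * cmod (e j))"
    unfolding N_def
  proof (rule sum_mono)
    fix k
    have "cmod (e k) \<le> (\<Sum>j\<in>hex3. cmod (of_real (r' k j) * e j))"
      by (subst e_r') (rule norm_sum)
    then show "cmod (e k) \<le> (\<Sum>j\<in>hex3. r' k j * cmod (e j))"
      using r'_nonneg by (simp add: norm_mult)
  qed
  also have "\<dots> = (\<Sum>j\<in>hex3. (\<Sum>k\<in>hex3. r' k j) * cmod (e j))"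
    by (subst sum.swap) (simp add: sum_distrib_right)
  also have "\<dots> \<le> (\<Sum>j\<in>hex3. (1 - 1 / 1024) * cmod (e j))"
  proof (intro sum_mono mult_right_mono)
    fix j assume j: "j \<in> hex3"
    have "(\<Sum>k\<in>hex3. r' k j) = (\<Sum>k\<in>hex3. r k j - (if k = 0 then 1 / 1024 else 0))"
      by (intro sum.cong) (auto simp: r'_def)
    also have "\<dots> = (\<Sum>k\<in>hex3. r k j) - 1 / 1024"
      using zero by (simp add: sum_subtractf)
    finally show "(\<Sum>k\<in>hex3. r' k j) \<le> 1 - 1 / 1024" using r_sum[OF j] by simp
  qed simp
  also have "\<dots> = (1 - 1 / 1024) * N" by (simp add: N_def sum_distrib_left)
  finally have "N \<le> 0" by simp
  then have "\<forall>k\<in>hex3. cmod (e k) = 0"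
  proof -
    have "N = 0" using \<open>N \<le> 0\<close> by (simp add: N_def sum_nonneg order_antisym)
    then show ?thesis unfolding N_def by (subst (asm) sum_nonneg_eq_0_iff) auto
  qed
  then have "e k = 0" using e_out by (metis norm_eq_zero)
  then show ?thesis by (simp add: e_def)
qed

lemma L2inner_syn: "L2inner (syn p) (syn q) = lk (p * lconj q * Phi) 0"
proof -
  have "autocorr_poly = Phi"
    by (rule poly_mapping_eqI) (simp add: lookup_autocorr_poly autocorr_eq_Phi)
  then show ?thesis by (simp add: L2inner_syn_autocorr)
qed

end

subsection \<open>Prewavelets\<close>

lemma lconj_ldilate: "lconj (ldilate p) = ldilate (lconj p)"
proof (rule poly_mapping_eqI)
  fix m :: "int \<times> int"
  have "even_pt (- m) \<longleftrightarrow> even_pt m" by (simp add: even_pt_def)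
  moreover have "even_pt m \<Longrightarrow> half_pt (- m) = - half_pt m"
    by (auto simp: even_pt_def half_pt_def elim!: evenE)
  ultimately show "lk (lconj (ldilate p)) m = lk (ldilate (lconj p)) m"
    by (simp add: lookup_ldilate)
qed

lemma lookup_0_even_part: "lk p 0 = lk (even_part p) 0"
  by simp

lemma even_part_Phi_H_Hs:
  assumes s: "s \<in> E - {(0, 0)}"
  shows "even_part (Phi * lconj H * Hs s) = 0"
proof -
  have c: "C (1 / (2 ^ 6 * 362880)) * C (2 ^ 6 * 362880) = 1" by (simp add: C_mult)
  have "Phi * lconj H * Hs s = (C (1 / (2 ^ 6 * 362880)) * C (2 ^ 6 * 362880)) * Phi * lconj H * Hs s"
    by (simp only: c mult_1_left)
  also have "\<dots> = C (1 / (2 ^ 6 * 362880)) * (HPhi * Hs s)"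
    by (simp add: lconj_mult lconj_C mult_ac)
  finally show ?thesis
    by (simp only: even_part_C_times even_part_HPhi_Hs[OF s]) simp
qed

lemma cmod_lookup_mult_lconj: "cmod (lk (p * lconj q) 0) \<le> norm2 p * norm2 q"
proof -
  let ?S = "Poly_Mapping.keys p \<union> Poly_Mapping.keys q"
  have "cmod (lk (p * lconj q) 0) = cmod (\<Sum>k\<in>?S. lk p k * cnj (lk q k))"
    by (subst lookup_mult_lconj_0[of ?S]) auto
  also have "\<dots> \<le> (\<Sum>k\<in>?S. \<bar>cmod (lk p k)\<bar> * \<bar>cmod (lk q k)\<bar>)"
    by (rule order_trans[OF norm_sum]) (simp add: norm_mult)
  also have "\<dots> \<le> L2_set (\<lambda>k. cmod (lk p k)) ?S * L2_set (\<lambda>k. cmod (lk q k)) ?S"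
    by (rule L2_set_mult_ineq)
  also have "\<dots> = norm2 p * norm2 q"
    by (simp add: norm2_superset[of ?S p] norm2_superset[of ?S q])
  finally show ?thesis .
qed

section \<open>Splitting into parity classes\<close>

definition component :: "nat \<times> nat \<Rightarrow> lpoly \<Rightarrow> lpoly" where
  "component s p = even_part (mon (- int (fst s)) (- int (snd s)) * p)"

lemma component_sum: "p = (\<Sum>s\<in>E. ldilate (component s p) * mon (int (fst s)) (int (snd s)))"
proof (rule poly_mapping_eqI)
  fix m :: "int \<times> int"
  obtain i j where m: "m = (i, j)" by force
  have *: "lk (ldilate (component s p) * mon (int (fst s)) (int (snd s))) (i, j)
      = (if even_pt (i - int (fst s), j - int (snd s)) then lk p (i, j) else 0)" for s
  proof -
    have "lk (mon (- int (fst s)) (- int (snd s)) * p) (half_pt (a, b) + half_pt (a, b)) = lk p (a + int (fst s), b + int (snd s))"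
      if "even_pt (a, b)" for a b
      unfolding half_pt_double[OF that] by (simp add: lookup_mon_times)
    then show ?thesis
      unfolding mult.commute[of _ "mon _ _"] lookup_mon_times lookup_ldilate component_def lookup_even_part by simp
  qed
  show "lk p m = lk (\<Sum>s\<in>E. ldilate (component s p) * mon (int (fst s)) (int (snd s))) m"
    unfolding m lookup_sum unfolding * unfolding sum_E by (auto simp: even_pt_def)
qed

lemma component_dilate_times: "component s (ldilate p * q) = p * component s q"
  unfolding component_def by (simp add: mult.left_commute[of _ "ldilate p"] even_part_ldilate_mult)

lemma component_add: "component s (p + q) = component s p + component s q"
  by (simp add: component_def distrib_left even_part_add)

lemma component_sum_commute: "component s (sum f I) = (\<Sum>i\<in>I. component s (f i))"
  by (induction I rule: infinite_finite_induct) (auto simp: component_add, simp_all add: component_def)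

lemma norm2_component: "norm2 (component s p) \<le> norm2 p"
  unfolding component_def by (rule order_trans[OF norm2_even_part]) simp

text \<open>As \<open>w t\<close> has only even exponents, outside class 0 the polynomial H_t
  consists of - w_(0,0) zeta^t alone. On the classes s \<noteq> 0 the three H_t thus form - w_(0,0)
  times the identity matrix.\<close>

lemma component_Hs:
  assumes s: "s \<in> E - {(0, 0)}" and t: "t \<in> E - {(0, 0)}"
  shows "component s (Hs t) = (if s = t then - even_part w00 else 0)"
proof -
  have w: "w r = ldilate (even_part (w r))" for r by (simp add: Ldown_ldilate w_Ldown)
  have m0: "even_part (mon 0 0) = mon 0 0"
    using even_part_ldilate[of "mon 0 0"] by (simp add: mon_def ldilate_single)
  have e: "even_part (mon a b * w r) = even_part (w r) * even_part (mon a b)" for a b r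
    by (subst w) (simp add: mult.commute[of "mon a b"] even_part_ldilate_mult)
  have "component s (Hs t) = even_part (w t) * even_part (mon (- int (fst s)) (- int (snd s)))
      - even_part (w (0, 0)) * even_part (mon (int (fst t) - int (fst s)) (int (snd t) - int (snd s)))"
  proof -
    have "mon (- int (fst s)) (- int (snd s)) * Hs t = mon (- int (fst s)) (- int (snd s)) * w t
      - mon (int (fst t) - int (fst s)) (int (snd t) - int (snd s)) * w (0, 0)"
      by (simp add: Hs_eq[OF t] right_diff_distrib mult.commute[of "w (0, 0)"] mon_mult flip: mult.assoc)
    then show ?thesis by (simp only: component_def even_part_diff e)
  qed
  moreover have "even_part (mon (- int (fst s)) (- int (snd s))) = 0"
    using s by (auto simp: E_eq even_part_mon)
  moreover have "even_part (mon (int (fst t) - int (fst s)) (int (snd t) - int (snd s))) = (if s = t then 1 else 0)"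
    using s t m0 by (auto simp: E_eq even_part_mon one_lpoly)
  ultimately show ?thesis by (simp add: w_def)
qed

lemma mult_self_le_cancel:
  fixes a b :: real
  assumes "a * a \<le> b * a" "0 \<le> a" "0 \<le> b" shows "a \<le> b"
  using assms by (cases "a = 0") (auto simp: mult_le_cancel_right)

lemma ldilate_sum: "ldilate (sum f I) = (\<Sum>i\<in>I. ldilate (f i))"
  by (induction I rule: infinite_finite_induct) (auto simp: ldilate_add)

lemma finite_E [simp]: "finite E"
  by (simp add: E_eq)

text \<open>Class s of the combination is - c_s w_(0,0) by \<open>component_Hs\<close>. Taking a
  class does not increase the l_2-norm, and w_(0,0) is removed with its approximate inverse.\<close>

lemma Hs_combination_lower:
  obtains \<kappa> where "0 \<le> \<kappa>"
    "\<And>c s. s \<in> E - {(0, 0)} \<Longrightarrow> norm2 (c s) \<le> \<kappa> * norm2 (\<Sum>t\<in>E - {(0, 0)}. ldilate (c t) * Hs t)"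
proof -
  obtain P q where Pq: "P * w00 = 1 - q" "norm1 q < 1" using w00_inverse by blast
  define \<kappa> where "\<kappa> = norm1 P / (1 - norm1 q)"
  have \<kappa>: "0 \<le> \<kappa>" using Pq(2) by (simp add: \<kappa>_def)
  have "norm2 (c s) \<le> \<kappa> * norm2 (\<Sum>t\<in>E - {(0, 0)}. ldilate (c t) * Hs t)" if s: "s \<in> E - {(0, 0)}" for c s
  proof -
    have "component s (\<Sum>t\<in>E - {(0, 0)}. ldilate (c t) * Hs t) = (\<Sum>t\<in>E - {(0, 0)}. c t * (if s = t then - even_part w00 else 0))"
      unfolding component_sum_commute component_dilate_times using component_Hs[OF s] by (intro sum.cong) auto
    also have "\<dots> = (\<Sum>t\<in>E - {(0, 0)}. if s = t then - (c t * even_part w00) else 0)"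
      by (intro sum.cong) auto
    also have "\<dots> = - (c s * even_part w00)" using s by simp
    finally have comp: "component s (\<Sum>t\<in>E - {(0, 0)}. ldilate (c t) * Hs t) = - (c s * even_part w00)" .
    have w: "ldilate (even_part w00) = w00" using w_Ldown[of "(0, 0)"] by (intro Ldown_ldilate) (simp add: w_def)
    have "norm2 (c s) = norm2 (ldilate (c s))" by simp
    also have "\<dots> \<le> \<kappa> * norm2 (w00 * ldilate (c s))"
      unfolding \<kappa>_def by (rule norm2_le_of_inverse[OF Pq])
    also have "w00 * ldilate (c s) = ldilate (c s * even_part w00)"
      by (simp add: ldilate_mult w mult.commute)
    also have "norm2 (ldilate (c s * even_part w00)) = norm2 (component s (\<Sum>t\<in>E - {(0, 0)}. ldilate (c t) * Hs t))"
      by (simp add: comp)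
    also have "\<kappa> * \<dots> \<le> \<kappa> * norm2 (\<Sum>t\<in>E - {(0, 0)}. ldilate (c t) * Hs t)"
      by (intro mult_left_mono norm2_component \<kappa>)
    finally show ?thesis .
  qed
  then show thesis using that \<kappa> by blast
qed

lemma Hs_combination_upper:
  obtains M where "0 \<le> M"
    "\<And>c. norm2 (\<Sum>t\<in>E - {(0, 0)}. ldilate (c t) * Hs t) \<le> M * (\<Sum>t\<in>E - {(0, 0)}. norm2 (c t))"
proof -
  define M where "M = (\<Sum>t\<in>E - {(0, 0)}. norm1 (Hs t))"
  have "norm2 (\<Sum>t\<in>E - {(0, 0)}. ldilate (c t) * Hs t) \<le> M * (\<Sum>t\<in>E - {(0, 0)}. norm2 (c t))" for c
  proof -
    have "norm2 (\<Sum>t\<in>E - {(0, 0)}. ldilate (c t) * Hs t) \<le> (\<Sum>t\<in>E - {(0, 0)}. norm2 (Hs t * ldilate (c t)))"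
      unfolding mult.commute[of _ "Hs _"] by (rule norm2_sum)
    also have "\<dots> \<le> (\<Sum>t\<in>E - {(0, 0)}. M * norm2 (c t))"
    proof (rule sum_mono)
      fix t assume t: "t \<in> E - {(0, 0)}"
      have "norm1 (Hs t) \<le> M" unfolding M_def using t by (intro member_le_sum) auto
      then have "norm1 (Hs t) * norm2 (ldilate (c t)) \<le> M * norm2 (c t)" by (simp add: mult_right_mono)
      then show "norm2 (Hs t * ldilate (c t)) \<le> M * norm2 (c t)" using norm2_mult[of "Hs t" "ldilate (c t)"] by linarith
    qed
    finally show ?thesis by (simp add: sum_distrib_left)
  qed
  moreover have "0 \<le> M" by (simp add: M_def sum_nonneg)
  ultimately show thesis using that by blast
qed

text \<open>If \<open>v\<close> is nearly inverse to \<open>w\<^sub>0\<^sub>0\<close>, the combination of the \<open>H\<^sub>s\<close>, \<open>s \<noteq> 0\<close>, with coefficients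
  \<open>- v f\<^sub>s\<close> nearly reproduces \<open>p = \<Sum> f\<^sub>s \<zeta>\<^sup>s\<close>, up to the pairing of \<open>p\<close> with \<open>H\<close>.\<close>

lemma Hs_combination_approx:
  assumes v: "v \<in> Ldown"
  shows "p - (\<Sum>s\<in>E - {(0, 0)}. ldilate (- (component s p * even_part v)) * Hs s)
    = (1 - v * w00) * p + v * ldilate (even_part (HPhi * p))"
proof -
  define f where "f s = ldilate (component s p)" for s
  have ld_neg: "ldilate (- a) = - ldilate a" for a
    by (rule poly_mapping_eqI) (simp add: lookup_ldilate)
  have w: "w r = ldilate (even_part (w r))" for r by (simp add: Ldown_ldilate w_Ldown)
  have c: "ldilate (- (component s p * even_part v)) = - (f s * v)" for s
    by (simp add: ld_neg ldilate_mult f_def Ldown_ldilate[OF v])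
  have p: "p = f (0, 0) + f (1, 0) * mon 1 0 + f (0, 1) * mon 0 1 + f (1, 1) * mon 1 1"
    using component_sum[of p] by (simp add: sum_E f_def flip: one_lpoly)
  have e: "even_part (w r * mon (- int (fst r)) (- int (snd r)) * p) = even_part (w r) * component r p" for r
    by (subst w) (simp add: mult.assoc even_part_ldilate_mult component_def)
  have "even_part (HPhi * p) = (\<Sum>r\<in>E. even_part (w r * mon (- int (fst r)) (- int (snd r)) * p))"
    unfolding HPhi_split sum_E by (simp only: distrib_right even_part_add) (simp flip: one_lpoly)
  then have "ldilate (even_part (HPhi * p)) = (\<Sum>r\<in>E. w r * f r)"
    unfolding e by (simp only: sum_E ldilate_add ldilate_mult f_def Ldown_ldilate[OF w_Ldown])
  then have pair: "ldilate (even_part (HPhi * p)) = w00 * f (0, 0) + w10 * f (1, 0) + w01 * f (0, 1) + w11 * f (1, 1)"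
    by (simp add: sum_E w_def)
  have set: "E - {(0, 0)} = {(1, 0), (0, 1), (1, 1)}" by (auto simp: E_eq)
  have "(\<Sum>s\<in>E - {(0, 0)}. ldilate (- (component s p * even_part v)) * Hs s)
      = - (f (1, 0) * v) * H10 + - (f (0, 1) * v) * H01 + - (f (1, 1) * v) * H11"
    unfolding c set by (simp add: Hs_def)
  then have "p - (\<Sum>s\<in>E - {(0, 0)}. ldilate (- (component s p * even_part v)) * Hs s)
      = p + f (1, 0) * v * H10 + f (0, 1) * v * H01 + f (1, 1) * v * H11"
    by (simp only:) (simp add: algebra_simps)
  \<comment> \<open>The terms - v w_(0,0) f_s zeta^s with s \<noteq> 0 add up to - v w_(0,0) (p -
    f_0); the missing f_0 completes the pairing.\<close>
  also have "\<dots> = (1 - v * w00) * p + v * (w00 * f (0, 0) + w10 * f (1, 0) + w01 * f (0, 1) + w11 * f (1, 1))"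
    unfolding H10_def H01_def H11_def by (subst (1 2) p) (simp add: algebra_simps)
  finally show ?thesis unfolding pair .
qed

context box_spline_Xi
begin

lemma cmod_L2inner_syn: "cmod (L2inner (syn p) (syn q)) \<le> norm1 Phi * (norm2 p * norm2 q)"
proof -
  have "cmod (lk (Phi * p * lconj q) 0) \<le> norm2 (Phi * p) * norm2 q"
    by (rule cmod_lookup_mult_lconj)
  also have "\<dots> \<le> (norm1 Phi * norm2 p) * norm2 q"
    by (intro mult_right_mono norm2_mult) simp
  finally show ?thesis by (simp add: L2inner_syn mult_ac)
qed

lemma L2sq_syn_le: "L2sq (syn p) \<le> ennreal (norm1 Phi * (norm2 p)\<^sup>2)"
proof -
  have "Re (L2inner (syn p) (syn p)) \<le> norm1 Phi * (norm2 p * norm2 p)"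
    using complex_Re_le_cmod cmod_L2inner_syn order_trans by blast
  then show ?thesis by (simp add: L2inner_self[OF syn_L2] power2_eq_square ennreal_leI)
qed

text \<open>Duality: the inner product of \<open>syn p\<close> with \<open>syn (Phi * p)\<close> is
  the squared l_2-norm of Phi p. Cauchy-Schwarz and the upper bound \<open>L2sq_syn_le\<close> leave
  |Phi p|_2^2 <= const \<open>L2sq (syn p)\<close>, and Phi is divided out.\<close>

lemma L2sq_syn_ge:
  obtains \<mu> where "0 < \<mu>" "\<And>p. ennreal ((norm2 p)\<^sup>2) \<le> ennreal \<mu> * L2sq (syn p)"
proof -
  obtain P q where Pq: "P * Phi = 1 - q" "norm1 q < 1" using Phi_inverse by blast
  define \<kappa> where "\<kappa> = norm1 P / (1 - norm1 q)"
  have \<kappa>: "0 \<le> \<kappa>" using Pq(2) by (simp add: \<kappa>_def)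
  define \<mu> where "\<mu> = \<kappa>\<^sup>2 * norm1 Phi + 1"
  have "0 < \<mu>" by (simp add: \<mu>_def add_nonneg_pos)
  moreover have "ennreal ((norm2 p)\<^sup>2) \<le> ennreal \<mu> * L2sq (syn p)" for p
  proof -
    define x where "x = Phi * p"
    define L where "L = (\<integral>t. (cmod (syn p t))\<^sup>2 \<partial>lborel)"
    have L: "L2sq (syn p) = ennreal L" "0 \<le> L" by (simp_all add: L_def L2sq_integral[OF syn_L2])
    have "L2inner (syn p) (syn x) = of_real ((norm2 x)\<^sup>2)"
      unfolding norm2_power2 by (simp add: L2inner_syn x_def mult_ac)
    then have "cmod (L2inner (syn p) (syn x)) = (norm2 x)\<^sup>2"
      by (simp only: norm_of_real) simp
    then have "ennreal (((norm2 x)\<^sup>2)\<^sup>2) \<le> L2sq (syn p) * L2sq (syn x)"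
      using L2inner_Cauchy_Schwarz[OF syn_L2 syn_L2, of p x] by simp
    also have "\<dots> \<le> ennreal L * ennreal (norm1 Phi * (norm2 x)\<^sup>2)"
      unfolding L(1) by (intro mult_left_mono L2sq_syn_le) auto
    finally have "(norm2 x)\<^sup>2 * (norm2 x)\<^sup>2 \<le> (L * norm1 Phi) * (norm2 x)\<^sup>2"
      using L(2) by (simp add: power2_eq_square mult_ac flip: ennreal_mult)
    then have "(norm2 x)\<^sup>2 \<le> L * norm1 Phi"
      by (rule mult_self_le_cancel) (use L(2) in simp_all)
    moreover have "(norm2 p)\<^sup>2 \<le> (\<kappa> * norm2 x)\<^sup>2"
      unfolding \<kappa>_def x_def by (intro power_mono norm2_le_of_inverse[OF Pq]) simp
    ultimately have "(norm2 p)\<^sup>2 \<le> \<kappa>\<^sup>2 * (L * norm1 Phi)"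
      by (simp add: power_mult_distrib) (meson mult_left_mono order_trans zero_le_power2)
    also have "\<dots> \<le> \<mu> * L" using L(2) by (simp add: \<mu>_def algebra_simps)
    finally show ?thesis
      using L \<open>0 < \<mu>\<close> by (simp add: ennreal_leI flip: ennreal_mult)
  qed
  ultimately show thesis using that by blast
qed

section \<open>Approximation in V_0 and V_(-1)\<close>

lemma expm_double: "expm (2 *\<^sub>R u) = zsq (expm u)"
proof -
  have "cis (- (2 * t)) = (cis (- t))\<^sup>2" for t by (simp add: power2_eq_square cis_mult)
  then show ?thesis by (simp add: expm_def zsq_def)
qed

lemma fourier_H_ldilate:
  "leval (H * ldilate b) (expm u) * fourier \<phi> u = leval b (expm (2 *\<^sub>R u)) * fourier \<phi> (2 *\<^sub>R u)"
  unfolding leval_mult_torus[OF expm_torus] leval_ldilate expm_double fourier_phi_double by (simp add: mult_ac)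

lemma syn_Vm1: "syn (H * ldilate b) \<in> Vm1 \<phi>"
proof -
  have "syn b \<in> V0 \<phi>" using has_mask_syn[of "syn b" b] by (auto simp: V0_def)
  moreover have "has_fourier (syn (H * ldilate b)) (\<lambda>u. leval b (expm (2 *\<^sub>R u)) * fourier \<phi> (2 *\<^sub>R u))"
    using has_fourier_syn[of "H * ldilate b"] by (simp only: fourier_H_ldilate)
  ultimately show ?thesis using has_fourier_syn[of b] unfolding Vm1_def by blast
qed

lemma V0_approx:
  assumes "g \<in> V0 \<phi>"
  obtains a where "(\<lambda>k. (cmod (a k))\<^sup>2) summable_on UNIV"
    "(\<lambda>n. L2sq (\<lambda>x. g x - syn (box_poly a n) x)) \<longlonglongrightarrow> 0"
proof -
  from assms obtain F where F: "F \<in> L_l2" and g: "has_fourier g (\<lambda>u. F (expm u) * fourier \<phi> u)"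
    by (auto simp: V0_def has_mask_def)
  obtain a where a: "(\<lambda>k. (cmod (a k))\<^sup>2) summable_on UNIV"
    "(\<lambda>n. L2sq (\<lambda>u. F (expm u) * fourier \<phi> u - leval (box_poly a n) (expm u) * fourier \<phi> u)) \<longlonglongrightarrow> 0"
    using L_l2_approx[OF F] by blast
  have "(\<lambda>n. L2sq (\<lambda>x. g x - syn (box_poly a n) x)) \<longlonglongrightarrow> 0"
  proof (rule tendsto_sandwich[OF _ _ tendsto_const])
    show "\<forall>\<^sub>F n in sequentially. L2sq (\<lambda>x. g x - syn (box_poly a n) x)
      \<le> 4 * L2sq (\<lambda>u. F (expm u) * fourier \<phi> u - leval (box_poly a n) (expm u) * fourier \<phi> u)"
      by (intro always_eventually allI has_fourier_L2sq_le has_fourier_diff g has_fourier_syn)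
    show "(\<lambda>n. 4 * L2sq (\<lambda>u. F (expm u) * fourier \<phi> u - leval (box_poly a n) (expm u) * fourier \<phi> u)) \<longlonglongrightarrow> 0"
      using ennreal_tendsto_cmult[OF _ a(2), of 4] by simp
  qed simp
  then show thesis using that a by blast
qed

text \<open>Partial sums b of the mask at the coarse level become masks H b(zeta^2) at the fine
  level, by the refinement equation.\<close>

lemma Vm1_approx:
  assumes "g \<in> Vm1 \<phi>"
  obtains b where "(\<lambda>n. L2sq (\<lambda>x. g x - syn (H * ldilate (b n)) x)) \<longlonglongrightarrow> 0"
proof -
  from assms obtain g0 G F where F: "F \<in> L_l2" and g0: "has_fourier g0 (\<lambda>u. F (expm u) * fourier \<phi> u)"
    and G: "has_fourier g0 G" and g: "has_fourier g (\<lambda>u. G (2 *\<^sub>R u))"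
    by (auto simp: Vm1_def V0_def has_mask_def)
  obtain a where a: "(\<lambda>n. L2sq (\<lambda>u. F (expm u) * fourier \<phi> u - leval (box_poly a n) (expm u) * fourier \<phi> u)) \<longlonglongrightarrow> 0"
    using L_l2_approx[OF F] by blast
  have [measurable]: "(\<lambda>u. F (expm u)) \<in> borel_measurable borel" using F by (simp add: L_l2_def)
  \<comment> \<open>\<open>Vm1\<close> allows any transform G of g0, so uniqueness is used to
    replace it by the one given by the mask.\<close>
  have GF: "AE u in lborel. G (2 *\<^sub>R u) = F (expm (2 *\<^sub>R u)) * fourier \<phi> (2 *\<^sub>R u)"
    using AE_lborel_affine[OF has_fourier_image_unique[OF G g0], of 2 0] by simp
  have "(\<lambda>n. L2sq (\<lambda>x. g x - syn (H * ldilate (box_poly a n)) x)) \<longlonglongrightarrow> 0"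
  proof (rule tendsto_sandwich[OF _ _ tendsto_const])
    show "\<forall>\<^sub>F n in sequentially. L2sq (\<lambda>x. g x - syn (H * ldilate (box_poly a n)) x)
      \<le> 4 * L2sq (\<lambda>u. F (expm u) * fourier \<phi> u - leval (box_poly a n) (expm u) * fourier \<phi> u)"
    proof (intro always_eventually allI)
      fix n
      define D where "D u = F (expm u) * fourier \<phi> u - leval (box_poly a n) (expm u) * fourier \<phi> u" for u
      have [measurable]: "D \<in> borel_measurable borel" unfolding D_def[abs_def] by measurable
      have "L2sq (\<lambda>x. g x - syn (H * ldilate (box_poly a n)) x)
          \<le> 4 * L2sq (\<lambda>u. G (2 *\<^sub>R u) - leval (H * ldilate (box_poly a n)) (expm u) * fourier \<phi> u)"
        by (intro has_fourier_L2sq_le has_fourier_diff g has_fourier_syn)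
      also have "L2sq (\<lambda>u. G (2 *\<^sub>R u) - leval (H * ldilate (box_poly a n)) (expm u) * fourier \<phi> u) = L2sq (\<lambda>u. D (2 *\<^sub>R u))"
        by (rule L2sq_cong_AE) (use GF in \<open>eventually_elim, simp add: fourier_H_ldilate D_def\<close>)
      \<comment> \<open>The factor 4 is inserted to match the Jacobian of doubling in the next
        line.\<close>
      also have "L2sq (\<lambda>u. D (2 *\<^sub>R u)) \<le> 4 * L2sq (\<lambda>u. D (2 *\<^sub>R u))"
        using mult_right_mono[of 1 4 "L2sq (\<lambda>u. D (2 *\<^sub>R u))"] by simp
      also have "4 * L2sq (\<lambda>u. D (2 *\<^sub>R u)) = L2sq D"
        unfolding L2sq_def using nn_integral_lborel_affine[of "\<lambda>u. ennreal ((cmod (D u))\<^sup>2)" 2 0] by simp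
      finally show "L2sq (\<lambda>x. g x - syn (H * ldilate (box_poly a n)) x) \<le> 4 * L2sq D"
        by (simp add: mult_left_mono)
    qed
    show "(\<lambda>n. 4 * L2sq (\<lambda>u. F (expm u) * fourier \<phi> u - leval (box_poly a n) (expm u) * fourier \<phi> u)) \<longlonglongrightarrow> 0"
      using ennreal_tendsto_cmult[OF _ a, of 4] by simp
  qed simp
  then show thesis using that[of "box_poly a"] by simp
qed

text \<open>The inner product is the constant coefficient of a polynomial in zeta^2 times Phi
  conj(H) H_s, and the even part of the latter is 0.\<close>

lemma Hs_orthogonal:
  assumes s: "s \<in> E - {(0, 0)}"
  shows "L2inner (syn (ldilate c * Hs s)) (syn (H * ldilate b)) = 0"
proof -
  have "ldilate c * Hs s * lconj (H * ldilate b) * Phi = ldilate (c * lconj b) * (Phi * lconj H * Hs s)"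
    by (simp add: lconj_mult lconj_ldilate ldilate_mult mult_ac)
  then show ?thesis
    by (simp only: L2inner_syn lookup_0_even_part[of "ldilate _ * _"] even_part_ldilate_mult even_part_Phi_H_Hs[OF s]) simp
qed

lemma L2inner_cong_AE:
  assumes "AE x in lborel. f x = f' x" "f \<in> L2" "f' \<in> L2" "g \<in> L2"
  shows "L2inner f g = L2inner f' g"
  unfolding L2inner_def
proof (rule integral_cong_AE)
  have [measurable]: "f \<in> borel_measurable borel" "f' \<in> borel_measurable borel" "g \<in> borel_measurable borel"
    using assms by auto
  show "(\<lambda>x. f x * cnj (g x)) \<in> borel_measurable lborel" "(\<lambda>x. f' x * cnj (g x)) \<in> borel_measurable lborel"
    by measurable
  show "AE x in lborel. f x * cnj (g x) = f' x * cnj (g x)" using assms(1) by eventually_elim simp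
qed

text \<open>Orthogonality to the finite combinations in V_(-1) extends to its limits by
  Cauchy-Schwarz.\<close>

lemma Hs_in_W0:
  assumes s: "s \<in> E - {(0, 0)}" and f: "f \<in> borel_measurable borel" "AE x in lborel. syn (ldilate c * Hs s) x = f x"
  shows "f \<in> W0 \<phi>"
proof -
  let ?p = "ldilate c * Hs s"
  have mask: "has_mask \<phi> f (leval ?p)" by (rule has_mask_syn[OF f])
  then have V0: "f \<in> V0 \<phi>" and f2: "f \<in> L2" by (auto simp: V0_def has_mask_def has_fourier_L2)
  have "L2inner f g = 0" if g: "g \<in> Vm1 \<phi>" for g
  proof -
    have g2: "g \<in> L2" using g by (auto simp: Vm1_def has_fourier_L2)
    have fs: "L2inner f g = L2inner (syn ?p) g"
      using f(2) by (intro L2inner_cong_AE f2 syn_L2 g2) (auto elim: eventually_mono)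
    obtain b where b: "(\<lambda>n. L2sq (\<lambda>x. g x - syn (H * ldilate (b n)) x)) \<longlonglongrightarrow> 0"
      using Vm1_approx[OF g] by blast
    have "ennreal ((cmod (L2inner (syn ?p) g))\<^sup>2) \<le> L2sq (syn ?p) * L2sq (\<lambda>x. g x - syn (H * ldilate (b n)) x)" for n
      using L2inner_Cauchy_Schwarz[OF syn_L2[of ?p] L2_diff[OF g2 syn_L2[of "H * ldilate (b n)"]]]
      by (simp add: L2inner_diff_right[OF syn_L2 g2 syn_L2] Hs_orthogonal[OF s])
    moreover have "(\<lambda>n. L2sq (syn ?p) * L2sq (\<lambda>x. g x - syn (H * ldilate (b n)) x)) \<longlonglongrightarrow> L2sq (syn ?p) * 0"
      using L2_finite[OF syn_L2[of ?p]] by (intro ennreal_tendsto_cmult b) simp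
    ultimately have "ennreal ((cmod (L2inner (syn ?p) g))\<^sup>2) \<le> L2sq (syn ?p) * 0"
      by (intro LIMSEQ_le_const) auto
    then show ?thesis using fs by simp
  qed
  then show ?thesis using V0 by (simp add: W0_def)
qed

text \<open>A shift by 2 k multiplies the mask by zeta^(2k). Sorting the coefficients by s therefore
  turns any finite combination of wavelets into one polynomial mask, the sum of the d_s(zeta^2)
  H_s.\<close>

lemma wavelet_combination:
  assumes \<psi>: "\<And>s. s \<in> E - {(0, 0)} \<Longrightarrow> AE x in lborel. \<psi> s x = syn (Hs s) x"
    and J: "finite J" "J \<subseteq> (E - {(0, 0)}) \<times> UNIV"
    and d: "\<And>s. d s = (\<Sum>k\<in>{k. (s, k) \<in> J}. sg k (c (s, k)))"
  shows "AE x in lborel. (\<Sum>i\<in>J. c i * (case i of (s, k) \<Rightarrow> \<lambda>x. \<psi> s (x - 2 *\<^sub>R lat k)) x)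
      = syn (\<Sum>s\<in>E - {(0, 0)}. ldilate (d s) * Hs s) x"
    and "(\<Sum>i\<in>J. (cmod (c i))\<^sup>2) = (\<Sum>s\<in>E - {(0, 0)}. (norm2 (d s))\<^sup>2)"
proof -
  define K where "K s = {k. (s, k) \<in> J}" for s
  have K: "finite (K s)" for s
    by (rule finite_subset[of _ "snd ` J"]) (auto simp: K_def J(1) intro!: image_eqI)
  have J_eq: "J = Sigma (E - {(0, 0)}) K" using J(2) by (auto simp: K_def)
  have d: "d s = (\<Sum>k\<in>K s. sg k (c (s, k)))" for s by (simp add: d K_def)
  have lkd: "lk (d s) k = (if k \<in> K s then c (s, k) else 0)" for s k
    using K by (simp add: d lookup_sum lookup_single when_def)
  have "(norm2 (d s))\<^sup>2 = (\<Sum>k\<in>K s. (cmod (c (s, k)))\<^sup>2)" for s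
  proof -
    have "norm2 (d s) = L2_set (\<lambda>k. cmod (lk (d s) k)) (K s)"
      by (rule norm2_superset[OF K]) (auto simp: in_keys_iff lkd split: if_splits)
    then show ?thesis by (simp add: L2_set_def sum_nonneg lkd)
  qed
  then show "(\<Sum>i\<in>J. (cmod (c i))\<^sup>2) = (\<Sum>s\<in>E - {(0, 0)}. (norm2 (d s))\<^sup>2)"
    unfolding J_eq using K by (simp add: sum.Sigma case_prod_unfold)
  have "AE x in lborel. \<forall>i\<in>J. \<psi> (fst i) (x - lat (snd i + snd i)) = syn (Hs (fst i)) (x - lat (snd i + snd i))"
    by (rule AE_finite_allI[OF J(1)], rule AE_translate_lborel, rule \<psi>) (use J(2) in auto)
  then show "AE x in lborel. (\<Sum>i\<in>J. c i * (case i of (s, k) \<Rightarrow> \<lambda>x. \<psi> s (x - 2 *\<^sub>R lat k)) x)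
      = syn (\<Sum>s\<in>E - {(0, 0)}. ldilate (d s) * Hs s) x"
  proof eventually_elim
    case (elim x)
    have two: "2 *\<^sub>R lat k = lat (k + k)" for k by (simp add: lat_add scaleR_2)
    have "(\<Sum>i\<in>J. c i * (case i of (s, k) \<Rightarrow> \<lambda>x. \<psi> s (x - 2 *\<^sub>R lat k)) x)
        = (\<Sum>i\<in>J. syn (sg (snd i + snd i) (c i) * Hs (fst i)) x)"
    proof (rule sum.cong[OF refl])
      fix i assume "i \<in> J"
      then show "c i * (case i of (s, k) \<Rightarrow> \<lambda>x. \<psi> s (x - 2 *\<^sub>R lat k)) x = syn (sg (snd i + snd i) (c i) * Hs (fst i)) x"
        using elim by (cases i) (auto simp: syn_single_times two)
    qed
    also have "\<dots> = (\<Sum>s\<in>E - {(0, 0)}. \<Sum>k\<in>K s. syn (sg (k + k) (c (s, k)) * Hs s) x)"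
      unfolding J_eq using K by (simp add: sum.Sigma case_prod_unfold)
    also have "\<dots> = syn (\<Sum>s\<in>E - {(0, 0)}. ldilate (d s) * Hs s) x"
      by (simp add: syn_sum d ldilate_sum ldilate_single sum_distrib_right)
    finally show ?case .
  qed
qed

lemma wavelet_measurable: "has_mask \<phi> f F \<Longrightarrow> f \<in> borel_measurable borel"
  by (auto simp: has_mask_def dest: has_fourier_L2)

lemma wavelet_translate_W0:
  assumes s: "s \<in> E - {(0, 0)}" and f: "has_mask \<phi> f (leval (Hs s))"
  shows "(\<lambda>x. f (x - 2 *\<^sub>R lat k)) \<in> W0 \<phi>"
proof (rule Hs_in_W0[OF s, where c = "sg k 1"])
  have [measurable]: "f \<in> borel_measurable borel" by (rule wavelet_measurable[OF f])
  show "(\<lambda>x. f (x - 2 *\<^sub>R lat k)) \<in> borel_measurable borel" by measurable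
  have "AE x in lborel. f (x - lat (k + k)) = syn (Hs s) (x - lat (k + k))"
    by (rule AE_translate_lborel[OF has_mask_leval_AE[OF f]])
  then show "AE x in lborel. syn (ldilate (sg k 1) * Hs s) x = f (x - 2 *\<^sub>R lat k)"
    by eventually_elim (simp add: ldilate_single syn_single_times lat_add scaleR_2)
qed

lemma wavelet_riesz_bounds:
  assumes \<psi>: "\<And>s. s \<in> E - {(0, 0)} \<Longrightarrow> AE x in lborel. \<psi> s x = syn (Hs s) x"
  shows "\<exists>A B :: real. 0 < A \<and> 0 < B \<and> (\<forall>J c. finite J \<and> J \<subseteq> (E - {(0, 0)}) \<times> UNIV \<longrightarrow>
     ennreal (A * (\<Sum>i\<in>J. (cmod (c i))\<^sup>2))
       \<le> L2sq (\<lambda>x. \<Sum>i\<in>J. c i * (case i of (s, k) \<Rightarrow> \<lambda>x. \<psi> s (x - 2 *\<^sub>R lat k)) x) \<and>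
     L2sq (\<lambda>x. \<Sum>i\<in>J. c i * (case i of (s, k) \<Rightarrow> \<lambda>x. \<psi> s (x - 2 *\<^sub>R lat k)) x)
       \<le> ennreal (B * (\<Sum>i\<in>J. (cmod (c i))\<^sup>2)))"
proof -
  let ?S = "E - {(0, 0)}"
  have cardS: "card ?S = 3" by (simp add: E_eq)
  obtain \<kappa> where \<kappa>: "0 \<le> \<kappa>" "\<And>c s. s \<in> ?S \<Longrightarrow> norm2 (c s) \<le> \<kappa> * norm2 (\<Sum>t\<in>?S. ldilate (c t) * Hs t)"
    using Hs_combination_lower by blast
  obtain M where M: "0 \<le> M" "\<And>c. norm2 (\<Sum>t\<in>?S. ldilate (c t) * Hs t) \<le> M * (\<Sum>t\<in>?S. norm2 (c t))"
    using Hs_combination_upper by blast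
  obtain \<mu> where \<mu>: "0 < \<mu>" "\<And>p. ennreal ((norm2 p)\<^sup>2) \<le> ennreal \<mu> * L2sq (syn p)"
    using L2sq_syn_ge by blast
  \<comment> \<open>3 is the number of wavelets; the 1 keeps the denominator positive even when
    \<kappa> = 0.\<close>
  define A where "A = 1 / (3 * \<kappa>\<^sup>2 * \<mu> + 1)"
  define B where "B = norm1 Phi * (M\<^sup>2 * 3) + 1"
  have pos: "0 < 3 * \<kappa>\<^sup>2 * \<mu> + 1" using \<mu>(1) by (intro add_nonneg_pos) auto
  have A: "0 < A" using pos by (simp add: A_def)
  have B: "0 < B" by (simp add: B_def add_nonneg_pos)
  have low: "ennreal (A * (\<Sum>i\<in>J. (cmod (c i))\<^sup>2))
       \<le> L2sq (\<lambda>x. \<Sum>i\<in>J. c i * (case i of (s, k) \<Rightarrow> \<lambda>x. \<psi> s (x - 2 *\<^sub>R lat k)) x)" (is "?low")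
    and up: "L2sq (\<lambda>x. \<Sum>i\<in>J. c i * (case i of (s, k) \<Rightarrow> \<lambda>x. \<psi> s (x - 2 *\<^sub>R lat k)) x)
       \<le> ennreal (B * (\<Sum>i\<in>J. (cmod (c i))\<^sup>2))" (is "?up")
    if J: "finite J" "J \<subseteq> ?S \<times> UNIV" for J c
  proof -
    define d where "d s = (\<Sum>k\<in>{k. (s, k) \<in> J}. sg k (c (s, k)))" for s
    define P where "P = (\<Sum>s\<in>?S. ldilate (d s) * Hs s)"
    define X where "X = (\<Sum>s\<in>?S. (norm2 (d s))\<^sup>2)"
    note comb = wavelet_combination[OF \<psi> J d_def]
    have L2: "L2sq (\<lambda>x. \<Sum>i\<in>J. c i * (case i of (s, k) \<Rightarrow> \<lambda>x. \<psi> s (x - 2 *\<^sub>R lat k)) x) = L2sq (syn P)"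
      unfolding P_def by (rule L2sq_cong_AE[OF comb(1)])
    have X: "(\<Sum>i\<in>J. (cmod (c i))\<^sup>2) = X" unfolding X_def by (rule comb(2))
    define L where "L = (\<integral>t. (cmod (syn P t))\<^sup>2 \<partial>lborel)"
    have L: "L2sq (syn P) = ennreal L" "0 \<le> L" by (simp_all add: L_def L2sq_integral[OF syn_L2])
    have X0: "0 \<le> X" by (simp add: X_def sum_nonneg)
    have "(norm2 P)\<^sup>2 \<le> \<mu> * L"
      using \<mu>(2)[of P] \<mu>(1) L by (simp flip: ennreal_mult)
    have "X \<le> (\<Sum>s\<in>?S. (\<kappa> * norm2 P)\<^sup>2)"
      unfolding X_def P_def by (intro sum_mono power_mono \<kappa>(2)) auto
    also have "\<dots> = 3 * \<kappa>\<^sup>2 * (norm2 P)\<^sup>2" using cardS by (simp add: power_mult_distrib)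
    also have "\<dots> \<le> 3 * \<kappa>\<^sup>2 * (\<mu> * L)" by (intro mult_left_mono \<open>(norm2 P)\<^sup>2 \<le> \<mu> * L\<close>) auto
    also have "\<dots> \<le> (3 * \<kappa>\<^sup>2 * \<mu> + 1) * L" using L(2) by (simp add: algebra_simps)
    finally have "A * X \<le> L" using pos by (simp add: A_def field_simps)
    then show ?low unfolding L2 X L(1) by (rule ennreal_leI)
    have "(\<Sum>s\<in>?S. norm2 (d s))\<^sup>2 \<le> 3 * X"
      using sum_squared_le_sum_of_squares[of "\<lambda>s. norm2 (d s)" ?S] cardS by (simp add: X_def)
    moreover have "(norm2 P)\<^sup>2 \<le> (M * (\<Sum>s\<in>?S. norm2 (d s)))\<^sup>2"
      unfolding P_def by (intro power_mono M(2)) simp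
    ultimately have "(norm2 P)\<^sup>2 \<le> M\<^sup>2 * (3 * X)"
      by (simp only: power_mult_distrib) (meson mult_left_mono order_trans zero_le_power2)
    then have "norm1 Phi * (norm2 P)\<^sup>2 \<le> norm1 Phi * (M\<^sup>2 * (3 * X))" by (intro mult_left_mono) auto
    also have "\<dots> \<le> B * X" using X0 by (simp add: B_def algebra_simps)
    finally show ?up unfolding L2 X by (rule order_trans[OF L2sq_syn_le ennreal_leI])
  qed
  show ?thesis
    by (intro exI[of _ A] exI[of _ B] conjI allI impI A B; elim conjE) (rule low up; assumption)+
qed

text \<open>With e the pairing of p with W, \<open>syn (H * ldilate e)\<close> lies in V_(-1), and c
  times its inner product with \<open>syn p\<close> is |e|_2^2. Being orthogonal to g, it may be
  paired with g - \<open>syn p\<close> instead up to sign; Cauchy-Schwarz then leaves a factor |e|_2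
  to cancel.\<close>

lemma W0_pairing_le:
  assumes g: "g \<in> W0 \<phi>"
  shows "ennreal ((norm2 (even_part (HPhi * p)))\<^sup>2)
    \<le> ennreal ((2 ^ 6 * 362880)\<^sup>2 * (norm1 Phi * (norm1 H)\<^sup>2)) * L2sq (\<lambda>x. g x - syn p x)"
proof -
  define e where "e = even_part (HPhi * p)"
  let ?h = "H * ldilate e"
  have g2: "g \<in> L2" using g by (auto simp: W0_def V0_def has_mask_def has_fourier_L2)
  have "L2inner g (syn ?h) = 0" using g syn_Vm1[of e] by (simp add: W0_def)
  then have "L2inner (\<lambda>x. g x - syn p x) (syn ?h) = - L2inner (syn p) (syn ?h)"
    by (simp add: L2inner_diff_left g2 syn_L2)
  moreover have "of_real ((norm2 e)\<^sup>2) = 2 ^ 6 * 362880 * L2inner (syn p) (syn ?h)"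
  proof -
    have "of_real ((norm2 e)\<^sup>2) = lk (lconj e * even_part (HPhi * p)) 0"
      unfolding norm2_power2 by (simp add: e_def mult.commute)
    also have "\<dots> = lk (even_part (ldilate (lconj e) * (HPhi * p))) 0"
      by (simp only: even_part_ldilate_mult)
    also have "\<dots> = lk (ldilate (lconj e) * (HPhi * p)) 0" by (simp only: lookup_even_part add_0_left)
    also have "ldilate (lconj e) * (HPhi * p) = C (2 ^ 6 * 362880) * (p * lconj ?h * Phi)"
      by (simp add: lconj_mult lconj_ldilate lconj_C mult_ac)
    finally show ?thesis by (simp only: C_def lookup_single_times L2inner_syn diff_zero)
  qed
  ultimately have eq: "of_real ((norm2 e)\<^sup>2) = - (2 ^ 6 * 362880 * L2inner (\<lambda>x. g x - syn p x) (syn ?h))"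
    by simp
  have "(norm2 e)\<^sup>2 = cmod (of_real ((norm2 e)\<^sup>2))" by (simp only: norm_of_real) simp
  also have "\<dots> = 2 ^ 6 * 362880 * cmod (L2inner (\<lambda>x. g x - syn p x) (syn ?h))"
    by (simp only: eq norm_minus_cancel norm_mult) simp
  finally have "(norm2 e)\<^sup>2 = 2 ^ 6 * 362880 * cmod (L2inner (\<lambda>x. g x - syn p x) (syn ?h))" .
  then have "((norm2 e)\<^sup>2)\<^sup>2 = (2 ^ 6 * 362880)\<^sup>2 * (cmod (L2inner (\<lambda>x. g x - syn p x) (syn ?h)))\<^sup>2"
    by (simp only: power_mult_distrib)
  then have "ennreal (((norm2 e)\<^sup>2)\<^sup>2) = ennreal ((2 ^ 6 * 362880)\<^sup>2) * ennreal ((cmod (L2inner (\<lambda>x. g x - syn p x) (syn ?h)))\<^sup>2)"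
    by (simp only: ennreal_mult zero_le_power2)
  also have "\<dots> \<le> ennreal ((2 ^ 6 * 362880)\<^sup>2) * (L2sq (\<lambda>x. g x - syn p x) * L2sq (syn ?h))"
    by (intro mult_left_mono L2inner_Cauchy_Schwarz L2_diff g2 syn_L2) simp
  also have "\<dots> \<le> ennreal ((2 ^ 6 * 362880)\<^sup>2) * (L2sq (\<lambda>x. g x - syn p x) * ennreal (norm1 Phi * (norm1 H * norm2 e)\<^sup>2))"
  proof (intro mult_left_mono)
    have "L2sq (syn ?h) \<le> ennreal (norm1 Phi * (norm2 ?h)\<^sup>2)" by (rule L2sq_syn_le)
    also have "\<dots> \<le> ennreal (norm1 Phi * (norm1 H * norm2 e)\<^sup>2)"
      using norm2_mult[of H "ldilate e"] by (intro ennreal_leI mult_left_mono power_mono) auto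
    finally show "L2sq (syn ?h) \<le> ennreal (norm1 Phi * (norm1 H * norm2 e)\<^sup>2)" .
  qed auto
  finally have le: "ennreal (((norm2 e)\<^sup>2)\<^sup>2) \<le> ennreal ((2 ^ 6 * 362880)\<^sup>2) * (L2sq (\<lambda>x. g x - syn p x) * ennreal (norm1 Phi * (norm1 H * norm2 e)\<^sup>2))" .
  define L where "L = (\<integral>t. (cmod (g t - syn p t))\<^sup>2 \<partial>lborel)"
  have L: "L2sq (\<lambda>x. g x - syn p x) = ennreal L" "0 \<le> L"
    using L2sq_integral[OF L2_diff[OF g2 syn_L2[of p]]] by (simp_all add: L_def)
  define a :: real where "a = (2 ^ 6 * 362880)\<^sup>2"
  have a: "0 \<le> a" by (simp add: a_def)
  have "ennreal (((norm2 e)\<^sup>2)\<^sup>2) \<le> ennreal (a * (L * (norm1 Phi * (norm1 H * norm2 e)\<^sup>2)))"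
    using le L a unfolding a_def[symmetric] by (simp add: ennreal_mult)
  then have "((norm2 e)\<^sup>2)\<^sup>2 \<le> a * (L * (norm1 Phi * (norm1 H * norm2 e)\<^sup>2))"
    using L a by simp
  then have "(norm2 e)\<^sup>2 * (norm2 e)\<^sup>2 \<le> (a * (norm1 Phi * (norm1 H)\<^sup>2) * L) * (norm2 e)\<^sup>2"
    by (simp add: power2_eq_square mult_ac)
  moreover have "0 \<le> a * (norm1 Phi * (norm1 H)\<^sup>2) * L" using L a by simp
  ultimately have "(norm2 e)\<^sup>2 \<le> a * (norm1 Phi * (norm1 H)\<^sup>2) * L"
    by (rule mult_self_le_cancel[OF _ zero_le_power2])
  then have "ennreal ((norm2 e)\<^sup>2) \<le> ennreal (a * (norm1 Phi * (norm1 H)\<^sup>2)) * ennreal L"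
    using a L by (simp add: ennreal_leI flip: ennreal_mult)
  then show ?thesis unfolding e_def L(1) a_def .
qed

lemma norm2_box_poly_bounded:
  assumes "(\<lambda>k. (cmod (a k))\<^sup>2) summable_on UNIV"
  obtains A where "0 \<le> A" "\<And>n. norm2 (box_poly a n) \<le> A"
proof -
  define A where "A = sqrt (\<Sum>\<^sub>\<infinity>k. (cmod (a k))\<^sup>2)"
  have "norm2 (box_poly a n) \<le> A" for n
  proof -
    let ?S = "{-int n..int n} \<times> {-int n..int n}"
    have "norm2 (box_poly a n) = L2_set (\<lambda>k. cmod (lk (box_poly a n) k)) ?S"
      by (rule norm2_superset) (auto simp: in_keys_iff lookup_box_poly split: if_splits)
    also have "\<dots> = sqrt (\<Sum>k\<in>?S. (cmod (a k))\<^sup>2)"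
      unfolding L2_set_def by (intro arg_cong[where f = sqrt] sum.cong) (auto simp: lookup_box_poly)
    also have "\<dots> \<le> A"
      unfolding A_def by (intro real_sqrt_le_mono finite_sum_le_infsum assms) auto
    finally show ?thesis .
  qed
  moreover have "0 \<le> A" by (simp add: A_def infsum_nonneg)
  ultimately show thesis using that by blast
qed

text \<open>The error of \<open>Hs_combination_approx\<close> has two parts: (1 - v w_(0,0)) p_n is
  small uniformly in n since the partial sums p_n are bounded in l_2, and v times the pairing of p_n
  tends to 0 by \<open>W0_pairing_le\<close>.\<close>

lemma wavelet_dense:
  assumes \<psi>: "\<And>s. s \<in> E - {(0, 0)} \<Longrightarrow> AE x in lborel. \<psi> s x = syn (Hs s) x"
    and g: "g \<in> W0 \<phi>" and \<epsilon>: "0 < (\<epsilon> :: real)"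
  shows "\<exists>J c. finite J \<and> J \<subseteq> (E - {(0, 0)}) \<times> UNIV \<and>
    L2sq (\<lambda>x. g x - (\<Sum>i\<in>J. c i * (case i of (s, k) \<Rightarrow> \<lambda>x. \<psi> s (x - 2 *\<^sub>R lat k)) x)) < ennreal \<epsilon>"
proof -
  let ?S = "E - {(0, 0)}"
  have g2: "g \<in> L2" using g by (auto simp: W0_def V0_def has_mask_def has_fourier_L2)
  then have [measurable]: "g \<in> borel_measurable borel" by auto
  have "g \<in> V0 \<phi>" using g by (simp add: W0_def)
  then obtain a where a: "(\<lambda>k. (cmod (a k))\<^sup>2) summable_on UNIV"
    and lim: "(\<lambda>n. L2sq (\<lambda>x. g x - syn (box_poly a n) x)) \<longlonglongrightarrow> 0"
    using V0_approx by blast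
  obtain A where A: "0 \<le> A" "\<And>n. norm2 (box_poly a n) \<le> A" using norm2_box_poly_bounded[OF a] by blast
  define K where "K = norm1 Phi"
  have K: "0 \<le> K" by (simp add: K_def)
  \<comment> \<open>Makes 4 K (\<eta> A)^2 smaller than \<epsilon>; this is the limit of the error
    bound as n grows. The 1 keeps the denominator positive when K or A is 0.\<close>
  define \<eta> where "\<eta> = sqrt (\<epsilon> / (4 * (4 * K * A\<^sup>2 + 1)))"
  have den: "0 < 4 * K * A\<^sup>2 + 1" using K by (intro add_nonneg_pos) auto
  then have \<eta>: "0 < \<eta>" using \<epsilon> by (simp add: \<eta>_def)
  have small: "4 * K * (\<eta> * A)\<^sup>2 < \<epsilon>"
  proof -
    have "\<eta>\<^sup>2 * (4 * (4 * K * A\<^sup>2 + 1)) = \<epsilon>" using \<epsilon> den by (simp add: \<eta>_def)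
    moreover have "4 * K * (\<eta> * A)\<^sup>2 = \<eta>\<^sup>2 * (4 * K * A\<^sup>2)" by (simp add: power_mult_distrib)
    moreover have "\<eta>\<^sup>2 * (4 * K * A\<^sup>2) < \<eta>\<^sup>2 * (4 * (4 * K * A\<^sup>2 + 1))"
    proof (rule mult_strict_left_mono)
      have "0 \<le> 4 * K * A\<^sup>2" using K by simp
      moreover have "y < 4 * (y + 1)" if "0 \<le> y" for y :: real
        using add_nonneg_pos[of "3 * y" 4] that by (simp add: distrib_left)
      ultimately show "4 * K * A\<^sup>2 < 4 * (4 * K * A\<^sup>2 + 1)" by blast
    qed (use \<eta> in simp)
    ultimately show ?thesis by linarith
  qed
  obtain P q where Pq: "P \<in> Ldown" "P * w00 = 1 - q" "norm1 q < 1" using w00_inverse by blast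
  obtain N where N: "norm1 (1 - (P * (\<Sum>n<N. q ^ n)) * w00) < \<eta>"
    using approx_inverse[OF Pq(2,3) \<eta>] by blast
  define v where "v = P * (\<Sum>n<N. q ^ n)"
  have w: "w00 \<in> Ldown" using w_Ldown[of "(0, 0)"] by (simp add: w_def)
  have one: "1 \<in> Ldown" by (simp add: Ldown_iff lookup_one when_def even_pt_def zero_prod_def)
  \<comment> \<open>The error q inherits even exponents from P and \<open>w00\<close>, so the
    truncated inverse v stays in the dilated ring.\<close>
  have "q = 1 - P * w00" using Pq(2) by simp
  then have q: "q \<in> Ldown" by (simp add: Ldown_diff Ldown_mult Pq(1) w one)
  have "q ^ n \<in> Ldown" for n by (induction n) (simp_all add: one Ldown_mult q)
  then have "(\<Sum>n<N. q ^ n) \<in> Ldown" by (induction N) (simp_all add: Ldown_add, simp add: Ldown_iff)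
  then have v: "v \<in> Ldown" by (simp add: v_def Ldown_mult Pq(1))
  define e where "e n = even_part (HPhi * box_poly a n)" for n
  define d where "d n s = - (component s (box_poly a n) * even_part v)" for n s
  define Q where "Q n = (\<Sum>s\<in>?S. ldilate (d n s) * Hs s)" for n
  define D where "D n = L2sq (\<lambda>x. g x - syn (box_poly a n) x)" for n
  define V where "V = norm1 v"
  have diff: "box_poly a n - Q n = (1 - v * w00) * box_poly a n + v * ldilate (e n)" for n
    unfolding Q_def d_def e_def by (rule Hs_combination_approx[OF v])
  have nd: "norm2 (box_poly a n - Q n) \<le> \<eta> * A + V * norm2 (e n)" for n
  proof -
    have "norm2 (box_poly a n - Q n) \<le> norm1 (1 - v * w00) * norm2 (box_poly a n) + norm1 v * norm2 (ldilate (e n))"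
      unfolding diff by (intro order_trans[OF norm2_add] add_mono norm2_mult)
    also have "\<dots> \<le> \<eta> * A + V * norm2 (e n)"
      using N A \<eta> by (intro add_mono mult_mono) (auto simp: v_def V_def)
    finally show ?thesis .
  qed
  have bound: "L2sq (\<lambda>x. g x - syn (Q n) x)
      \<le> 2 * D n + (ennreal (4 * K * (\<eta> * A)\<^sup>2) + ennreal (4 * K * V\<^sup>2) * ennreal ((norm2 (e n))\<^sup>2))" for n
  proof -
    have "L2sq (\<lambda>x. g x - syn (Q n) x) = L2sq (\<lambda>x. (g x - syn (box_poly a n) x) + syn (box_poly a n - Q n) x)"
      by (simp add: syn_diff)
    also have "\<dots> \<le> 2 * D n + 2 * L2sq (syn (box_poly a n - Q n))"
      unfolding D_def by (rule L2sq_add) measurable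
    also have "\<dots> \<le> 2 * D n + 2 * ennreal (K * (norm2 (box_poly a n - Q n))\<^sup>2)"
      unfolding K_def by (intro add_left_mono mult_left_mono L2sq_syn_le) simp
    also have "\<dots> \<le> 2 * D n + ennreal (4 * K * (\<eta> * A)\<^sup>2 + 4 * K * V\<^sup>2 * (norm2 (e n))\<^sup>2)"
    proof (rule add_left_mono)
      have "(norm2 (box_poly a n - Q n))\<^sup>2 \<le> (\<eta> * A + V * norm2 (e n))\<^sup>2"
        by (intro power_mono nd) simp
      also have "\<dots> \<le> 2 * (\<eta> * A)\<^sup>2 + 2 * (V * norm2 (e n))\<^sup>2"
        using sum_squares_bound[of "\<eta> * A" "V * norm2 (e n)"] by (simp add: power2_sum)
      finally have "2 * (K * (norm2 (box_poly a n - Q n))\<^sup>2) \<le> 2 * (K * (2 * (\<eta> * A)\<^sup>2 + 2 * (V * norm2 (e n))\<^sup>2))"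
        using K by (intro mult_left_mono) auto
      also have "\<dots> = 4 * K * (\<eta> * A)\<^sup>2 + 4 * K * V\<^sup>2 * (norm2 (e n))\<^sup>2"
        by (simp add: power_mult_distrib algebra_simps)
      finally have "ennreal (2 * (K * (norm2 (box_poly a n - Q n))\<^sup>2)) \<le> ennreal (4 * K * (\<eta> * A)\<^sup>2 + 4 * K * V\<^sup>2 * (norm2 (e n))\<^sup>2)"
        by (rule ennreal_leI)
      moreover have "ennreal (2 * t) = 2 * ennreal t" for t by (simp add: ennreal_mult')
      ultimately show "2 * ennreal (K * (norm2 (box_poly a n - Q n))\<^sup>2) \<le> ennreal (4 * K * (\<eta> * A)\<^sup>2 + 4 * K * V\<^sup>2 * (norm2 (e n))\<^sup>2)"
        by (simp only:)
    qed
    finally show ?thesis using K by (simp add: ennreal_mult)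
  qed
  have e_lim: "(\<lambda>n. ennreal ((norm2 (e n))\<^sup>2)) \<longlonglongrightarrow> 0"
  proof (rule tendsto_sandwich[OF _ _ tendsto_const])
    show "\<forall>\<^sub>F n in sequentially. ennreal ((norm2 (e n))\<^sup>2)
        \<le> ennreal ((2 ^ 6 * 362880)\<^sup>2 * (norm1 Phi * (norm1 H)\<^sup>2)) * D n"
      unfolding e_def D_def by (intro always_eventually allI W0_pairing_le g)
    show "(\<lambda>n. ennreal ((2 ^ 6 * 362880)\<^sup>2 * (norm1 Phi * (norm1 H)\<^sup>2)) * D n) \<longlonglongrightarrow> 0"
      using ennreal_tendsto_cmult[OF _ lim, of "ennreal ((2 ^ 6 * 362880)\<^sup>2 * (norm1 Phi * (norm1 H)\<^sup>2))"]
      ennreal_less_top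
      unfolding D_def mult_zero_right by blast
  qed simp
  have "(\<lambda>n. 2 * D n + (ennreal (4 * K * (\<eta> * A)\<^sup>2) + ennreal (4 * K * V\<^sup>2) * ennreal ((norm2 (e n))\<^sup>2)))
      \<longlonglongrightarrow> 2 * 0 + (ennreal (4 * K * (\<eta> * A)\<^sup>2) + ennreal (4 * K * V\<^sup>2) * 0)"
    unfolding D_def by (intro tendsto_add tendsto_const ennreal_tendsto_cmult lim e_lim) auto
  moreover have "2 * 0 + (ennreal (4 * K * (\<eta> * A)\<^sup>2) + ennreal (4 * K * V\<^sup>2) * 0) < ennreal \<epsilon>"
    using small K by (simp add: ennreal_lessI \<epsilon>)
  ultimately have "\<forall>\<^sub>F n in sequentially. 2 * D n + (ennreal (4 * K * (\<eta> * A)\<^sup>2) + ennreal (4 * K * V\<^sup>2) * ennreal ((norm2 (e n))\<^sup>2)) < ennreal \<epsilon>"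
    by (rule order_tendstoD(2))
  then obtain n where "2 * D n + (ennreal (4 * K * (\<eta> * A)\<^sup>2) + ennreal (4 * K * V\<^sup>2) * ennreal ((norm2 (e n))\<^sup>2)) < ennreal \<epsilon>"
    by (auto simp: eventually_sequentially)
  with bound[of n] have close: "L2sq (\<lambda>x. g x - syn (Q n) x) < ennreal \<epsilon>" by (rule order_le_less_trans)
  \<comment> \<open>The finite family of wavelets is read off from the supports of the coefficient
    polynomials \<open>d n s\<close>.\<close>
  define J where "J = Sigma ?S (\<lambda>s. Poly_Mapping.keys (d n s))"
  define c where "c i = lk (d n (fst i)) (snd i)" for i
  define d' where "d' s = (\<Sum>k\<in>{k. (s, k) \<in> J}. sg k (c (s, k)))" for s
  have J: "finite J" "J \<subseteq> ?S \<times> UNIV" by (auto simp: J_def)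
  have "d' s = d n s" if "s \<in> ?S" for s
  proof -
    have "{k. (s, k) \<in> J} = Poly_Mapping.keys (d n s)" using that by (auto simp: J_def)
    then show ?thesis using lpoly_sum_single[of "Poly_Mapping.keys (d n s)" "d n s"] by (simp add: d'_def c_def)
  qed
  then have Q: "(\<Sum>s\<in>?S. ldilate (d' s) * Hs s) = Q n" unfolding Q_def by (intro sum.cong) auto
  have "AE x in lborel. (\<Sum>i\<in>J. c i * (case i of (s, k) \<Rightarrow> \<lambda>x. \<psi> s (x - 2 *\<^sub>R lat k)) x) = syn (Q n) x"
    using wavelet_combination(1)[OF \<psi> J d'_def] unfolding Q .
  then have "L2sq (\<lambda>x. g x - (\<Sum>i\<in>J. c i * (case i of (s, k) \<Rightarrow> \<lambda>x. \<psi> s (x - 2 *\<^sub>R lat k)) x)) = L2sq (\<lambda>x. g x - syn (Q n) x)"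
    by (intro L2sq_cong_AE) (auto elim: eventually_mono)
  then show ?thesis using close J by (intro exI[of _ J] exI[of _ c]) simp
qed

lemma prewavelets_Hs:
  assumes \<psi>: "\<forall>s\<in>E - {(0, 0)}. has_mask \<phi> (\<psi> s) (leval (Hs s))"
  shows "(\<forall>s\<in>E - {(0, 0)}. compactly_supported (\<psi> s)) \<and> prewavelets \<phi> (E - {(0, 0)}) \<psi>"
proof
  have AE: "AE x in lborel. \<psi> s x = syn (Hs s) x" if "s \<in> E - {(0, 0)}" for s
    using \<psi> that by (intro has_mask_leval_AE) blast
  show "\<forall>s\<in>E - {(0, 0)}. compactly_supported (\<psi> s)"
  proof
    fix s assume s: "s \<in> E - {(0, 0)}"
    obtain R where "AE x in lborel. R < norm x \<longrightarrow> syn (Hs s) x = 0" using syn_support by blast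
    then have "AE x in lborel. x \<notin> cball 0 R \<longrightarrow> \<psi> s x = 0"
      using AE[OF s] by eventually_elim (simp add: mem_cball not_le)
    then show "compactly_supported (\<psi> s)" unfolding compactly_supported_def by (intro exI[of _ "cball 0 R"]) simp
  qed
  have tr: "(\<lambda>x. \<psi> s (x - 2 *\<^sub>R lat k)) \<in> W0 \<phi>" if "s \<in> E - {(0, 0)}" for s k
    using \<psi> that by (intro wavelet_translate_W0) auto
  have W0: "\<psi> s \<in> W0 \<phi>" if "s \<in> E - {(0, 0)}" for s
    using tr[OF that, of 0] by (simp add: lat_def flip: zero_prod_def)
  have "riesz_basis (W0 \<phi>) ((E - {(0, 0)}) \<times> UNIV) (\<lambda>(s, k) x. \<psi> s (x - 2 *\<^sub>R lat k))"
    unfolding riesz_basis_def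
  proof (intro conjI ballI allI impI)
    show "(case i of (s, k) \<Rightarrow> \<lambda>x. \<psi> s (x - 2 *\<^sub>R lat k)) \<in> W0 \<phi>" if "i \<in> (E - {(0, 0)}) \<times> UNIV" for i
      using tr that by (cases i) auto
  qed (rule wavelet_riesz_bounds[OF AE] wavelet_dense[OF AE]; assumption)+
  then show "prewavelets \<phi> (E - {(0, 0)}) \<psi>"
    unfolding prewavelets_def using W0 by simp
qed

end

theorem mainTheorem8:
  fixes \<phi> :: "real \<times> real \<Rightarrow> complex"
  assumes "is_box_spline Xi \<phi>"
  shows
    "H = C (1 / 2 ^ 6) * (1 + mon 1 0) ^ 2 * (1 + mon 0 1) ^ 2 * (1 + mon 1 0 * mon 0 1) ^ 2
   \<and> (\<forall>k. autocorr \<phi> (lat k) = Poly_Mapping.lookup Phi k)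
   \<and> (\<forall>v :: nat \<times> nat \<Rightarrow> lpoly.
        ((\<forall>s\<in>E. v s \<in> Ldown) \<and>
         lconj (C (2 ^ 6 * 362880) * H) * Phi
           = v (0, 0) + v (1, 0) * mon (-1) 0 + v (0, 1) * mon 0 (-1) + v (1, 1) * mon (-1) (-1))
        \<longleftrightarrow> (\<forall>s\<in>E. v s = w s))
   \<and> torus_basis Ldown_l1 L_l1 E (\<lambda>s. leval (Hs s))
   \<and> (\<forall>s\<in>E - {(0, 0)}. \<forall>\<zeta>\<in>torus. bracket (leval Phi) (leval H) (leval (Hs s)) \<zeta> = 0)
   \<and> (\<exists>\<psi>. \<forall>s\<in>E - {(0, 0)}. has_mask \<phi> (\<psi> s) (leval (Hs s)))
   \<and> (\<forall>\<psi>. (\<forall>s\<in>E - {(0, 0)}. has_mask \<phi> (\<psi> s) (leval (Hs s))) \<longrightarrow>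
        (\<forall>s\<in>E - {(0, 0)}. compactly_supported (\<psi> s)) \<and> prewavelets \<phi> (E - {(0, 0)}) \<psi>)
   \<and> H01 = lswap H10
   \<and> card (Poly_Mapping.keys H10) = 43
   \<and> card (Poly_Mapping.keys H01) = 43
   \<and> card (Poly_Mapping.keys H11) = 43
   \<and> card (Poly_Mapping.keys H10) + card (Poly_Mapping.keys H01) + card (Poly_Mapping.keys H11) = 129"
proof -
  interpret box_spline_Xi \<phi> using assms by unfold_locales
  \<comment> \<open>The finite combinations with coefficients from H_s are themselves functions with
    these masks.\<close>
  have ex: "\<exists>\<psi>. \<forall>s\<in>E - {(0, 0)}. has_mask \<phi> (\<psi> s) (leval (Hs s))"
    using has_mask_syn[of "syn (Hs _)" "Hs _"] by (intro exI[of _ "\<lambda>s. syn (Hs s)"]) simp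
  show ?thesis
    by (intro conjI, intro H_factors, intro allI autocorr_eq_Phi, intro allI, rule HPhi_split_iff,
        rule torus_basis_Hs, intro ballI, rule bracket_Hs, assumption, assumption, rule ex,
        intro allI impI, erule prewavelets_Hs, rule H01_eq)
       (simp_all add: card_keys_H10 card_keys_H01 card_keys_H11)
qed

end
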